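(* Let $\{X^i_t : i\in I_t,\ t\ge0\}$ be the branching Lévy process described in the context, with underlying real-valued Lévy process $X$ whose cumulant generating function $K$ is finite in a neighbourhood of $\theta=0$, with constant branching rate $\lambda>0$ and with offspring number $N$ of finite mean whose distribution does not depend on the position of the particles. Let $\mu=\mathbb E(N)-1$ be the mean net number of new particles created at a branching event and suppose $\mu>0$. Then, conditional on the event $\{I_t\neq\emptyset\text{ for all }t\ge0\}$ that the branching Lévy process never becomes extinct, $$\frac1t\max_{i\in I_t}X^i_t\ \longrightarrow\ \inf_{\theta>0}\frac{K(\theta)+\lambda\mu}{\theta}\quad\text{in probability as }t\to\infty .$$
   Context: Branching Lévy process: initially there is one particle at a point $x_0\in\mathbb R$, which moves as a given real-valued Lévy process $X$ started from $X_0=x_0$. At a random time $T>0$, independent of $X$ with $\mathbb P(T>t)=e^{-\lambda t}$ for all $t\ge 0$, the particle is killed and replaced with a random number $N\in\{0,1,2,\dots\}$ of particles, where $N$ is independent of $X$ and $T$. Each of the new particles moves and branches as an independent copy of the initial particle, started from the final position $X_T$ of the initial particle. $I_t$ denotes the set of particles alive at time $t$, and $X^i_t$ the position of particle $i\in I_t$. The cumulant generating function $K$ of $X$ is defined by $\mathbb E_x[e^{\theta X_t}]=e^{\theta x+tK(\theta)}$ for all $t\ge0$, where $\mathbb E_x$ denotes expectation when $X_0=x$; $K(\theta)$ may equal $+\infty$ away from a neighbourhood of $0$. *)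

theory Defs
  imports "HOL-Probability.Probability"
begin

definition cadlag :: "(real \<Rightarrow> real) \<Rightarrow> bool" where
  "cadlag f \<longleftrightarrow> (\<forall>t\<ge>0. continuous (at_right t) f) \<and> (\<forall>t>0. \<exists>l. (f \<longlongrightarrow> l) (at_left t))"

text \<open>
  A real-valued Levy process started from 0; the process started from \<open>x\<close> is \<open>x + X\<close>. Only the
  values of \<open>X t\<close> with \<open>t \<ge> 0\<close> are relevant. All paths, and not just almost all of them,
  are right-continuous with left limits, so that \<open>X\<close> can be evaluated at a random time
  also when \<open>M\<close> is not complete.
\<close>
locale levy_process = prob_space M
  for M :: "'a measure" and X :: "real \<Rightarrow> 'a \<Rightarrow> real" +
  assumes measurable: "t \<ge> 0 \<Longrightarrow> X t \<in> borel_measurable M"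
    and start: "\<omega> \<in> space M \<Longrightarrow> X 0 \<omega> = 0"
    and paths: "\<omega> \<in> space M \<Longrightarrow> cadlag (\<lambda>t. X t \<omega>)"
    and stationary_increments: "s \<ge> 0 \<Longrightarrow> t \<ge> 0 \<Longrightarrow>
      distr M borel (\<lambda>\<omega>. X (s + t) \<omega> - X s \<omega>) = distr M borel (X t)"
    and independent_increments: "mono r \<Longrightarrow> r 0 \<ge> 0 \<Longrightarrow>
      indep_vars (\<lambda>_. borel) (\<lambda>i \<omega>. X (r (Suc i)) \<omega> - X (r i) \<omega>) {..<(n :: nat)}"

definition exp_ereal :: "ereal \<Rightarrow> ennreal" where
  "exp_ereal k = (if k = \<infinity> then \<infinity> else if k = -\<infinity> then 0 else ennreal (exp (real_of_ereal k)))"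

text \<open>
  The cumulant generating function of a Levy process \<open>X\<close> started from 0. At \<open>t = 0\<close> the
  convention \<open>0 * \<infinity> = 0\<close> on extended reals gives the correct value \<open>exp (\<theta> * x)\<close>.
\<close>
definition cgf :: "'a measure \<Rightarrow> (real \<Rightarrow> 'a \<Rightarrow> real) \<Rightarrow> real \<Rightarrow> ereal" where
  "cgf M X \<theta> = (THE k. \<forall>x. \<forall>t\<ge>0.
     (\<integral>\<^sup>+ \<omega>. ennreal (exp (\<theta> * (x + X t \<omega>))) \<partial>M) = exp_ereal (ereal (\<theta> * x) + ereal t * k))"

text \<open>
  Particles carry Ulam--Harris labels, written in reverse: \<open>[]\<close> is the initial particle and
  \<open>k # u\<close> is the child number \<open>k\<close> (counting from 0) of \<open>u\<close>.
\<close>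
type_synonym label = "nat list"

definition path_space :: "(real \<Rightarrow> real) measure" where
  "path_space = (\<Pi>\<^sub>M t\<in>{0..}. borel)"

definition sample_path :: "(real \<Rightarrow> 'a \<Rightarrow> real) \<Rightarrow> 'a \<Rightarrow> real \<Rightarrow> real" where
  "sample_path X \<omega> = (\<lambda>t\<in>{0..}. X t \<omega>)"

definition mark_space :: "((real \<Rightarrow> real) \<times> real \<times> nat) measure" where
  "mark_space = path_space \<Otimes>\<^sub>M borel \<Otimes>\<^sub>M count_space UNIV"

definition mark :: "(real \<Rightarrow> 'a \<Rightarrow> real) \<Rightarrow> ('a \<Rightarrow> real) \<Rightarrow> ('a \<Rightarrow> nat) \<Rightarrow> 'a \<Rightarrow> (real \<Rightarrow> real) \<times> real \<times> nat"
  where "mark X T N \<omega> = (sample_path X \<omega>, T \<omega>, N \<omega>)"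

text \<open>
  Every label \<open>u\<close>, whether or not the particle \<open>u\<close> is ever born, has a displacement process \<open>X u\<close>
  (relative to the birthplace and as a function of the age), a lifetime \<open>T u\<close> and a number of
  children \<open>N u\<close>. Assumption \<open>indep_mark\<close> expresses the mutual independence of these three
  by a product law; \<open>indep_labels\<close> and \<open>same_law\<close> say that distinct particles use independent
  copies of the triple of the initial particle.
\<close>
locale branching_levy_process = prob_space M
  for M :: "'a measure" and X :: "label \<Rightarrow> real \<Rightarrow> 'a \<Rightarrow> real"
    and T :: "label \<Rightarrow> 'a \<Rightarrow> real" and N :: "label \<Rightarrow> 'a \<Rightarrow> nat" and rate :: real +
  assumes rate_pos: "rate > 0"
    and levy: "levy_process M (X u)"
    and lifetime_measurable: "T u \<in> borel_measurable M"
    and lifetime_pos: "\<omega> \<in> space M \<Longrightarrow> T u \<omega> > 0"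
    and lifetime_exponential: "t \<ge> 0 \<Longrightarrow> \<P>(\<omega> in M. T u \<omega> > t) = exp (- rate * t)"
    and offspring_measurable: "N u \<in> measurable M (count_space UNIV)"
    and indep_mark: "distr M mark_space (mark (X u) (T u) (N u)) =
      distr M path_space (sample_path (X u)) \<Otimes>\<^sub>M distr M borel (T u) \<Otimes>\<^sub>M distr M (count_space UNIV) (N u)"
    and indep_labels: "indep_vars (\<lambda>_. mark_space) (\<lambda>v. mark (X v) (T v) (N v)) UNIV"
    and same_law: "distr M mark_space (mark (X u) (T u) (N u)) =
      distr M mark_space (mark (X []) (T []) (N []))"

fun born :: "(label \<Rightarrow> 'a \<Rightarrow> nat) \<Rightarrow> 'a \<Rightarrow> label \<Rightarrow> bool" where
  "born N \<omega> [] \<longleftrightarrow> True"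
| "born N \<omega> (k # u) \<longleftrightarrow> born N \<omega> u \<and> k < N u \<omega>"

fun birth_time :: "(label \<Rightarrow> 'a \<Rightarrow> real) \<Rightarrow> 'a \<Rightarrow> label \<Rightarrow> real" where
  "birth_time T \<omega> [] = 0"
| "birth_time T \<omega> (k # u) = birth_time T \<omega> u + T u \<omega>"

fun birth_place :: "(label \<Rightarrow> real \<Rightarrow> 'a \<Rightarrow> real) \<Rightarrow> (label \<Rightarrow> 'a \<Rightarrow> real) \<Rightarrow> real \<Rightarrow> 'a \<Rightarrow> label \<Rightarrow> real"
  where
  "birth_place X T x0 \<omega> [] = x0"
| "birth_place X T x0 \<omega> (k # u) = birth_place X T x0 \<omega> u + X u (T u \<omega>) \<omega>"

definition alive :: "(label \<Rightarrow> 'a \<Rightarrow> real) \<Rightarrow> (label \<Rightarrow> 'a \<Rightarrow> nat) \<Rightarrow> real \<Rightarrow> 'a \<Rightarrow> label set" where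
  "alive T N t \<omega> =
     {u. born N \<omega> u \<and> birth_time T \<omega> u \<le> t \<and> t < birth_time T \<omega> u + T u \<omega>}"

definition position ::
  "(label \<Rightarrow> real \<Rightarrow> 'a \<Rightarrow> real) \<Rightarrow> (label \<Rightarrow> 'a \<Rightarrow> real) \<Rightarrow> real \<Rightarrow> label \<Rightarrow> real \<Rightarrow> 'a \<Rightarrow> real" where
  "position X T x0 u t \<omega> = birth_place X T x0 \<omega> u + X u (t - birth_time T \<omega> u) \<omega>"

definition survives :: "(label \<Rightarrow> 'a \<Rightarrow> real) \<Rightarrow> (label \<Rightarrow> 'a \<Rightarrow> nat) \<Rightarrow> 'a \<Rightarrow> bool" where
  "survives T N \<omega> \<longleftrightarrow> (\<forall>t\<ge>0. alive T N t \<omega> \<noteq> {})"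

text \<open>
  Convergence in probability to a constant as \<open>t \<rightarrow> \<infinity>\<close>, conditional on the event \<open>Q\<close>.
\<close>
definition cond_converges_in_prob ::
  "'a measure \<Rightarrow> ('a \<Rightarrow> bool) \<Rightarrow> (real \<Rightarrow> 'a \<Rightarrow> real) \<Rightarrow> real \<Rightarrow> bool" where
  "cond_converges_in_prob M Q Y c \<longleftrightarrow>
     (\<forall>\<epsilon>>0. ((\<lambda>t. \<P>(\<omega> in M. \<bar>Y t \<omega> - c\<bar> > \<epsilon> \<bar> Q \<omega>)) \<longlongrightarrow> 0) at_top)"

text \<open>
  The infimum is taken in the extended reals, where values of \<open>\<theta>\<close> with \<open>K \<theta> = \<infinity>\<close> do not
  contribute. If \<open>K\<close> is the cumulant generating function of a Levy process and is finite near 0,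
  the infimum is a real number: it is at least \<open>E (X 1)\<close> by Jensen's inequality.
\<close>
definition speed :: "(real \<Rightarrow> ereal) \<Rightarrow> real \<Rightarrow> real \<Rightarrow> real" where
  "speed K rate \<mu> = real_of_ereal (INF \<theta>\<in>{0<..}. (K \<theta> + ereal (rate * \<mu>)) / ereal \<theta>)"

end

theory Submission
  imports Defs
begin

text \<open>
  Let \<open>\<lambda>\<close> be the branching rate. The speed is \<open>c = inf\<^sub>\<theta> (K \<theta> + \<lambda> \<mu>) / \<theta>\<close> because the mean number of
  particles to the right of \<open>a t\<close> at time \<open>t\<close> is \<open>exp (\<lambda> \<mu> t)\<close> times the probability that the Levy process is
  to the right of \<open>a t\<close>. By the theory of large deviations this mean decays exponentially for \<open>a > c\<close> and grows exponentially for \<open>a < c\<close>.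

  \<^emph>\<open>Upper bound.\<close> The mean of the sum of \<open>exp (\<theta> X\<^sup>i\<^sub>t)\<close> over the particles alive at time \<open>t\<close> solves a
  renewal equation, and is at most \<open>exp ((K \<theta> + \<lambda> \<mu>) t)\<close> (\<open>nn_integral_weight_le\<close>). For \<open>a > c\<close> some \<open>\<theta>\<close> makes
  \<open>exp ((K \<theta> + \<lambda> \<mu> - \<theta> a) t)\<close> tend to zero, and Markov's inequality gives \<open>alive_above_tail\<close>. With
  \<open>\<theta> = 0\<close> the same bound shows that almost surely only finitely many particles are alive.

  \<^emph>\<open>Lower bound.\<close> Large deviations are used along generations and not along time, so that regeneration
  takes place at births: the subtrees of the particles of a generation are independent copies of the whole
  tree (\<open>branching_property\<close>). Fix \<open>a < c\<close> and give to each particle the gain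
  \<open>X\<^sub>T - a T\<close> over its life. Under the law of a single mark, \<open>E[N exp (\<theta> (X\<^sub>T - a T))]\<close> is
  \<open>\<lambda> (1 + \<mu>) / (\<lambda> + a \<theta> - K \<theta>)\<close>, or \<open>\<infinity>\<close> if \<open>\<lambda> + a \<theta> \<le> K \<theta>\<close>; it exceeds \<open>1\<close> for
  every \<open>\<theta> \<ge> 0\<close> precisely because \<open>K \<theta> + \<lambda> \<mu> > a \<theta>\<close> for all \<open>\<theta> > 0\<close> (\<open>nn_integral_gain_gt_1\<close>). This remains
  true when lifetimes, displacements and numbers of children are restricted to a bounded range
  (\<open>uniform_truncation\<close>). Chernoff's lower bound (\<open>mean_count_supercritical\<close>) then
  yields a number \<open>g\<close> of generations such that the mean number of lines of descent of length \<open>g\<close> with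
  a gain that is nonnegative up to an error \<open>\<delta> g\<close> is larger than \<open>1\<close>. Such lines are the edges of a supercritical
  Galton--Watson process, which survives with positive probability (\<open>lineage_positive\<close>); when it survives,
  there are at all times particles to the right of \<open>b t - C\<close>, where \<open>b < a\<close> is as close to \<open>a\<close> as desired
  (\<open>lineage_alive\<close>).

  Positive probability improves to certainty on survival by a zero-one law: that no particle in the
  tree starts such a surviving process is inherited by all subtrees, and an inherited property that holds on
  extinction is almost surely the same as extinction if its probability is less than one
  (\<open>inherited_zero_one_law\<close>). Since a branching process that survives in time has particles in every
  generation, the lower bound holds on survival.
\<close>

section \<open>Exponential moments of a Levy process\<close>

context levy_process
begin

definition mgf :: "real \<Rightarrow> real \<Rightarrow> ennreal" where
  "mgf \<theta> t = (\<integral>\<^sup>+\<omega>. ennreal (exp (\<theta> * X t \<omega>)) \<partial>M)"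

lemma mgf_0: "mgf \<theta> 0 = 1"
proof -
  have "mgf \<theta> 0 = (\<integral>\<^sup>+\<omega>. 1 \<partial>M)"
    unfolding mgf_def by (intro nn_integral_cong) (simp add: start)
  then show ?thesis by (simp add: emeasure_space_1)
qed

lemma mgf_add:
  assumes "s \<ge> 0" "t \<ge> 0"
  shows "mgf \<theta> (s + t) = mgf \<theta> s * mgf \<theta> t"
proof -
  have [measurable]: "X u \<in> borel_measurable M" if "u \<ge> 0" for u
    using that by (rule measurable)
  have [measurable]: "X s \<in> borel_measurable M" "X t \<in> borel_measurable M"
      "X (s + t) \<in> borel_measurable M"
    using assms by (auto intro!: measurable)
  define r where "r i = (if i = 0 then 0 else if i = 1 then s else s + t)" for i :: nat
  have "mono r"
    using assms by (auto simp: mono_def r_def)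
  then have "indep_vars (\<lambda>_. borel) (\<lambda>i \<omega>. X (r (Suc i)) \<omega> - X (r i) \<omega>) {..<(2 :: nat)}"
    by (rule independent_increments) (simp add: r_def)
  then have "indep_vars (\<lambda>_. borel) (\<lambda>i \<omega>. ennreal (exp (\<theta> * (X (r (Suc i)) \<omega> - X (r i) \<omega>)))) {..<(2 :: nat)}"
    by (rule indep_vars_compose2) auto
  from indep_vars_nn_integral[OF _ this]
  have "(\<integral>\<^sup>+\<omega>. ennreal (exp (\<theta> * (X s \<omega> - X 0 \<omega>))) * ennreal (exp (\<theta> * (X (s + t) \<omega> - X s \<omega>))) \<partial>M)
    = (\<integral>\<^sup>+\<omega>. ennreal (exp (\<theta> * (X s \<omega> - X 0 \<omega>))) \<partial>M) * (\<integral>\<^sup>+\<omega>. ennreal (exp (\<theta> * (X (s + t) \<omega> - X s \<omega>))) \<partial>M)"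
    by (simp add: r_def numeral_2_eq_2 mult.commute)
  also have "(\<integral>\<^sup>+\<omega>. ennreal (exp (\<theta> * (X (s + t) \<omega> - X s \<omega>))) \<partial>M)
    = (\<integral>\<^sup>+x. ennreal (exp (\<theta> * x)) \<partial>distr M borel (\<lambda>\<omega>. X (s + t) \<omega> - X s \<omega>))"
    by (subst nn_integral_distr) auto
  also have "\<dots> = mgf \<theta> t"
    unfolding stationary_increments[OF assms] mgf_def by (subst nn_integral_distr) auto
  also have "(\<integral>\<^sup>+\<omega>. ennreal (exp (\<theta> * (X s \<omega> - X 0 \<omega>))) \<partial>M) = mgf \<theta> s"
    unfolding mgf_def by (intro nn_integral_cong) (simp add: start)
  also have "(\<integral>\<^sup>+\<omega>. ennreal (exp (\<theta> * (X s \<omega> - X 0 \<omega>))) * ennreal (exp (\<theta> * (X (s + t) \<omega> - X s \<omega>))) \<partial>M) = mgf \<theta> (s + t)"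
    unfolding mgf_def
    by (intro nn_integral_cong) (simp add: start flip: ennreal_mult exp_add, simp add: algebra_simps)
  finally show ?thesis .
qed

lemma mgf_pos: "mgf \<theta> t > 0" if "t \<ge> 0"
proof -
  have [measurable]: "X t \<in> borel_measurable M" using that by (rule measurable)
  have "mgf \<theta> t \<noteq> 0"
  proof
    assume "mgf \<theta> t = 0"
    then have "AE \<omega> in M. ennreal (exp (\<theta> * X t \<omega>)) = 0"
      unfolding mgf_def by (subst (asm) nn_integral_0_iff_AE) auto
    then have "AE \<omega> in M. False" by eventually_elim simp
    then show False by simp
  qed
  then show ?thesis by (simp add: zero_less_iff_neq_zero)
qed

lemma mgf_mult: "t \<ge> 0 \<Longrightarrow> mgf \<theta> (real n * t) = mgf \<theta> t ^ n"
proof (induction n)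
  case (Suc n)
  have "mgf \<theta> (real (Suc n) * t) = mgf \<theta> (t + real n * t)" by (simp add: algebra_simps)
  also have "\<dots> = mgf \<theta> t * mgf \<theta> (real n * t)" by (rule mgf_add) (use Suc in auto)
  finally show ?case using Suc by simp
qed (simp add: mgf_0)

text \<open>
  Fatou's lemma gives an inequality even if the exponential moments to the right of \<open>t\<close> have no common bound.
  Multiplicativity turns it into an equality in \<open>mgf_finite_exp\<close>.
\<close>
lemma mgf_Fatou:
  assumes "t \<ge> 0" "\<And>n. r n > t" "r \<longlonglongrightarrow> t"
  shows "mgf \<theta> t \<le> liminf (\<lambda>n. mgf \<theta> (r n))"
proof -
  have r: "r n \<ge> 0" for n using assms(1) assms(2)[of n] by simp
  have [measurable]: "X (r n) \<in> borel_measurable M" for n by (rule measurable) (rule r)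
  have lim: "(\<lambda>n. ennreal (exp (\<theta> * X (r n) \<omega>))) \<longlonglongrightarrow> ennreal (exp (\<theta> * X t \<omega>))" if "\<omega> \<in> space M" for \<omega>
  proof -
    have "((\<lambda>t. X t \<omega>) \<longlongrightarrow> X t \<omega>) (at_right t)"
      using paths[OF that] assms(1) by (auto simp: cadlag_def continuous_within)
    moreover have "filterlim r (at_right t) sequentially"
      using assms by (auto simp: filterlim_at intro!: always_eventually)
    ultimately have "(\<lambda>n. X (r n) \<omega>) \<longlonglongrightarrow> X t \<omega>"
      by (rule filterlim_compose)
    then show ?thesis by (intro tendsto_intros)
  qed
  have "mgf \<theta> t = (\<integral>\<^sup>+\<omega>. liminf (\<lambda>n. ennreal (exp (\<theta> * X (r n) \<omega>))) \<partial>M)"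
    unfolding mgf_def using lim by (intro nn_integral_cong) (metis lim_imp_Liminf sequentially_bot)
  also have "\<dots> \<le> liminf (\<lambda>n. mgf \<theta> (r n))"
    unfolding mgf_def by (rule nn_integral_liminf) auto
  finally show ?thesis .
qed

text \<open>
  Since exponential moments never vanish, an infinite factor makes the product \<open>mgf \<theta> s * mgf \<theta> (t - s)\<close>
  infinite.
\<close>
lemma mgf_finite_mono:
  assumes "0 \<le> s" "s \<le> t" "mgf \<theta> t < \<infinity>"
  shows "mgf \<theta> s < \<infinity>"
proof (rule ccontr)
  assume "\<not> mgf \<theta> s < \<infinity>"
  then have "mgf \<theta> s = \<infinity>" by (cases "mgf \<theta> s") auto
  moreover have "mgf \<theta> t = mgf \<theta> s * mgf \<theta> (t - s)" using mgf_add[of s "t - s"] assms by simp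
  moreover have "mgf \<theta> (t - s) > 0" using assms by (intro mgf_pos) simp
  ultimately show False using assms(3) by (auto simp: ennreal_top_mult split: if_splits)
qed

lemma mgf_rational:
  assumes "mgf \<theta> 1 = ennreal (exp k)"
  shows "mgf \<theta> (real m / real (Suc n)) = ennreal (exp (real m / real (Suc n) * k))"
proof -
  have "mgf \<theta> (1 / real (Suc n)) ^ Suc n = mgf \<theta> 1"
    by (subst mgf_mult[symmetric]) auto
  then have 1: "mgf \<theta> (1 / real (Suc n)) ^ Suc n = ennreal (exp k)" using assms by simp
  have fin: "mgf \<theta> (1 / real (Suc n)) < \<infinity>"
    by (rule mgf_finite_mono[of _ 1]) (use assms in auto)
  obtain x where x: "mgf \<theta> (1 / real (Suc n)) = ennreal x" "x \<ge> 0"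
    using fin by (cases "mgf \<theta> (1 / real (Suc n))") auto
  have "x ^ Suc n = exp k"
    using 1 x by (simp add: ennreal_power ennreal_eq_0_iff del: power_Suc)
  also have "\<dots> = exp (k / real (Suc n)) ^ Suc n"
    by (simp add: exp_of_nat_mult[symmetric] del: power_Suc of_nat_Suc)
  finally have "x = exp (k / real (Suc n))"
    using x by (metis exp_ge_zero power_eq_imp_eq_base zero_less_Suc)
  with x have "mgf \<theta> (real m * (1 / real (Suc n))) = ennreal (exp (k / real (Suc n))) ^ m"
    by (subst mgf_mult) auto
  then show ?thesis
    by (simp add: ennreal_power exp_of_nat_mult[symmetric] del: of_nat_Suc)
qed

lemma mgf_finite_exp:
  assumes k: "mgf \<theta> 1 = ennreal (exp k)" and t: "t \<ge> 0"
  shows "mgf \<theta> t = ennreal (exp (t * k))"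
proof -
  \<comment> \<open>Approximate from the right by the rationals with denominator \<open>n + 1\<close>.\<close>
  have upper: "mgf \<theta> t \<le> ennreal (exp (t * k))" if t: "t \<ge> 0" for t
  proof -
    define r where "r n = real (nat (\<lfloor>real (Suc n) * t\<rfloor> + 1)) / real (Suc n)" for n
    have r_eq: "r n = (of_int \<lfloor>real (Suc n) * t\<rfloor> + 1) / real (Suc n)" for n
      using t by (simp add: r_def)
    have gt: "r n > t" for n
      unfolding r_eq by (simp add: pos_less_divide_eq mult.commute del: of_nat_Suc)
    have le: "r n \<le> t + 1 / real (Suc n)" for n
    proof -
      have "r n \<le> (real (Suc n) * t + 1) / real (Suc n)"
        unfolding r_eq by (intro divide_right_mono add_right_mono) auto
      also have "\<dots> = t + 1 / real (Suc n)"
        by (simp add: field_simps)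
      finally show ?thesis .
    qed
    have upper_lim: "(\<lambda>n. t + 1 / real (Suc n)) \<longlonglongrightarrow> t"
      using tendsto_add[OF tendsto_const LIMSEQ_inverse_real_of_nat, of t] by (simp add: inverse_eq_divide)
    have lim: "r \<longlonglongrightarrow> t"
    proof (rule tendsto_sandwich[OF _ _ tendsto_const upper_lim])
      show "\<forall>\<^sub>F n in sequentially. t \<le> r n"
        using gt by (intro always_eventually allI less_imp_le)
      show "\<forall>\<^sub>F n in sequentially. r n \<le> t + 1 / real (Suc n)"
        using le by (intro always_eventually allI)
    qed
    have "(\<lambda>n. mgf \<theta> (r n)) = (\<lambda>n. ennreal (exp (r n * k)))"
      unfolding r_def by (intro ext mgf_rational k)
    moreover have "(\<lambda>n. ennreal (exp (r n * k))) \<longlonglongrightarrow> ennreal (exp (t * k))"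
      by (intro tendsto_intros lim)
    ultimately have "liminf (\<lambda>n. mgf \<theta> (r n)) = ennreal (exp (t * k))"
      by (simp add: lim_imp_Liminf)
    then show ?thesis using mgf_Fatou[OF t gt lim, of \<theta>] by simp
  qed
  \<comment> \<open>The upper bound for the complementary time \<open>n - t\<close> gives the lower bound at \<open>t\<close>, because the two
    exponential moments multiply to a known one.\<close>
  define n where "n = nat \<lceil>t\<rceil>"
  have n: "t \<le> real n" unfolding n_def by linarith
  have "ennreal (exp (real n * k)) = mgf \<theta> (real n)"
    using mgf_rational[OF k, of n 0] by simp
  also have "\<dots> = mgf \<theta> t * mgf \<theta> (real n - t)"
    using mgf_add[of t "real n - t"] n t by simp
  also have "\<dots> \<le> mgf \<theta> t * ennreal (exp ((real n - t) * k))"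
    using n by (intro mult_left_mono upper) auto
  finally have "ennreal (exp (real n * k)) * ennreal (exp (- (real n - t) * k))
    \<le> mgf \<theta> t * (ennreal (exp ((real n - t) * k)) * ennreal (exp (- (real n - t) * k)))"
    by (metis mult.assoc mult_right_mono zero_le)
  then have "ennreal (exp (t * k)) \<le> mgf \<theta> t"
    by (simp add: ennreal_mult[symmetric] exp_add[symmetric] algebra_simps)
  with upper[OF t] show ?thesis by simp
qed

lemma mgf_infinite:
  assumes "mgf \<theta> 1 = \<infinity>" "t > 0"
  shows "mgf \<theta> t = \<infinity>"
proof (rule ccontr)
  assume "mgf \<theta> t \<noteq> \<infinity>"
  moreover obtain n where "1 \<le> real n * t"
    using assms(2) by (metis less_eq_real_def reals_Archimedean3)
  ultimately have "mgf \<theta> 1 < \<infinity>"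
    using assms(2) by (intro mgf_finite_mono[of 1 "real n * t"])
      (auto simp: mgf_mult less_top[symmetric] power_eq_top_ennreal)
  then show False using assms by simp
qed

text \<open>
  The \<open>THE\<close> in the definition of \<open>cgf\<close> is justified, in two cases according to whether \<open>exp (\<theta> X\<^sub>1)\<close> has
  a finite expectation: the expectation is multiplicative in time, which determines it at the rational
  times, and right-continuity of the paths (by Fatou's lemma) carries it over to the others.
\<close>
lemma mgf_eq_cgf:
  assumes "t \<ge> 0"
  shows "mgf \<theta> t = exp_ereal (ereal t * cgf M X \<theta>)"
    and "cgf M X \<theta> \<noteq> -\<infinity>"
proof -
  let ?P = "\<lambda>k. \<forall>x. \<forall>t\<ge>0.
     (\<integral>\<^sup>+ \<omega>. ennreal (exp (\<theta> * (x + X t \<omega>))) \<partial>M) = exp_ereal (ereal (\<theta> * x) + ereal t * k)"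
  have shift: "(\<integral>\<^sup>+ \<omega>. ennreal (exp (\<theta> * (x + X t \<omega>))) \<partial>M) = ennreal (exp (\<theta> * x)) * mgf \<theta> t" if "t \<ge> 0" for x t
  proof -
    have [measurable]: "X t \<in> borel_measurable M" using that by (rule measurable)
    show ?thesis unfolding mgf_def
      by (subst nn_integral_cmult[symmetric]) (auto simp: ring_distribs exp_add ennreal_mult)
  qed
  have exp1: "exp_ereal k = exp_ereal k' \<longleftrightarrow> k = k'" if "k \<noteq> -\<infinity>" for k k'
    using that by (cases k; cases k') (auto simp: exp_ereal_def ennreal_eq_0_iff)
  have "\<exists>k. k \<noteq> -\<infinity> \<and> ?P k"
  proof (cases "mgf \<theta> 1 = \<infinity>")
    case True
    have "?P \<infinity>"
    proof (intro allI impI)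
      fix x t :: real assume t: "t \<ge> 0"
      show "(\<integral>\<^sup>+ \<omega>. ennreal (exp (\<theta> * (x + X t \<omega>))) \<partial>M) = exp_ereal (ereal (\<theta> * x) + ereal t * \<infinity>)"
        unfolding shift[OF t] using t mgf_infinite[OF True, of t]
        by (cases "t = 0") (auto simp: mgf_0 exp_ereal_def ennreal_mult_top)
    qed
    moreover have "(\<infinity> :: ereal) \<noteq> -\<infinity>" by simp
    ultimately show ?thesis by blast
  next
    case False
    then obtain y where y: "mgf \<theta> 1 = ennreal y" "y \<ge> 0" by (cases "mgf \<theta> 1") auto
    then have "y > 0" using mgf_pos[of 1 \<theta>] by simp
    with y have "mgf \<theta> 1 = ennreal (exp (ln y))" by simp
    from mgf_finite_exp[OF this]
    have "?P (ereal (ln y))"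
      by (simp add: shift exp_ereal_def exp_add ennreal_mult)
    moreover have "ereal (ln y) \<noteq> -\<infinity>" by simp
    ultimately show ?thesis by blast
  qed
  then obtain k where k: "k \<noteq> -\<infinity>" "?P k" by blast
  have "cgf M X \<theta> = k"
    unfolding cgf_def
  proof (rule the_equality)
    fix k' assume k': "?P k'"
    then have "exp_ereal (ereal (\<theta> * 0) + ereal 1 * k') = exp_ereal (ereal (\<theta> * 0) + ereal 1 * k)"
      using k(2) by (metis zero_le_one)
    then have "exp_ereal k = exp_ereal k'" by (simp add: zero_ereal_def[symmetric])
    then show "k' = k" using k(1) by (simp add: exp1)
  qed (rule k)
  with k shift[OF assms, of 0] spec[OF k(2), of 0] show "mgf \<theta> t = exp_ereal (ereal t * cgf M X \<theta>)" "cgf M X \<theta> \<noteq> -\<infinity>"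
    using assms by (auto simp: zero_ereal_def[symmetric])
qed

end

section \<open>Trees of independent marks\<close>

definition subtree :: "nat \<Rightarrow> (nat list \<Rightarrow> 'm) \<Rightarrow> nat list \<Rightarrow> 'm" where
  "subtree k \<tau> = (\<lambda>l. \<tau> (k # l))"

lemma (in prob_space) indep_vars_imp_indep_var:
  assumes "indep_vars M' X I" "i \<in> I" "j \<in> I" "i \<noteq> j"
  shows "indep_var (M' i) (X i) (M' j) (X j)"
proof -
  have "indep_var (PiM {i} M') (\<lambda>\<omega>. restrict (\<lambda>i. X i \<omega>) {i}) (PiM {j} M') (\<lambda>\<omega>. restrict (\<lambda>i. X i \<omega>) {j})"
    by (rule indep_var_restrict[OF assms(1)]) (use assms in auto)
  then have "indep_var (M' i) ((\<lambda>f. f i) \<circ> (\<lambda>\<omega>. restrict (\<lambda>i. X i \<omega>) {i}))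
      (M' j) ((\<lambda>f. f j) \<circ> (\<lambda>\<omega>. restrict (\<lambda>i. X i \<omega>) {j}))"
    by (rule indep_var_compose) (auto intro!: measurable_component_singleton)
  then show ?thesis by (simp add: comp_def)
qed

locale iid_tree = prob_space \<nu> for \<nu> :: "'m measure"
begin

abbreviation tree_law :: "(nat list \<Rightarrow> 'm) measure" where
  "tree_law \<equiv> (\<Pi>\<^sub>M l\<in>UNIV. \<nu>)"

sublocale tree: prob_space tree_law
  by (intro prob_space_PiM prob_space_axioms)

lemma measurable_root[measurable]: "(\<lambda>\<tau>. \<tau> l) \<in> tree_law \<rightarrow>\<^sub>M \<nu>"
  by (rule measurable_component_singleton) simp

lemma measurable_subtree[measurable]: "subtree k \<in> tree_law \<rightarrow>\<^sub>M tree_law"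
  unfolding subtree_def by (rule measurable_PiM_single') (auto simp: space_PiM)

lemma distr_root: "distr tree_law \<nu> (\<lambda>\<tau>. \<tau> l) = \<nu>"
  using distr_PiM_component[of UNIV "\<lambda>_. \<nu>" l] prob_space_axioms by simp

lemma distr_subtree: "distr tree_law tree_law (subtree k) = tree_law"
  using distr_PiM_reindex[of UNIV "\<lambda>_. \<nu>" "\<lambda>l. k # l" UNIV] prob_space_axioms
  by (simp add: subtree_def[abs_def] inj_on_def restrict_UNIV)

lemma indep_marks: "tree.indep_vars (\<lambda>_. \<nu>) (\<lambda>l \<tau>. \<tau> l) UNIV"
  by (subst tree.indep_vars_iff_distr_eq_PiM) (simp_all add: distr_root restrict_UNIV)

text \<open>
  The labels split into the root and the labels of the subtrees of its children. The root mark is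
  represented by a constant tree, so that it has the type of the subtrees and can be a member of the same
  independent family.
\<close>
lemma branching_property:
  "tree.indep_vars (\<lambda>_. tree_law)
     (\<lambda>j \<tau>. case j of None \<Rightarrow> (\<lambda>l. \<tau> []) | Some k \<Rightarrow> subtree k \<tau>) (UNIV :: nat option set)"
proof -
  define K :: "nat option \<Rightarrow> nat list set"
    where "K j = (case j of None \<Rightarrow> {[]} | Some k \<Rightarrow> range (\<lambda>l. k # l))" for j
  define Y :: "nat option \<Rightarrow> (nat list \<Rightarrow> 'm) \<Rightarrow> nat list \<Rightarrow> 'm"
    where "Y j \<tau> = (case j of None \<Rightarrow> (\<lambda>l. \<tau> []) | Some k \<Rightarrow> subtree k \<tau>)" for j \<tau>
  have "tree.indep_vars (\<lambda>j. \<Pi>\<^sub>M l\<in>K j. \<nu>) (\<lambda>j \<tau>. restrict (\<lambda>l. \<tau> l) (K j)) UNIV"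
    by (rule tree.indep_vars_restrict[OF indep_marks])
       (auto simp: disjoint_family_on_def K_def split: option.splits)
  then have "tree.indep_vars (\<lambda>_. tree_law) (\<lambda>j \<tau>. Y j (restrict (\<lambda>l. \<tau> l) (K j))) UNIV"
  proof (rule tree.indep_vars_compose2)
    fix j :: "nat option"
    show "Y j \<in> (\<Pi>\<^sub>M l\<in>K j. \<nu>) \<rightarrow>\<^sub>M tree_law"
      by (cases j; rule measurable_PiM_single')
        (auto simp: Y_def K_def subtree_def space_PiM intro!: measurable_component_singleton)
  qed
  moreover have "Y j (restrict (\<lambda>l. \<tau> l) (K j)) = (case j of None \<Rightarrow> (\<lambda>l. \<tau> []) | Some k \<Rightarrow> subtree k \<tau>)" for j \<tau>
    by (auto simp: Y_def K_def subtree_def split: option.splits)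
  ultimately show ?thesis by simp
qed

text \<open>
  Conditioning on the first branching: given the root mark, the subtree of each child is a fresh copy
  of the tree.
\<close>
lemma nn_integral_root_subtree:
  assumes f[measurable]: "f \<in> borel_measurable (\<nu> \<Otimes>\<^sub>M tree_law)"
  shows "(\<integral>\<^sup>+\<tau>. f (\<tau> [], subtree k \<tau>) \<partial>tree_law) = (\<integral>\<^sup>+m. \<integral>\<^sup>+\<sigma>. f (m, \<sigma>) \<partial>tree_law \<partial>\<nu>)"
proof -
  have "tree.indep_var tree_law (\<lambda>\<tau> l. \<tau> []) tree_law (subtree k)"
    using tree.indep_vars_imp_indep_var[OF branching_property, of None "Some k"] by simp
  then have *: "distr tree_law tree_law (\<lambda>\<tau> l. \<tau> []) \<Otimes>\<^sub>M tree_law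
      = distr tree_law (tree_law \<Otimes>\<^sub>M tree_law) (\<lambda>\<tau>. (\<lambda>l. \<tau> [], subtree k \<tau>))"
    and [measurable]: "(\<lambda>\<tau> l. \<tau> []) \<in> tree_law \<rightarrow>\<^sub>M tree_law"
    unfolding tree.indep_var_distribution_eq by (simp_all add: distr_subtree)
  have "(\<integral>\<^sup>+\<tau>. f (\<tau> [], subtree k \<tau>) \<partial>tree_law)
      = (\<integral>\<^sup>+x. f (fst x [], snd x) \<partial>distr tree_law (tree_law \<Otimes>\<^sub>M tree_law) (\<lambda>\<tau>. (\<lambda>l. \<tau> [], subtree k \<tau>)))"
    by (subst nn_integral_distr) auto
  also have "\<dots> = (\<integral>\<^sup>+\<rho>. \<integral>\<^sup>+\<sigma>. f (\<rho> [], \<sigma>) \<partial>tree_law \<partial>distr tree_law tree_law (\<lambda>\<tau> l. \<tau> []))"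
    unfolding *[symmetric] by (subst tree.nn_integral_fst[symmetric]) auto
  also have "\<dots> = (\<integral>\<^sup>+\<tau>. \<integral>\<^sup>+\<sigma>. f (\<tau> [], \<sigma>) \<partial>tree_law \<partial>tree_law)"
    by (subst nn_integral_distr) auto
  also have "\<dots> = (\<integral>\<^sup>+m. \<integral>\<^sup>+\<sigma>. f (m, \<sigma>) \<partial>tree_law \<partial>distr tree_law \<nu> (\<lambda>\<tau>. \<tau> []))"
    by (subst nn_integral_distr) auto
  finally show ?thesis by (simp add: distr_root)
qed

lemma prob_subtree:
  assumes [measurable]: "Measurable.pred tree_law A"
  shows "\<P>(\<tau> in tree_law. A (subtree k \<tau>)) = \<P>(\<tau> in tree_law. A \<tau>)"
proof -
  have "\<P>(\<tau> in tree_law. A \<tau>) = measure (distr tree_law tree_law (subtree k)) {\<tau> \<in> space tree_law. A \<tau>}"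
    by (simp add: distr_subtree)
  also have "\<dots> = \<P>(\<tau> in tree_law. A (subtree k \<tau>))"
    by (subst measure_distr) (auto intro!: arg_cong[where f="measure _"] measurable_space[OF measurable_subtree])
  finally show ?thesis by simp
qed

lemma prob_subtrees_2:
  assumes [measurable]: "Measurable.pred tree_law A" "Measurable.pred tree_law B" and "i \<noteq> j"
  shows "\<P>(\<tau> in tree_law. A (subtree i \<tau>) \<and> B (subtree j \<tau>)) = \<P>(\<tau> in tree_law. A \<tau>) * \<P>(\<tau> in tree_law. B \<tau>)"
proof -
  have "tree.indep_var tree_law (subtree i) tree_law (subtree j)"
    using tree.indep_vars_imp_indep_var[OF branching_property, of "Some i" "Some j"] assms(3) by simp
  from tree.indep_varD[OF this, of "{\<tau> \<in> space tree_law. A \<tau>}" "{\<tau> \<in> space tree_law. B \<tau>}"]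
  have "measure tree_law ((\<lambda>\<tau>. (subtree i \<tau>, subtree j \<tau>)) -` ({\<tau> \<in> space tree_law. A \<tau>} \<times> {\<tau> \<in> space tree_law. B \<tau>}) \<inter> space tree_law)
    = measure tree_law (subtree i -` {\<tau> \<in> space tree_law. A \<tau>} \<inter> space tree_law)
    * measure tree_law (subtree j -` {\<tau> \<in> space tree_law. B \<tau>} \<inter> space tree_law)" by simp
  moreover have "(\<lambda>\<tau>. (subtree i \<tau>, subtree j \<tau>)) -` ({\<tau> \<in> space tree_law. A \<tau>} \<times> {\<tau> \<in> space tree_law. B \<tau>}) \<inter> space tree_law
    = {\<tau> \<in> space tree_law. A (subtree i \<tau>) \<and> B (subtree j \<tau>)}"
    by (auto intro!: measurable_space[OF measurable_subtree])
  moreover have "subtree i -` {\<tau> \<in> space tree_law. A \<tau>} \<inter> space tree_law = {\<tau> \<in> space tree_law. A (subtree i \<tau>)}" for i A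
    by (auto intro!: measurable_space[OF measurable_subtree])
  ultimately show ?thesis by (simp add: prob_subtree)
qed

lemma prob_root_subtrees:
  assumes [measurable]: "Measurable.pred \<nu> R" "Measurable.pred tree_law A"
  shows "\<P>(\<tau> in tree_law. R (\<tau> []) \<and> (\<forall>k<n. A (subtree k \<tau>))) = \<P>(m in \<nu>. R m) * \<P>(\<tau> in tree_law. A \<tau>) ^ n"
proof -
  define B :: "nat option \<Rightarrow> (nat list \<Rightarrow> 'm) set"
    where "B j = (case j of None \<Rightarrow> {\<tau> \<in> space tree_law. R (\<tau> [])} | Some k \<Rightarrow> {\<tau> \<in> space tree_law. A \<tau>})" for j
  define Y :: "nat option \<Rightarrow> (nat list \<Rightarrow> 'm) \<Rightarrow> nat list \<Rightarrow> 'm"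
    where "Y j \<tau> = (case j of None \<Rightarrow> (\<lambda>l. \<tau> []) | Some k \<Rightarrow> subtree k \<tau>)" for j \<tau>
  define J where "J = insert None (Some ` {..<n})"
  have sp: "(\<lambda>l. \<tau> []) \<in> space tree_law" if "\<tau> \<in> space tree_law" for \<tau>
    using that by (auto simp: space_PiM)
  have Some: "Y (Some k) -` B (Some k) \<inter> space tree_law = {\<tau> \<in> space tree_law. A (subtree k \<tau>)}" for k
    by (auto simp: Y_def B_def intro!: measurable_space[OF measurable_subtree])
  have None: "Y None -` B None \<inter> space tree_law = {\<tau> \<in> space tree_law. R (\<tau> [])}"
    using sp by (auto simp: Y_def B_def)
  have "tree.prob (\<Inter>j\<in>J. Y j -` B j \<inter> space tree_law) = (\<Prod>j\<in>J. tree.prob (Y j -` B j \<inter> space tree_law))"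
  proof (rule tree.indep_varsD[where I=UNIV])
    show "tree.indep_vars (\<lambda>_. tree_law) Y UNIV"
      using branching_property by (simp add: Y_def[abs_def])
    show "B j \<in> sets tree_law" for j
      by (cases j) (auto simp: B_def)
  qed (auto simp: J_def)
  also have "(\<Inter>j\<in>J. Y j -` B j \<inter> space tree_law) = {\<tau> \<in> space tree_law. R (\<tau> []) \<and> (\<forall>k<n. A (subtree k \<tau>))}"
    
  proof -
    have "\<tau> \<in> (\<Inter>j\<in>J. Y j -` B j \<inter> space tree_law) \<longleftrightarrow>
        \<tau> \<in> Y None -` B None \<inter> space tree_law \<and> (\<forall>k<n. \<tau> \<in> Y (Some k) -` B (Some k) \<inter> space tree_law)" for \<tau>
      by (auto simp: J_def)
    then show ?thesis unfolding None Some by (intro set_eqI) (simp, blast)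
  qed
  also have "(\<Prod>j\<in>J. tree.prob (Y j -` B j \<inter> space tree_law))
    = \<P>(\<tau> in tree_law. R (\<tau> [])) * (\<Prod>k<n. \<P>(\<tau> in tree_law. A (subtree k \<tau>)))"
    unfolding J_def by (subst prod.insert) (auto simp: None Some prod.reindex)
  also have "(\<Prod>k<n. \<P>(\<tau> in tree_law. A (subtree k \<tau>))) = \<P>(\<tau> in tree_law. A \<tau>) ^ n"
    by (simp add: prob_subtree)
  also have "\<P>(\<tau> in tree_law. R (\<tau> [])) = measure (distr tree_law \<nu> (\<lambda>\<tau>. \<tau> [])) {m \<in> space \<nu>. R m}"
    by (subst measure_distr) (auto intro!: arg_cong[where f="measure _"] simp: space_PiM)
  finally show ?thesis by (simp add: distr_root)
qed

end

section \<open>Chernoff's lower bound for weighted random walks\<close>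

lemma (in prob_space) isCont_integral_exp:
  fixes f Z :: "'a \<Rightarrow> real"
  assumes [measurable]: "f \<in> borel_measurable M" "Z \<in> borel_measurable M"
    and f: "\<And>m. \<bar>f m\<bar> \<le> F" and Z: "\<And>m. \<bar>Z m\<bar> \<le> A"
  shows "isCont (\<lambda>\<theta>. \<integral>m. f m * exp (\<theta> * Z m) \<partial>M) \<theta>"
  unfolding continuous_at_sequentially comp_def
proof (intro allI impI)
  fix x :: "nat \<Rightarrow> real" assume x: "x \<longlonglongrightarrow> \<theta>"
  then have "Bseq x" by (intro convergent_imp_Bseq convergentI)
  then obtain R where R: "\<And>n. \<bar>x n\<bar> \<le> R" by (auto simp: Bseq_def)
  have "R \<ge> 0" using R[of 0] by simp
  show "(\<lambda>n. \<integral>m. f m * exp (x n * Z m) \<partial>M) \<longlonglongrightarrow> (\<integral>m. f m * exp (\<theta> * Z m) \<partial>M)"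
  proof (rule integral_dominated_convergence[where w="\<lambda>_. F * exp (R * A)"])
    show "AE m in M. (\<lambda>n. f m * exp (x n * Z m)) \<longlonglongrightarrow> f m * exp (\<theta> * Z m)"
      by (intro AE_I2 tendsto_intros x)
    show "AE m in M. norm (f m * exp (x n * Z m)) \<le> F * exp (R * A)" for n
    proof (intro AE_I2)
      fix m
      have "x n * Z m \<le> \<bar>x n\<bar> * \<bar>Z m\<bar>" by (metis abs_ge_self abs_mult)
      also have "\<dots> \<le> R * A" using R Z \<open>R \<ge> 0\<close> by (intro mult_mono) auto
      finally have "exp (x n * Z m) \<le> exp (R * A)" by simp
      then show "norm (f m * exp (x n * Z m)) \<le> F * exp (R * A)"
        using f[of m] by (auto simp: abs_mult intro!: mult_mono)
    qed
  qed auto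
qed

lemma (in prob_space) integrable_exp_bounded:
  fixes f Z :: "'a \<Rightarrow> real"
  assumes [measurable]: "f \<in> borel_measurable M" "Z \<in> borel_measurable M"
    and f: "\<And>m. \<bar>f m\<bar> \<le> F" and Z: "\<And>m. \<bar>Z m\<bar> \<le> A"
  shows "integrable M (\<lambda>m. f m * exp (\<theta> * Z m))"
proof (rule integrable_const_bound[where B="F * exp (\<bar>\<theta>\<bar> * A)"])
  show "AE m in M. norm (f m * exp (\<theta> * Z m)) \<le> F * exp (\<bar>\<theta>\<bar> * A)"
  proof (intro AE_I2)
    fix m
    have "\<theta> * Z m \<le> \<bar>\<theta>\<bar> * \<bar>Z m\<bar>" by (metis abs_ge_self abs_mult)
    also have "\<dots> \<le> \<bar>\<theta>\<bar> * A" using Z by (intro mult_mono) auto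
    finally have "exp (\<theta> * Z m) \<le> exp (\<bar>\<theta>\<bar> * A)" by simp
    then show "norm (f m * exp (\<theta> * Z m)) \<le> F * exp (\<bar>\<theta>\<bar> * A)"
      using f[of m] by (auto simp: abs_mult intro!: mult_mono)
  qed
qed auto

text \<open>
  One generation of a branching random walk, averaged: a particle with mark \<open>m\<close> counts \<open>w m\<close> times and its
  offspring is displaced by \<open>Z m\<close>. The bounds make all exponential moments finite.
\<close>
locale weighted_step = prob_space M for M :: "'m measure" +
  fixes w Z :: "'m \<Rightarrow> real" and C A :: real
  assumes w_measurable[measurable]: "w \<in> borel_measurable M"
    and Z_measurable[measurable]: "Z \<in> borel_measurable M"
    and w_nonneg: "0 \<le> w m" and w_le: "w m \<le> C"
    and Z_le: "\<bar>Z m\<bar> \<le> A"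
begin

text \<open>
  The mean number of particles in the nonnegative half-line after \<open>g\<close> generations, started from one particle
  at \<open>y\<close>.
\<close>
fun mean_count :: "nat \<Rightarrow> real \<Rightarrow> real" where
  "mean_count 0 y = indicator {0..} y"
| "mean_count (Suc g) y = (\<integral>m. w m * mean_count g (y + Z m) \<partial>M)"

lemma C_nonneg: "0 \<le> C"
  using w_nonneg w_le order_trans by blast

lemma mean_count_basic:
  "mean_count g \<in> borel_measurable borel \<and> (\<forall>y. 0 \<le> mean_count g y \<and> mean_count g y \<le> C ^ g)"
proof (induction g)
  case 0
  have "mean_count 0 = (\<lambda>y. indicator {0..} y)" by auto
  then show ?case by (auto split: split_indicator)
next
  case (Suc g)
  then have [measurable]: "mean_count g \<in> borel_measurable borel"
    and b: "\<And>y. 0 \<le> mean_count g y" "\<And>y. mean_count g y \<le> C ^ g" by auto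
  have "mean_count (Suc g) = (\<lambda>y. \<integral>m. w m * mean_count g (y + Z m) \<partial>M)" by auto
  moreover have "(\<lambda>y. \<integral>m. w m * mean_count g (y + Z m) \<partial>M) \<in> borel_measurable borel"
    by measurable
  moreover have "(\<integral>m. w m * mean_count g (y + Z m) \<partial>M) \<le> (\<integral>m. C * C ^ g \<partial>M)" for y
  proof (rule integral_mono')
    show "w m * mean_count g (y + Z m) \<le> C * C ^ g" for m
      using b w_nonneg w_le C_nonneg by (intro mult_mono) auto
  qed (auto simp: C_nonneg)
  ultimately show ?case
    using b w_nonneg by (auto simp: prob_space intro!: integral_nonneg)
qed

lemma mean_count_measurable[measurable]: "mean_count g \<in> borel_measurable borel"
  and mean_count_nonneg: "0 \<le> mean_count g y" and mean_count_le: "mean_count g y \<le> C ^ g"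
  using mean_count_basic by auto

lemma integrable_mean_count: "integrable M (\<lambda>m. w m * mean_count g (y + Z m))"
  by (rule integrable_const_bound[where B="C * C ^ g"])
    (auto simp: abs_mult mean_count_nonneg mean_count_le w_nonneg w_le C_nonneg intro!: AE_I2 mult_mono)

lemma mean_count_mono: "x \<le> y \<Longrightarrow> mean_count g x \<le> mean_count g y"
proof (induction g arbitrary: x y)
  case (Suc g)
  then show ?case
    by (auto intro!: integral_mono integrable_mean_count mult_left_mono w_nonneg)
qed (auto split: split_indicator)

definition gen :: "real \<Rightarrow> real" where
  "gen \<theta> = (\<integral>m. w m * exp (\<theta> * Z m) \<partial>M)"

text \<open>
  The exponential times a parabola lies below the indicator of a half-line, and the step operator of
  \<open>mean_count\<close> maps such functions to such functions: the factor \<open>gen \<theta>\<close> comes out, the parabola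
  is shifted by the mean of the tilted law and lowered by its variance. This is Chebyshev's
  inequality for the random walk under the tilted law.
\<close>
lemma mean_count_ge:
  assumes \<theta>: "0 \<le> \<theta>" and M: "gen \<theta> > 0" and c: "c > 0" "c \<le> a"
    and mean: "(\<integral>m. w m * exp (\<theta> * Z m) * (Z m - mm) \<partial>M) = 0"
    and var: "(\<integral>m. w m * exp (\<theta> * Z m) * (Z m - mm)\<^sup>2 \<partial>M) \<le> gen \<theta> * v"
  shows "mean_count g y \<ge> gen \<theta> ^ g * exp (\<theta> * (y - (a + c))) * (1 - ((y + real g * mm - a)\<^sup>2 + real g * v) / c\<^sup>2)"
proof (induction g arbitrary: y)
  case 0
  show ?case
  proof (cases "\<bar>y - a\<bar> \<le> c")
    case True
    then have "y \<ge> 0" using c by auto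
    have "\<theta> * (y - (a + c)) \<le> 0" using True \<theta> by (intro mult_nonneg_nonpos) auto
    then have "exp (\<theta> * (y - (a + c))) * (1 - (y - a)\<^sup>2 / c\<^sup>2) \<le> 1 * 1"
      using True c by (intro mult_mono) (auto simp: divide_le_eq power2_le_iff_abs_le)
    then show ?thesis using \<open>y \<ge> 0\<close> by simp
  next
    case False
    then have "c\<^sup>2 \<le> (y - a)\<^sup>2" using c by (metis abs_le_square_iff abs_of_pos linear)
    then have "1 - (y - a)\<^sup>2 / c\<^sup>2 \<le> 0" using c by (simp add: le_divide_eq)
    then have "exp (\<theta> * (y - (a + c))) * (1 - (y - a)\<^sup>2 / c\<^sup>2) \<le> 0"
      by (intro mult_nonneg_nonpos) auto
    then show ?thesis by (simp split: split_indicator)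
  qed
next
  case (Suc g)
  let ?e = "\<lambda>m. w m * exp (\<theta> * Z m)"
  let ?b = "y + real (Suc g) * mm - a"
  let ?K = "gen \<theta> ^ g * exp (\<theta> * (y - (a + c)))"
  have i0: "integrable M ?e"
    by (rule integrable_exp_bounded[where F=C and A=A]) (auto simp: w_nonneg w_le Z_le)
  have Zb: "\<bar>Z m - mm\<bar> \<le> A + \<bar>mm\<bar>" for m using Z_le[of m] by linarith
  have "integrable M (\<lambda>m. (w m * (Z m - mm)) * exp (\<theta> * Z m))"
    by (rule integrable_exp_bounded[where F="C * (A + \<bar>mm\<bar>)" and A=A])
      (auto simp: w_nonneg w_le Z_le abs_mult C_nonneg Zb intro!: mult_mono)
  then have i1: "integrable M (\<lambda>m. ?e m * (Z m - mm))" by (simp add: mult_ac)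
  have "integrable M (\<lambda>m. (w m * (Z m - mm)\<^sup>2) * exp (\<theta> * Z m))"
  proof (rule integrable_exp_bounded[where F="C * (A + \<bar>mm\<bar>)\<^sup>2" and A=A])
    fix m
    have "(Z m - mm)\<^sup>2 \<le> (A + \<bar>mm\<bar>)\<^sup>2" using Zb[of m] by (metis abs_ge_zero abs_le_square_iff abs_of_nonneg order_trans)
    then show "\<bar>w m * (Z m - mm)\<^sup>2\<bar> \<le> C * (A + \<bar>mm\<bar>)\<^sup>2"
      by (auto simp: abs_mult w_nonneg w_le C_nonneg intro!: mult_mono)
  qed (auto simp: Z_le)
  then have i2: "integrable M (\<lambda>m. ?e m * (Z m - mm)\<^sup>2)" by (simp add: mult_ac)
  \<comment> \<open>The parabola is expanded around the tilted mean \<open>mm\<close>: the linear term integrates to zero and the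
    quadratic one to at most \<open>gen \<theta> * v\<close>.\<close>
  define q where "q m = ?K * ((1 - (?b\<^sup>2 + real g * v) / c\<^sup>2) * ?e m - 2 * ?b / c\<^sup>2 * (?e m * (Z m - mm))
    - 1 / c\<^sup>2 * (?e m * (Z m - mm)\<^sup>2))" for m
  have q_eq: "q m = w m * (gen \<theta> ^ g * exp (\<theta> * ((y + Z m) - (a + c)))
      * (1 - (((y + Z m) + real g * mm - a)\<^sup>2 + real g * v) / c\<^sup>2))" for m
  proof -
    have "(y + Z m) + real g * mm - a = ?b + (Z m - mm)" by (simp add: algebra_simps)
    then have sq: "((y + Z m) + real g * mm - a)\<^sup>2 = ?b\<^sup>2 + 2 * ?b * (Z m - mm) + (Z m - mm)\<^sup>2"
      by (simp only: power2_sum)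
    have "exp (\<theta> * ((y + Z m) - (a + c))) = exp (\<theta> * (y - (a + c))) * exp (\<theta> * Z m)"
      by (simp add: exp_add[symmetric] algebra_simps)
    then show ?thesis unfolding sq q_def by (simp only: add_divide_distrib) (simp add: algebra_simps)
  qed
  have "gen \<theta> ^ Suc g * exp (\<theta> * (y - (a + c))) * (1 - (?b\<^sup>2 + real (Suc g) * v) / c\<^sup>2)
    = ?K * ((1 - (?b\<^sup>2 + real g * v) / c\<^sup>2) * gen \<theta> - 1 / c\<^sup>2 * (gen \<theta> * v))"
    by (simp add: add_divide_distrib distrib_right) (simp add: algebra_simps add_divide_distrib)
  also have "\<dots> \<le> ?K * ((1 - (?b\<^sup>2 + real g * v) / c\<^sup>2) * gen \<theta> - 2 * ?b / c\<^sup>2 * 0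
    - 1 / c\<^sup>2 * (\<integral>m. ?e m * (Z m - mm)\<^sup>2 \<partial>M))"
    using var M by (intro mult_left_mono diff_mono) auto
  also have "\<dots> = (\<integral>m. q m \<partial>M)"
    unfolding q_def using i0 i1 i2 by (simp add: mean gen_def)
  also have "\<dots> \<le> (\<integral>m. w m * mean_count g (y + Z m) \<partial>M)"
  proof (rule integral_mono)
    show "integrable M q" unfolding q_def using i0 i1 i2 by auto
    show "q m \<le> w m * mean_count g (y + Z m)" for m
      unfolding q_eq by (intro mult_left_mono Suc.IH w_nonneg)
  qed (rule integrable_mean_count)
  finally show ?case by simp
qed

text \<open>
  Where \<open>gen\<close> is minimal, either \<open>\<theta> = 0\<close> or the tilted law is centred. In both cases the walk under the
  tilted law stays near its mean and the change of measure costs next to nothing.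
\<close>
lemma mean_count_supercritical:
  assumes gt: "\<And>\<theta>. 0 \<le> \<theta> \<Longrightarrow> gen \<theta> > 1"
    and grow: "\<eta> > 0" "c > 0" "\<And>\<theta>. 0 \<le> \<theta> \<Longrightarrow> c * exp (\<theta> * \<eta>) \<le> gen \<theta>"
    and \<delta>: "\<delta> > 0"
  shows "\<exists>g\<ge>1. mean_count g (real g * \<delta>) > 1"
proof -
  have int: "integrable M (\<lambda>m. w m * exp (\<theta> * Z m))" for \<theta>
    by (rule integrable_exp_bounded[where F=C and A=A]) (auto simp: w_nonneg w_le Z_le)
  have wZ: "\<bar>w m * Z m\<bar> \<le> C * A" for m
    by (auto simp: abs_mult w_nonneg w_le C_nonneg Z_le intro!: mult_mono)
  define D where "D \<theta> = (\<integral>m. (w m * Z m) * exp (\<theta> * Z m) \<partial>M)" for \<theta>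
  have intD: "integrable M (\<lambda>m. (w m * Z m) * exp (\<theta> * Z m))" for \<theta>
    by (rule integrable_exp_bounded[where F="C * A" and A=A]) (auto simp: wZ Z_le)
  have gen_cont: "isCont gen \<theta>" for \<theta>
    unfolding gen_def by (rule isCont_integral_exp[where F=C and A=A]) (auto simp: w_nonneg w_le Z_le)
  have D_cont: "isCont D \<theta>" for \<theta>
    unfolding D_def by (rule isCont_integral_exp[where F="C * A" and A=A]) (auto simp: wZ Z_le)
  \<comment> \<open>The derivative of \<open>gen\<close> is \<open>D\<close>; this one-sided form of convexity is all that the first-order conditions
    at the minimum use.\<close>
  have gen_diff: "gen (\<theta> + h) - gen \<theta> \<le> h * D (\<theta> + h)" for \<theta> h
  proof -
    have "gen (\<theta> + h) - gen \<theta> = (\<integral>m. w m * exp ((\<theta> + h) * Z m) - w m * exp (\<theta> * Z m) \<partial>M)"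
      unfolding gen_def by (rule Bochner_Integration.integral_diff[symmetric]) (rule int)+
    also have "\<dots> \<le> (\<integral>m. h * ((w m * Z m) * exp ((\<theta> + h) * Z m)) \<partial>M)"
    proof (rule integral_mono)
      fix m
      have "1 - h * Z m \<le> exp (- (h * Z m))" using exp_ge_add_one_self[of "- (h * Z m)"] by simp
      then have "exp ((\<theta> + h) * Z m) * (1 - h * Z m) \<le> exp ((\<theta> + h) * Z m) * exp (- (h * Z m))"
        by (intro mult_left_mono) auto
      also have "\<dots> = exp (\<theta> * Z m)" by (simp add: exp_add[symmetric] algebra_simps)
      finally have "w m * (exp ((\<theta> + h) * Z m) * (1 - h * Z m)) \<le> w m * exp (\<theta> * Z m)"
        by (intro mult_left_mono w_nonneg)
      then show "w m * exp ((\<theta> + h) * Z m) - w m * exp (\<theta> * Z m) \<le> h * ((w m * Z m) * exp ((\<theta> + h) * Z m))"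
        by (simp add: algebra_simps)
    qed (auto intro: int intD)
    finally show ?thesis by (simp add: D_def)
  qed
  obtain \<theta> where \<theta>: "\<theta> \<ge> 0" and min: "\<And>x. x \<ge> 0 \<Longrightarrow> gen \<theta> \<le> gen x"
  proof -
    \<comment> \<open>Beyond \<open>B\<close> the exponential growth exceeds \<open>gen 0\<close>, so that a minimum over the compact interval is global.\<close>
    define B where "B = max 0 (ln (gen 0 / c) / \<eta>)"
    have far: "gen 0 \<le> gen x" if "x \<ge> B" for x
    proof -
      have "x \<ge> 0" "ln (gen 0 / c) \<le> x * \<eta>" using that grow(1) by (auto simp: B_def divide_le_eq)
      then have "gen 0 / c \<le> exp (x * \<eta>)" using gt[of 0] grow(2) by (metis divide_pos_pos exp_le_cancel_iff exp_ln less_trans order_refl zero_less_one)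
      then have "gen 0 \<le> c * exp (x * \<eta>)" using grow(2) by (simp add: divide_le_eq mult.commute)
      with grow(3)[OF \<open>x \<ge> 0\<close>] show ?thesis by simp
    qed
    have "continuous_on {0..B} gen" by (intro continuous_at_imp_continuous_on ballI gen_cont)
    then obtain \<theta> where "\<theta> \<in> {0..B}" "\<And>x. x \<in> {0..B} \<Longrightarrow> gen \<theta> \<le> gen x"
      using continuous_attains_inf[of "{0..B}" gen] by (auto simp: B_def)
    moreover from this have "gen \<theta> \<le> gen 0" by (auto simp: B_def)
    moreover have "gen \<theta> \<le> gen x" if "x \<ge> 0" for x
    proof (cases "x \<le> B")
      case False
      then have "gen 0 \<le> gen x" by (intro far) simp
      with \<open>gen \<theta> \<le> gen 0\<close> show ?thesis by simp
    qed (use calculation that in auto)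
    ultimately show thesis using that by auto
  qed
  have D_ge: "D \<theta> \<ge> 0"
  proof (rule tendsto_lowerbound)
    show "(D \<longlongrightarrow> D \<theta>) (at_right \<theta>)"
      using D_cont[of \<theta>] by (simp add: continuous_at filterlim_at_split)
    have "0 \<le> D x" if "x > \<theta>" for x
    proof -
      have "0 \<le> (x - \<theta>) * D x" using gen_diff[of \<theta> "x - \<theta>"] min[of x] that \<theta> by simp
      then show ?thesis using that by (simp add: zero_le_mult_iff)
    qed
    then show "\<forall>\<^sub>F x in at_right \<theta>. 0 \<le> D x" by (auto simp: eventually_at_filter)
  qed simp
  have D_le: "D \<theta> \<le> 0" if pos: "\<theta> > 0"
  proof (rule tendsto_upperbound)
    show "(D \<longlongrightarrow> D \<theta>) (at_left \<theta>)"
      using D_cont[of \<theta>] by (simp add: continuous_at filterlim_at_split)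
    have "D x \<le> 0" if "x < \<theta>" "0 < x" for x
    proof -
      have "0 \<le> (x - \<theta>) * D x" using gen_diff[of \<theta> "x - \<theta>"] min[of x] that \<theta> by simp
      then show ?thesis using that by (simp add: zero_le_mult_iff)
    qed
    then show "\<forall>\<^sub>F x in at_left \<theta>. D x \<le> 0"
      using eventually_at_left_real[OF pos] by (auto elim: eventually_mono)
  qed simp
  define mm where "mm = D \<theta> / gen \<theta>"
  have gen1: "gen \<theta> > 1" using gt \<theta> by simp
  have mm: "mm \<ge> 0" "\<theta> * mm = 0"
    using D_ge D_le gen1 \<theta> by (auto simp: mm_def intro: antisym)
  have mean: "(\<integral>m. w m * exp (\<theta> * Z m) * (Z m - mm) \<partial>M) = 0"
  proof -
    have "(\<integral>m. w m * exp (\<theta> * Z m) * (Z m - mm) \<partial>M) = (\<integral>m. (w m * Z m) * exp (\<theta> * Z m) - mm * (w m * exp (\<theta> * Z m)) \<partial>M)"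
      by (intro Bochner_Integration.integral_cong) (auto simp: algebra_simps)
    also have "\<dots> = D \<theta> - mm * gen \<theta>"
      unfolding D_def gen_def using int intD by simp
    also have "\<dots> = 0" using gen1 by (simp add: mm_def)
    finally show ?thesis .
  qed
  define v where "v = (A + \<bar>mm\<bar>)\<^sup>2"
  have var: "(\<integral>m. w m * exp (\<theta> * Z m) * (Z m - mm)\<^sup>2 \<partial>M) \<le> gen \<theta> * v"
  proof -
    have "(\<integral>m. w m * exp (\<theta> * Z m) * (Z m - mm)\<^sup>2 \<partial>M) \<le> (\<integral>m. w m * exp (\<theta> * Z m) * v \<partial>M)"
    proof (rule integral_mono')
      fix m
      have "\<bar>Z m - mm\<bar> \<le> A + \<bar>mm\<bar>" using Z_le[of m] by linarith
      then have "(Z m - mm)\<^sup>2 \<le> v" unfolding v_def by (metis abs_ge_zero abs_le_square_iff abs_of_nonneg order_trans)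
      then show "w m * exp (\<theta> * Z m) * (Z m - mm)\<^sup>2 \<le> w m * exp (\<theta> * Z m) * v"
        using w_nonneg by (intro mult_left_mono) auto
    qed (auto intro!: integrable_mult_left int simp: w_nonneg v_def)
    then show ?thesis by (simp add: gen_def)
  qed
  \<comment> \<open>The margin \<open>d\<close> is small enough for the change of measure, which costs \<open>exp (\<theta> d)\<close> in each step, to be
    outweighed by \<open>gen \<theta>\<close>.\<close>
  define d where "d = min \<delta> (ln (gen \<theta>) / (2 * (\<theta> + 1)))"
  have d: "d > 0" "d \<le> \<delta>" using \<delta> gen1 \<theta> by (auto simp: d_def)
  define \<rho> where "\<rho> = gen \<theta> * exp (- \<theta> * d)"
  have "\<theta> * d < ln (gen \<theta>)"
  proof -
    have "\<theta> * d \<le> \<theta> * (ln (gen \<theta>) / (2 * (\<theta> + 1)))" using \<theta> by (intro mult_left_mono) (auto simp: d_def)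
    also have "\<dots> = ln (gen \<theta>) * (\<theta> / (2 * (\<theta> + 1)))" by simp
    also have "\<dots> < ln (gen \<theta>) * 1" using gen1 \<theta> by (intro mult_strict_left_mono) (auto simp: divide_less_eq)
    finally show ?thesis by simp
  qed
  then have "exp (\<theta> * d) < gen \<theta>" using gen1 by (metis exp_less_cancel_iff exp_ln less_trans zero_less_one)
  then have \<rho>: "\<rho> > 1" by (simp add: \<rho>_def exp_minus field_simps)
  have lower: "mean_count g (real g * \<delta>) \<ge> \<rho> ^ g * (1 - v / (real g * d\<^sup>2))" if g: "g \<ge> 1" for g
  proof -
    \<comment> \<open>Under the tilted law the walk ends near \<open>a\<close>, and the parabola is positive within distance \<open>g d \<le> a\<close> of \<open>a\<close>.\<close>
    define a where "a = real g * d + real g * mm"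
    have "mean_count g (real g * d) \<ge> gen \<theta> ^ g * exp (\<theta> * (real g * d - (a + real g * d)))
      * (1 - ((real g * d + real g * mm - a)\<^sup>2 + real g * v) / (real g * d)\<^sup>2)"
      by (rule mean_count_ge) (use \<theta> gen1 g d mm mean var in \<open>auto simp: a_def\<close>)
    also have "(1 - ((real g * d + real g * mm - a)\<^sup>2 + real g * v) / (real g * d)\<^sup>2) = 1 - v / (real g * d\<^sup>2)"
      using g by (simp add: a_def power2_eq_square)
    also have "\<theta> * (real g * d - (a + real g * d)) = real g * (- \<theta> * d) - real g * (\<theta> * mm)"
      by (simp add: a_def algebra_simps)
    also have "gen \<theta> ^ g * exp (real g * (- \<theta> * d) - real g * (\<theta> * mm)) = \<rho> ^ g"
      unfolding mm(2) mult_zero_right diff_zero exp_of_nat_mult \<rho>_def power_mult_distrib ..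
    finally show ?thesis
      using mean_count_mono[of "real g * d" "real g * \<delta>" g] d by (smt (verit) mult_left_mono of_nat_0_le_iff)
  qed
  have "((\<lambda>g. v / (real g * d\<^sup>2)) \<longlongrightarrow> 0) sequentially"
    using tendsto_mult[OF tendsto_const[of "v / d\<^sup>2"] LIMSEQ_inverse_real_of_nat] d
    by (subst filterlim_sequentially_Suc[symmetric]) (simp add: field_simps)
  then have "\<forall>\<^sub>F g in sequentially. v / (real g * d\<^sup>2) < 1 / 2"
    by (rule order_tendstoD) simp
  moreover have "\<forall>\<^sub>F g in sequentially. \<rho> ^ g > 2"
  proof -
    obtain n where "2 < \<rho> ^ n" using real_arch_pow[OF \<rho>] by blast
    then have "2 < \<rho> ^ k" if "k \<ge> n" for k
      using power_increasing[OF that, of \<rho>] \<rho> by linarith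
    then show ?thesis by (auto simp: eventually_sequentially)
  qed
  ultimately have "\<forall>\<^sub>F g in sequentially. g \<ge> 1 \<and> mean_count g (real g * \<delta>) > 1"
    using eventually_ge_at_top[of 1]
  proof eventually_elim
    case (elim g)
    have "1 < \<rho> ^ g * (1 / 2)" using elim by simp
    also have "\<dots> \<le> \<rho> ^ g * (1 - v / (real g * d\<^sup>2))" using elim \<rho> by (intro mult_left_mono) auto
    also have "\<dots> \<le> mean_count g (real g * \<delta>)" using elim by (intro lower)
    finally show ?case using elim by simp
  qed
  then show ?thesis by (auto simp: eventually_sequentially)
qed

end

section \<open>Galton--Watson processes in a tree of independent marks\<close>

text \<open>
  If \<open>n\<close> of the events occur, then the counting function of the right-hand side is \<open>n - (n\<^sup>2 - n)\<close>, which is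
  at most \<open>1\<close>, and \<open>0\<close> for \<open>n = 0\<close>.
\<close>
lemma (in prob_space) bonferroni:
  assumes "finite V" and E: "\<And>l. l \<in> V \<Longrightarrow> E l \<in> events"
  shows "prob (\<Union>l\<in>V. E l) \<ge> (\<Sum>l\<in>V. prob (E l)) - (\<Sum>l\<in>V. \<Sum>l'\<in>V - {l}. prob (E l \<inter> E l'))"
proof -
  have [measurable]: "E l \<in> events" if "l \<in> V" for l using E[OF that] .
  have int: "integrable M (indicator S :: 'a \<Rightarrow> real)" if "S \<in> events" for S
    using that by (simp add: integrable_indicator_iff less_top[symmetric])
  have intl: "integrable M (indicator (E l) :: 'a \<Rightarrow> real)" if "l \<in> V" for l
    using E[OF that] by (rule int)
  have intll: "integrable M (indicator (E l \<inter> E l') :: 'a \<Rightarrow> real)" if "l \<in> V" "l' \<in> V" for l l'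
    using E that by (intro int) auto
  have ind: "(\<integral>x. indicator S x \<partial>M) = prob S" if "S \<in> events" for S
    using sets.sets_into_space[OF that] by (simp add: Int_absorb2)
  have sum1: "(\<integral>x. (\<Sum>l\<in>V. indicator (E l) x) \<partial>M) = (\<Sum>l\<in>V. prob (E l))"
    by (subst Bochner_Integration.integral_sum) (auto intro!: intl sum.cong ind E)
  have sum2: "(\<integral>x. (\<Sum>l\<in>V. \<Sum>l'\<in>V - {l}. indicator (E l \<inter> E l') x) \<partial>M) = (\<Sum>l\<in>V. \<Sum>l'\<in>V - {l}. prob (E l \<inter> E l'))"
  proof (subst Bochner_Integration.integral_sum)
    fix l assume l: "l \<in> V"
    then show "integrable M (\<lambda>x. \<Sum>l'\<in>V - {l}. indicator (E l \<inter> E l') x :: real)"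
      by (intro Bochner_Integration.integrable_sum intll) auto
  next
    show "(\<Sum>l\<in>V. \<integral>x. (\<Sum>l'\<in>V - {l}. indicator (E l \<inter> E l') x) \<partial>M) = (\<Sum>l\<in>V. \<Sum>l'\<in>V - {l}. prob (E l \<inter> E l'))"
      by (intro sum.cong refl, subst Bochner_Integration.integral_sum) (auto intro!: intll sum.cong ind E sets.Int)
  qed
  have "(\<Sum>l\<in>V. prob (E l)) - (\<Sum>l\<in>V. \<Sum>l'\<in>V - {l}. prob (E l \<inter> E l'))
      = (\<integral>x. (\<Sum>l\<in>V. indicator (E l) x) - (\<Sum>l\<in>V. \<Sum>l'\<in>V - {l}. indicator (E l \<inter> E l') x) \<partial>M)"
    unfolding sum1[symmetric] sum2[symmetric]
    by (rule Bochner_Integration.integral_diff[symmetric])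
      (intro Bochner_Integration.integrable_sum intl intll; simp)+
  also have "\<dots> \<le> (\<integral>x. indicator (\<Union>l\<in>V. E l) x \<partial>M)"
  proof (rule integral_mono)
    fix x
    define n where "n = (\<Sum>l\<in>V. indicator (E l) x :: real)"
    have "(\<Sum>l\<in>V. \<Sum>l'\<in>V - {l}. indicator (E l \<inter> E l') x) = (\<Sum>l\<in>V. indicator (E l) x * n - indicator (E l) x :: real)"
    proof (rule sum.cong)
      fix l assume l: "l \<in> V"
      have "n = indicator (E l) x + (\<Sum>l'\<in>V - {l}. indicator (E l') x)"
        unfolding n_def using l assms(1) by (simp add: sum.remove)
      then show "(\<Sum>l'\<in>V - {l}. indicator (E l \<inter> E l') x) = (indicator (E l) x * n - indicator (E l) x :: real)"
        by (auto simp: indicator_inter_arith sum_distrib_left[symmetric] split: split_indicator)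
    qed simp
    also have "\<dots> = n * n - n"
      by (simp add: sum_subtractf sum_distrib_right[symmetric] n_def)
    finally have eq: "(\<Sum>l\<in>V. indicator (E l) x) - (\<Sum>l\<in>V. \<Sum>l'\<in>V - {l}. indicator (E l \<inter> E l') x) = n - (n * n - n)"
      by (simp add: n_def)
    show "(\<Sum>l\<in>V. indicator (E l) x) - (\<Sum>l\<in>V. \<Sum>l'\<in>V - {l}. indicator (E l \<inter> E l') x) \<le> (indicator (\<Union>l\<in>V. E l) x :: real)"
    proof (cases "x \<in> (\<Union>l\<in>V. E l)")
      case True
      have "0 \<le> (n - 1) * (n - 1)" by simp
      then have "n - (n * n - n) \<le> 1" by (simp add: algebra_simps)
      then show ?thesis unfolding eq using True by simp
    next
      case False
      then have "n = 0" by (auto simp: n_def intro!: sum.neutral)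
      then show ?thesis unfolding eq by simp
    qed
  qed (use assms in \<open>auto intro!: Bochner_Integration.integrable_sum Bochner_Integration.integrable_diff int\<close>)
  also have "\<dots> = prob (\<Union>l\<in>V. E l)"
    using E[THEN sets.sets_into_space] by (auto simp: Int_absorb2 UN_subset_iff)
  finally show ?thesis by simp
qed

definition subtree_at :: "nat list \<Rightarrow> (nat list \<Rightarrow> 'm) \<Rightarrow> nat list \<Rightarrow> 'm" where
  "subtree_at l \<tau> = (\<lambda>l'. \<tau> (l @ l'))"

lemma subtree_at_Nil[simp]: "subtree_at [] \<tau> = \<tau>"
  by (simp add: subtree_at_def)

lemma subtree_at_Cons: "subtree_at (k # l) \<tau> = subtree_at l (subtree k \<tau>)"
  by (simp add: subtree_at_def subtree_def)

context iid_tree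
begin

lemma measurable_subtree_at[measurable]: "subtree_at l \<in> tree_law \<rightarrow>\<^sub>M tree_law"
  unfolding subtree_at_def by (rule measurable_PiM_single') (auto simp: space_PiM)

lemma prob_subtree_at:
  assumes [measurable]: "Measurable.pred tree_law A"
  shows "\<P>(\<tau> in tree_law. A (subtree_at l \<tau>)) = \<P>(\<tau> in tree_law. A \<tau>)"
proof (induction l)
  case (Cons k l)
  have "\<P>(\<tau> in tree_law. A (subtree_at l (subtree k \<tau>))) = \<P>(\<tau> in tree_law. A (subtree_at l \<tau>))"
    by (rule prob_subtree[where A="\<lambda>\<sigma>. A (subtree_at l \<sigma>)"]) measurable
  then show ?case using Cons by (simp add: subtree_at_Cons)
qed simp

lemma prob_subtree_at_2:
  assumes A[measurable]: "Measurable.pred tree_law A"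
  shows "length l = length l' \<Longrightarrow> l \<noteq> l' \<Longrightarrow>
    \<P>(\<tau> in tree_law. A (subtree_at l \<tau>) \<and> A (subtree_at l' \<tau>)) = \<P>(\<tau> in tree_law. A \<tau>)\<^sup>2"
proof (induction l arbitrary: l')
  case (Cons k l)
  then obtain k' m where l': "l' = k' # m" by (cases l') auto
  show ?case
  proof (cases "k = k'")
    case True
    have "\<P>(\<tau> in tree_law. A (subtree_at l (subtree k \<tau>)) \<and> A (subtree_at m (subtree k \<tau>)))
        = \<P>(\<tau> in tree_law. A (subtree_at l \<tau>) \<and> A (subtree_at m \<tau>))"
      by (rule prob_subtree[where A="\<lambda>\<sigma>. A (subtree_at l \<sigma>) \<and> A (subtree_at m \<sigma>)"]) measurable
    then show ?thesis using Cons l' True by (simp add: subtree_at_Cons)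
  next
    case False
    have "\<P>(\<tau> in tree_law. A (subtree_at l (subtree k \<tau>)) \<and> A (subtree_at m (subtree k' \<tau>)))
        = \<P>(\<tau> in tree_law. A (subtree_at l \<tau>)) * \<P>(\<tau> in tree_law. A (subtree_at m \<tau>))"
      by (rule prob_subtrees_2[where A="\<lambda>\<sigma>. A (subtree_at l \<sigma>)" and B="\<lambda>\<sigma>. A (subtree_at m \<sigma>)"]) (use False in measurable)
    then show ?thesis using l' by (simp add: subtree_at_Cons prob_subtree_at power2_eq_square)
  qed
qed simp

end

text \<open>
  Along a line of descent only the first \<open>J\<close> children of a particle and particles with a good mark are
  admitted, and the variable \<open>Z\<close> is summed. The bound on the number of children makes the set of lines of a given
  length finite.
\<close>
locale selected_lines = iid_tree \<nu> for \<nu> :: "'m measure" +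
  fixes kids :: "'m \<Rightarrow> nat" and good :: "'m \<Rightarrow> bool" and Z :: "'m \<Rightarrow> real" and J :: nat and A :: real
  assumes kids_measurable[measurable]: "kids \<in> \<nu> \<rightarrow>\<^sub>M count_space UNIV"
    and good_measurable[measurable]: "Measurable.pred \<nu> good"
    and Z_measurable[measurable]: "Z \<in> borel_measurable \<nu>"
    and Z_bounded: "\<bar>Z m\<bar> \<le> A"
begin

sublocale weighted_step \<nu> "\<lambda>m. if good m then real (min (kids m) J) else 0" Z "real J" A
  by unfold_locales (auto simp: Z_bounded)

text \<open>
  The number \<open>y\<close> is the sum of \<open>Z\<close> along the part of the line above the present root.
\<close>
fun line :: "real \<Rightarrow> (nat list \<Rightarrow> 'm) \<Rightarrow> nat list \<Rightarrow> bool" where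
  "line y \<tau> [] \<longleftrightarrow> 0 \<le> y"
| "line y \<tau> (k # l) \<longleftrightarrow> k < kids (\<tau> []) \<and> good (\<tau> []) \<and> line (y + Z (\<tau> [])) (subtree k \<tau>) l"

lemma line_measurable[measurable]:
  "f \<in> borel_measurable N \<Longrightarrow> h \<in> N \<rightarrow>\<^sub>M tree_law \<Longrightarrow> Measurable.pred N (\<lambda>x. line (f x) (h x) l)"
proof (induction l arbitrary: f h)
  case (Cons k l)
  note [measurable] = Cons.prems
  have [measurable]: "(\<lambda>x. h x []) \<in> N \<rightarrow>\<^sub>M \<nu>" by (rule measurable_compose[OF Cons.prems(2) measurable_root])
  have "Measurable.pred N (\<lambda>x. line (f x + Z (h x [])) (subtree k (h x)) l)"
    by (rule Cons.IH) measurable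
  then show ?case by simp
qed simp

fun line_prob :: "nat list \<Rightarrow> real \<Rightarrow> real" where
  "line_prob [] y = indicator {0..} y"
| "line_prob (k # l) y = (\<integral>m. (if k < kids m \<and> good m then line_prob l (y + Z m) else 0) \<partial>\<nu>)"

lemma line_prob_basic:
  "line_prob l \<in> borel_measurable borel \<and> (\<forall>y. 0 \<le> line_prob l y \<and> line_prob l y \<le> 1)"
proof (induction l)
  case Nil
  have "line_prob [] = (\<lambda>y. indicator {0..} y)" by auto
  then show ?case by (auto split: split_indicator)
next
  case (Cons k l)
  then have [measurable]: "line_prob l \<in> borel_measurable borel"
    and b: "\<And>y. 0 \<le> line_prob l y" "\<And>y. line_prob l y \<le> 1" by auto
  have "line_prob (k # l) = (\<lambda>y. \<integral>m. (if k < kids m \<and> good m then line_prob l (y + Z m) else 0) \<partial>\<nu>)" by auto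
  moreover have "(\<lambda>y. \<integral>m. (if k < kids m \<and> good m then line_prob l (y + Z m) else 0) \<partial>\<nu>) \<in> borel_measurable borel"
    by measurable
  moreover have "(\<integral>m. (if k < kids m \<and> good m then line_prob l (y + Z m) else 0) \<partial>\<nu>) \<le> (\<integral>m. 1 \<partial>\<nu>)" for y
    by (rule integral_mono') (auto simp: b)
  ultimately show ?case using b by (auto simp: prob_space intro!: integral_nonneg)
qed

lemma line_prob_measurable[measurable]: "line_prob l \<in> borel_measurable borel"
  and line_prob_nonneg: "0 \<le> line_prob l y" and line_prob_le: "line_prob l y \<le> 1"
  using line_prob_basic by auto

lemma integrable_line_prob: "integrable \<nu> (\<lambda>m. if k < kids m \<and> good m then line_prob l (y + Z m) else 0)"
  by (rule integrable_const_bound[where B=1]) (auto simp: line_prob_nonneg line_prob_le)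

text \<open>
  The line only looks at marks strictly above the particle in which it ends, and these are independent of
  the subtree of that particle.
\<close>
lemma prob_line:
  assumes [measurable]: "Measurable.pred tree_law E"
  shows "\<P>(\<tau> in tree_law. line y \<tau> l \<and> E (subtree_at l \<tau>)) = line_prob l y * \<P>(\<tau> in tree_law. E \<tau>)"
proof (induction l arbitrary: y)
  case Nil
  show ?case by (auto split: split_indicator)
next
  case (Cons k l)
  let ?f = "\<lambda>(m, \<sigma>). indicator {(m, \<sigma>). k < kids m \<and> good m \<and> line (y + Z m) \<sigma> l \<and> E (subtree_at l \<sigma>)} (m, \<sigma>) :: ennreal"
  let ?p = "\<P>(\<tau> in tree_law. E \<tau>)"
  have f[measurable]: "?f \<in> borel_measurable (\<nu> \<Otimes>\<^sub>M tree_law)"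
    by (simp add: split_beta') 
  have "emeasure tree_law {\<tau> \<in> space tree_law. line y \<tau> (k # l) \<and> E (subtree_at (k # l) \<tau>)}
     = (\<integral>\<^sup>+\<tau>. indicator {\<tau> \<in> space tree_law. line y \<tau> (k # l) \<and> E (subtree_at (k # l) \<tau>)} \<tau> \<partial>tree_law)"
    by (rule nn_integral_indicator[symmetric]) measurable
  also have "\<dots> = (\<integral>\<^sup>+\<tau>. ?f (\<tau> [], subtree k \<tau>) \<partial>tree_law)"
    by (intro nn_integral_cong) (simp add: subtree_at_Cons split: split_indicator)
  also have "\<dots> = (\<integral>\<^sup>+m. \<integral>\<^sup>+\<sigma>. ?f (m, \<sigma>) \<partial>tree_law \<partial>\<nu>)"
    by (rule nn_integral_root_subtree[OF f])
  also have "\<dots> = (\<integral>\<^sup>+m. ennreal ((if k < kids m \<and> good m then line_prob l (y + Z m) else 0) * ?p) \<partial>\<nu>)"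
  proof (rule nn_integral_cong)
    fix m assume "m \<in> space \<nu>"
    have "(\<integral>\<^sup>+\<sigma>. ?f (m, \<sigma>) \<partial>tree_law) = (if k < kids m \<and> good m then
      (\<integral>\<^sup>+\<sigma>. indicator {\<sigma> \<in> space tree_law. line (y + Z m) \<sigma> l \<and> E (subtree_at l \<sigma>)} \<sigma> \<partial>tree_law) else 0)"
    proof (cases "k < kids m \<and> good m")
      case True
      show ?thesis
        unfolding if_P[OF True] by (intro nn_integral_cong) (use True in \<open>simp split: split_indicator\<close>)
    qed (auto simp: indicator_def)
    also have "(\<integral>\<^sup>+\<sigma>. indicator {\<sigma> \<in> space tree_law. line (y + Z m) \<sigma> l \<and> E (subtree_at l \<sigma>)} \<sigma> \<partial>tree_law)
      = ennreal (line_prob l (y + Z m) * ?p)"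
      by (subst nn_integral_indicator) (auto simp: tree.emeasure_eq_measure Cons.IH)
    finally show "(\<integral>\<^sup>+\<sigma>. ?f (m, \<sigma>) \<partial>tree_law) = ennreal ((if k < kids m \<and> good m then line_prob l (y + Z m) else 0) * ?p)"
      by simp
  qed
  also have "\<dots> = ennreal (line_prob (k # l) y * ?p)"
    by (subst nn_integral_eq_integral)
      (auto simp: line_prob_nonneg intro!: integrable_mult_left integrable_line_prob)
  finally show ?case
    by (simp add: tree.emeasure_eq_measure integral_nonneg line_prob_nonneg del: line.simps)
qed

definition lines :: "nat \<Rightarrow> nat list set" where
  "lines g = {l. set l \<subseteq> {..<J} \<and> length l = g}"

lemma finite_lines[simp]: "finite (lines g)"
  unfolding lines_def by (rule finite_lists_length_eq) simp

lemma sum_lines_Suc: "(\<Sum>l\<in>lines (Suc g). f l) = (\<Sum>k<J. \<Sum>l\<in>lines g. f (k # l))"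
proof -
  have "lines (Suc g) = (\<lambda>(k, l). k # l) ` ({..<J} \<times> lines g)"
    by (auto simp: lines_def image_iff length_Suc_conv)
  moreover have "inj_on (\<lambda>(k, l). k # l) ({..<J} \<times> lines g)"
    by (auto simp: inj_on_def)
  ultimately have "(\<Sum>l\<in>lines (Suc g). f l) = (\<Sum>(k, l)\<in>{..<J} \<times> lines g. f (k # l))"
    by (simp add: sum.reindex comp_def split_beta')
  then show ?thesis by (simp add: sum.cartesian_product)
qed

text \<open>
  Linearity of expectation (the many-to-one formula): the number of admissible children of a particle
  with mark \<open>m\<close> is \<open>min (kids m) J\<close> or \<open>0\<close>.
\<close>
lemma sum_line_prob: "(\<Sum>l\<in>lines g. line_prob l y) = mean_count g y"
proof (induction g arbitrary: y)
  case 0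
  have "lines 0 = {[]}" by (auto simp: lines_def)
  then show ?case by simp
next
  case (Suc g)
  have "(\<Sum>l\<in>lines (Suc g). line_prob l y)
      = (\<Sum>k<J. \<Sum>l\<in>lines g. \<integral>m. (if k < kids m \<and> good m then line_prob l (y + Z m) else 0) \<partial>\<nu>)"
    by (simp add: sum_lines_Suc)
  also have "\<dots> = (\<integral>m. (\<Sum>k<J. \<Sum>l\<in>lines g. if k < kids m \<and> good m then line_prob l (y + Z m) else 0) \<partial>\<nu>)"
    by (simp add: Bochner_Integration.integral_sum Bochner_Integration.integrable_sum integrable_line_prob)
  also have "\<dots> = (\<integral>m. (if good m then real (min (kids m) J) else 0) * mean_count g (y + Z m) \<partial>\<nu>)"
  proof (rule Bochner_Integration.integral_cong)
    fix m
    have "(\<Sum>k<J. \<Sum>l\<in>lines g. if k < kids m \<and> good m then line_prob l (y + Z m) else 0)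
        = (\<Sum>k<J. if k < kids m \<and> good m then mean_count g (y + Z m) else 0)"
      by (intro sum.cong) (auto simp: Suc.IH)
    also have "\<dots> = (\<Sum>k\<in>{k. k < J \<and> k < kids m}. if good m then mean_count g (y + Z m) else 0)"
      by (subst sum.mono_neutral_cong_right[where S="{k. k < J \<and> k < kids m}"]) auto
    also have "{k. k < J \<and> k < kids m} = {..<min (kids m) J}" by auto
    finally show "(\<Sum>k<J. \<Sum>l\<in>lines g. if k < kids m \<and> good m then line_prob l (y + Z m) else 0)
        = (if good m then real (min (kids m) J) else 0) * mean_count g (y + Z m)" by simp
  qed simp
  finally show ?case by simp
qed

text \<open>
  A lineage of \<open>n\<close> lines of length \<open>g\<close>; the sum of \<open>Z\<close> is reset to \<open>y\<close> at the start of each line, so that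
  lineages are the lines of descent of a Galton--Watson process.
\<close>
fun lineage :: "nat \<Rightarrow> real \<Rightarrow> nat \<Rightarrow> (nat list \<Rightarrow> 'm) \<Rightarrow> bool" where
  "lineage g y 0 \<tau> \<longleftrightarrow> True"
| "lineage g y (Suc n) \<tau> \<longleftrightarrow> (\<exists>l\<in>lines g. line y \<tau> l \<and> lineage g y n (subtree_at l \<tau>))"

lemma lineage_measurable[measurable]: "Measurable.pred tree_law (lineage g y n)"
proof (induction n)
  case (Suc n)
  note [measurable] = Suc
  have "Measurable.pred tree_law (\<lambda>\<tau>. \<exists>l\<in>lines g. line y \<tau> l \<and> lineage g y n (subtree_at l \<tau>))"
    by (rule pred_intros_finite) (auto intro!: pred_intros_logic)
  then show ?case by simp
qed simp

lemma lineage_antimono: "lineage g y (Suc n) \<tau> \<Longrightarrow> lineage g y n \<tau>"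
  by (induction n arbitrary: \<tau>) auto

text \<open>
  The selected lines of \<open>g\<close> generations form a Galton--Watson process with mean number of children
  \<open>m > 1\<close>. By Bonferroni's inequality the probability \<open>p n\<close> of having \<open>n\<close> generations in this process
  satisfies \<open>p (n + 1) \<ge> m * p n - c * (p n)\<^sup>2\<close>, hence \<open>p (n + 1) \<ge> p n\<close> once \<open>p n\<close> is small.
\<close>
lemma lineage_positive:
  assumes "mean_count g y > 1"
  shows "\<P>(\<tau> in tree_law. \<forall>n. lineage g y n \<tau>) > 0"
proof -
  define p where "p n = \<P>(\<tau> in tree_law. lineage g y n \<tau>)" for n
  define m where "m = mean_count g y"
  define c where "c = (real (card (lines g)))\<^sup>2 + 1"
  have m: "m > 1" using assms by (simp add: m_def)
  have p01: "0 \<le> p n" "p n \<le> 1" for n by (auto simp: p_def)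
  define F where "F n l = {\<tau> \<in> space tree_law. line y \<tau> l \<and> lineage g y n (subtree_at l \<tau>)}" for n l
  have E: "F n l \<in> sets tree_law" for l n
    unfolding F_def by measurable
  have step: "p (Suc n) = tree.prob (\<Union>l\<in>lines g. F n l)" for n
    unfolding p_def F_def by (intro arg_cong[where f="measure _"]) auto
  have single: "tree.prob (F n l) = line_prob l y * p n" for l n
    unfolding p_def F_def by (rule prob_line) measurable
  have pair: "tree.prob (F n l
      \<inter> F n l') \<le> (p n)\<^sup>2"
    if "l \<in> lines g" "l' \<in> lines g - {l}" for l l' n
  proof -
    have "tree.prob (F n l
      \<inter> F n l')
      \<le> \<P>(\<tau> in tree_law. lineage g y n (subtree_at l \<tau>) \<and> lineage g y n (subtree_at l' \<tau>))"
      by (rule tree.finite_measure_mono) (auto simp: F_def)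
    also have "\<dots> = (p n)\<^sup>2"
      unfolding p_def by (rule prob_subtree_at_2) (use that in \<open>auto simp: lines_def\<close>)
    finally show ?thesis .
  qed
  have quadratic: "p (Suc n) \<ge> m * p n - c * (p n)\<^sup>2" for n
  proof -
    have "(\<Sum>l\<in>lines g. \<Sum>l'\<in>lines g - {l}. tree.prob (F n l
      \<inter> F n l'))
      \<le> (\<Sum>l\<in>lines g. \<Sum>l'\<in>lines g - {l}. (p n)\<^sup>2)"
      by (intro sum_mono pair)
    also have "\<dots> \<le> (\<Sum>l\<in>lines g. \<Sum>l'\<in>lines g. (p n)\<^sup>2)"
      by (intro sum_mono sum_mono2) auto
    also have "\<dots> \<le> c * (p n)\<^sup>2"
      by (simp add: c_def power2_eq_square algebra_simps)
    finally show ?thesis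
      using tree.bonferroni[of "lines g" "F n"] E
      unfolding step single by (simp add: sum_distrib_right[symmetric] sum_line_prob m_def)
  qed
  have "\<exists>l\<in>lines g. line_prob l y > 0"
  proof (rule ccontr)
    assume "\<not> (\<exists>l\<in>lines g. line_prob l y > 0)"
    then have "line_prob l y = 0" if "l \<in> lines g" for l
      using that line_prob_nonneg[of l y] by (metis less_eq_real_def)
    then have "mean_count g y = 0" by (simp flip: sum_line_prob)
    then show False using assms by simp
  qed
  then obtain l where l: "l \<in> lines g" "line_prob l y > 0" by blast
  have linear: "p (Suc n) \<ge> line_prob l y * p n" for n
    unfolding step single[symmetric] by (rule tree.finite_measure_mono) (use l E in auto)
  \<comment> \<open>As long as \<open>p n\<close> is at most \<open>(m - 1) / c\<close>, the quadratic bound prevents a decrease. From a larger value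
    the linear bound allows only one step down, to \<open>q\<close> at least.\<close>
  define q where "q = min 1 (line_prob l y * ((m - 1) / c))"
  have c: "c > 0" unfolding c_def by (simp add: add_nonneg_pos)
  have q: "q > 0" using l m c by (auto simp: q_def)
  have "p n \<ge> q" for n
  proof (induction n)
    case 0
    then show ?case by (simp add: p_def q_def tree.prob_space)
  next
    case (Suc n)
    show ?case
    proof (cases "p n \<le> (m - 1) / c")
      case True
      then have "c * p n \<le> m - 1" using c by (simp add: field_simps)
      then have "p n * (c * p n) \<le> p n * (m - 1)" using p01 by (intro mult_left_mono) auto
      then have "p n \<le> m * p n - c * (p n)\<^sup>2" by (simp add: algebra_simps power2_eq_square)
      with quadratic[of n] Suc show ?thesis by simp
    next
      case False
      then have "line_prob l y * ((m - 1) / c) \<le> line_prob l y * p n" using l by (intro mult_left_mono) auto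
      with linear[of n] show ?thesis by (simp add: q_def)
    qed
  qed
  moreover have "p \<longlonglongrightarrow> tree.prob (\<Inter>n. {\<tau> \<in> space tree_law. lineage g y n \<tau>})"
    unfolding p_def by (rule tree.finite_Lim_measure_decseq) (auto simp: decseq_Suc_iff simp del: lineage.simps dest: lineage_antimono)
  ultimately have "q \<le> tree.prob (\<Inter>n. {\<tau> \<in> space tree_law. lineage g y n \<tau>})"
    by (intro tendsto_lowerbound[of p]) auto
  also have "(\<Inter>n. {\<tau> \<in> space tree_law. lineage g y n \<tau>}) = {\<tau> \<in> space tree_law. \<forall>n. lineage g y n \<tau>}" by auto
  finally show ?thesis using q by simp
qed

end

text \<open>
  A tree is extinct by \<open>n\<close> if it has no particle of generation \<open>n\<close>.
\<close>
fun extinct_by :: "('m \<Rightarrow> nat) \<Rightarrow> nat \<Rightarrow> (nat list \<Rightarrow> 'm) \<Rightarrow> bool" where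
  "extinct_by kids 0 \<tau> \<longleftrightarrow> False"
| "extinct_by kids (Suc n) \<tau> \<longleftrightarrow> (\<forall>k<kids (\<tau> []). extinct_by kids n (subtree k \<tau>))"

definition extinct :: "('m \<Rightarrow> nat) \<Rightarrow> (nat list \<Rightarrow> 'm) \<Rightarrow> bool" where
  "extinct kids \<tau> \<longleftrightarrow> (\<exists>n. extinct_by kids n \<tau>)"

lemma extinct_by_mono: "extinct_by kids n \<tau> \<Longrightarrow> n \<le> n' \<Longrightarrow> extinct_by kids n' \<tau>"
proof (induction n arbitrary: n' \<tau>)
  case (Suc n)
  then show ?case by (cases n') auto
qed simp

lemma extinct_iff: "extinct kids \<tau> \<longleftrightarrow> (\<forall>k<kids (\<tau> []). extinct kids (subtree k \<tau>))"
proof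
  assume "extinct kids \<tau>"
  then obtain n where n: "extinct_by kids n \<tau>" by (auto simp: extinct_def)
  then show "\<forall>k<kids (\<tau> []). extinct kids (subtree k \<tau>)"
    by (cases n) (auto simp: extinct_def)
next
  assume "\<forall>k<kids (\<tau> []). extinct kids (subtree k \<tau>)"
  then obtain f where f: "\<And>k. k < kids (\<tau> []) \<Longrightarrow> extinct_by kids (f k) (subtree k \<tau>)"
    unfolding extinct_def by metis
  \<comment> \<open>The sum serves as a common upper bound for the extinction generations of the finitely many children.\<close>
  have "extinct_by kids (Suc (\<Sum>k<kids (\<tau> []). f k)) \<tau>"
    by (auto intro!: extinct_by_mono[OF f] member_le_sum)
  then show "extinct kids \<tau>" unfolding extinct_def by blast
qed

text \<open>
  Powers are strictly convex: the chord between \<open>e\<close> and \<open>1\<close> is evaluated at the convex combination \<open>s\<close>.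
\<close>
lemma power_strict_chord:
  fixes e s :: real
  assumes "0 \<le> e" "e < s" "s < 1" "n \<ge> 2"
  shows "s ^ n < (1 - s) / (1 - e) * e ^ n + (1 - (1 - s) / (1 - e))"
proof -
  define \<alpha> where "\<alpha> = (1 - s) / (1 - e)"
  have "(\<Sum>j<n. e ^ j) < (\<Sum>j<n. s ^ j)"
    by (rule sum_strict_mono_ex1) (use assms in \<open>auto intro!: power_mono bexI[of _ 1]\<close>)
  then have "(1 - s) * (\<Sum>j<n. e ^ j) < (1 - s) * (\<Sum>j<n. s ^ j)"
    using assms by (intro mult_strict_left_mono) auto
  also have "\<dots> = 1 - s ^ n" by (simp add: one_diff_power_eq)
  also have "(1 - s) * (\<Sum>j<n. e ^ j) = \<alpha> * (1 - e ^ n)"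
    using assms by (simp add: one_diff_power_eq \<alpha>_def)
  finally show ?thesis unfolding \<alpha>_def[symmetric] by (simp add: algebra_simps)
qed

context iid_tree
begin

lemma extinct_measurable:
  assumes [measurable]: "kids \<in> \<nu> \<rightarrow>\<^sub>M count_space UNIV"
  shows "Measurable.pred tree_law (extinct kids)"
proof -
  have "Measurable.pred tree_law (extinct_by kids n)" for n
  proof (induction n)
    case (Suc n)
    note [measurable] = this
    have "Measurable.pred tree_law (\<lambda>\<tau>. \<forall>k. k < kids (\<tau> []) \<longrightarrow> extinct_by kids n (subtree k \<tau>))"
      by measurable
    then show ?case by simp
  qed simp
  note [measurable] = this
  show ?thesis unfolding extinct_def[abs_def] by measurable
qed

lemma prob_all_subtrees:
  assumes [measurable]: "kids \<in> \<nu> \<rightarrow>\<^sub>M count_space UNIV" "Measurable.pred tree_law A"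
  shows "(\<lambda>n. \<P>(m in \<nu>. kids m = n) * \<P>(\<tau> in tree_law. A \<tau>) ^ n)
    sums \<P>(\<tau> in tree_law. \<forall>k<kids (\<tau> []). A (subtree k \<tau>))"
proof -
  let ?E = "\<lambda>n. {\<tau> \<in> space tree_law. kids (\<tau> []) = n \<and> (\<forall>k<n. A (subtree k \<tau>))}"
  have "(\<lambda>n. tree.prob (?E n)) sums tree.prob (\<Union>n. ?E n)"
    by (rule tree.finite_measure_UNION) (auto simp: disjoint_family_on_def)
  also have "(\<Union>n. ?E n) = {\<tau> \<in> space tree_law. \<forall>k<kids (\<tau> []). A (subtree k \<tau>)}" by auto
  also have "(\<lambda>n. tree.prob (?E n)) = (\<lambda>n. \<P>(m in \<nu>. kids m = n) * \<P>(\<tau> in tree_law. A \<tau>) ^ n)"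
    by (intro ext prob_root_subtrees) auto
  finally show ?thesis .
qed

text \<open>
  The probabilities \<open>s\<close> of \<open>A\<close> and \<open>e\<close> of extinction satisfy \<open>s \<le> f s\<close> and \<open>e = f e\<close>, where \<open>f\<close> is the
  generating function of the number of children. Since \<open>f\<close> is strictly convex with \<open>f 1 = 1\<close>, it lies
  strictly below the diagonal between \<open>e\<close> and \<open>1\<close>, so that \<open>s \<le> e\<close>.
\<close>
lemma inherited_zero_one_law:
  assumes kids[measurable]: "kids \<in> \<nu> \<rightarrow>\<^sub>M count_space UNIV"
    and A[measurable]: "Measurable.pred tree_law A"
    and inherited: "\<And>\<tau> k. A \<tau> \<Longrightarrow> k < kids (\<tau> []) \<Longrightarrow> A (subtree k \<tau>)"
    and extinct: "\<And>\<tau>. extinct kids \<tau> \<Longrightarrow> A \<tau>"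
    and A_less: "\<P>(\<tau> in tree_law. A \<tau>) < 1"
    and branching: "\<P>(m in \<nu>. kids m \<ge> 2) > 0"
  shows "\<P>(\<tau> in tree_law. A \<tau> \<and> \<not> extinct kids \<tau>) = 0"
proof -
  note [measurable] = extinct_measurable[OF kids]
  define p where "p n = \<P>(m in \<nu>. kids m = n)" for n
  define s where "s = \<P>(\<tau> in tree_law. A \<tau>)"
  define e where "e = \<P>(\<tau> in tree_law. extinct kids \<tau>)"
  have e0: "0 \<le> e" by (simp add: e_def)
  have e_s: "e \<le> s"
    unfolding e_def s_def by (rule tree.finite_measure_mono) (auto dest: extinct)
  have fe: "(\<lambda>n. p n * e ^ n) sums e"
    using prob_all_subtrees[of kids "extinct kids"] unfolding e_def p_def by (simp flip: extinct_iff)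
  obtain fs where fs: "(\<lambda>n. p n * s ^ n) sums fs" "s \<le> fs"
  proof
    show "(\<lambda>n. p n * s ^ n) sums \<P>(\<tau> in tree_law. \<forall>k<kids (\<tau> []). A (subtree k \<tau>))"
      unfolding s_def p_def by (rule prob_all_subtrees) measurable
    show "s \<le> \<P>(\<tau> in tree_law. \<forall>k<kids (\<tau> []). A (subtree k \<tau>))"
      unfolding s_def by (rule tree.finite_measure_mono) (auto dest: inherited)
  qed
  have f1: "p sums 1"
  proof -
    have "p sums prob (\<Union>n. {m \<in> space \<nu>. kids m = n})"
      unfolding p_def by (rule finite_measure_UNION) (auto simp: disjoint_family_on_def)
    also have "(\<Union>n. {m \<in> space \<nu>. kids m = n}) = space \<nu>" by auto
    finally show ?thesis by (simp add: prob_space)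
  qed
  have "\<exists>n\<ge>2. p n > 0"
  proof (rule ccontr)
    assume *: "\<not> (\<exists>n\<ge>2. p n > 0)"
    have "p n = 0" if "n \<ge> 2" for n
      using that * by (auto simp: p_def zero_less_measure_iff)
    then have "AE m in \<nu>. kids m \<noteq> n" if "n \<ge> 2" for n
      using that unfolding p_def by (subst (asm) prob_eq_0) auto
    then have "AE m in \<nu>. \<forall>n. n \<ge> 2 \<longrightarrow> kids m \<noteq> n" by (subst AE_all_countable) auto
    then have "AE m in \<nu>. \<not> kids m \<ge> 2" by eventually_elim auto
    then have "\<P>(m in \<nu>. kids m \<ge> 2) = 0" by (subst prob_eq_0) auto
    then show False using branching by simp
  qed
  then obtain n where n: "n \<ge> 2" "p n > 0" by blast
  have "s \<le> e"
  proof (rule ccontr)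
    assume "\<not> s \<le> e"
    then have es: "e < s" "s < 1" using A_less by (auto simp: s_def)
    define \<alpha> where "\<alpha> = (1 - s) / (1 - e)"
    have "\<alpha> * (1 - e) = 1 - s" using es by (simp add: \<alpha>_def)
    then have \<alpha>: "\<alpha> * e + (1 - \<alpha>) = s" by (simp add: algebra_simps)
    have chord: "s ^ k \<le> \<alpha> * e ^ k + (1 - \<alpha>)" for k
    proof -
      consider "k = 0" | "k = 1" | "k \<ge> 2" by linarith
      then show ?thesis
        using power_strict_chord[OF e0 es, of k] \<alpha> by cases (auto simp: \<alpha>_def)
    qed
    have sums: "(\<lambda>k. p k * (\<alpha> * e ^ k + (1 - \<alpha>) - s ^ k)) sums (\<alpha> * e + (1 - \<alpha>) * 1 - fs)"
      using sums_diff[OF sums_add[OF sums_mult[OF fe, of \<alpha>] sums_mult[OF f1, of "1 - \<alpha>"]] fs(1)]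
      by (simp add: algebra_simps)
    have "0 < (\<Sum>k. p k * (\<alpha> * e ^ k + (1 - \<alpha>) - s ^ k))"
    proof (rule suminf_pos2)
      show "0 < p n * (\<alpha> * e ^ n + (1 - \<alpha>) - s ^ n)"
        using power_strict_chord[OF e0 es n(1)] n by (simp add: \<alpha>_def)
      show "0 \<le> p k * (\<alpha> * e ^ k + (1 - \<alpha>) - s ^ k)" for k
        using chord[of k] by (simp add: p_def)
    qed (use sums in \<open>rule sums_summable\<close>)
    also have "\<dots> = s - fs" using sums_unique[OF sums] \<alpha> by simp
    finally show False using fs(2) by simp
  qed
  have "\<P>(\<tau> in tree_law. A \<tau> \<and> \<not> extinct kids \<tau>)
    = tree.prob ({\<tau> \<in> space tree_law. A \<tau>} - {\<tau> \<in> space tree_law. extinct kids \<tau>})"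
    by (intro arg_cong[where f="measure _"]) auto
  also have "\<dots> = s - e"
    unfolding s_def e_def by (rule tree.finite_measure_Diff) (auto dest: extinct)
  finally have "\<P>(\<tau> in tree_law. A \<tau> \<and> \<not> extinct kids \<tau>) = s - e" .
  moreover have "\<P>(\<tau> in tree_law. A \<tau> \<and> \<not> extinct kids \<tau>) \<ge> 0" by simp
  ultimately show ?thesis using \<open>s \<le> e\<close> by simp
qed

end

section \<open>Trajectories and genealogies\<close>

definition dyadic_above :: "nat \<Rightarrow> real \<Rightarrow> real" where
  "dyadic_above n s = max 0 ((of_int \<lfloor>2 ^ n * s\<rfloor> + 1) / 2 ^ n)"

lemma dyadic_above: "s \<ge> 0 \<Longrightarrow> s < dyadic_above n s" "s \<ge> 0 \<Longrightarrow> dyadic_above n s \<le> s + (1 / 2) ^ n"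
proof -
  assume s: "s \<ge> 0"
  have eq: "dyadic_above n s = (of_int \<lfloor>2 ^ n * s\<rfloor> + 1) / 2 ^ n"
    using s by (simp add: dyadic_above_def)
  show "s < dyadic_above n s"
    unfolding eq by (simp add: less_divide_eq mult.commute)
  have "(of_int \<lfloor>2 ^ n * s\<rfloor> + 1) / 2 ^ n \<le> (2 ^ n * s + 1) / 2 ^ n"
    by (intro divide_right_mono add_right_mono) auto
  then show "dyadic_above n s \<le> s + (1 / 2) ^ n"
    unfolding eq by (simp add: add_divide_distrib power_one_over)
qed

lemma dyadic_above_nonneg: "0 \<le> dyadic_above n s"
  by (simp add: dyadic_above_def)

lemma dyadic_above_Rats: "dyadic_above n s \<in> \<rat>"
  by (auto simp: dyadic_above_def max_def)

lemma dyadic_above_lim: "s \<ge> 0 \<Longrightarrow> (\<lambda>n. dyadic_above n s) \<longlonglongrightarrow> s"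
proof (rule tendsto_sandwich[of "\<lambda>_. s" _ _ "\<lambda>n. s + (1 / 2) ^ n"])
  show "(\<lambda>n. s + (1 / 2) ^ n) \<longlonglongrightarrow> s"
    using tendsto_add[OF tendsto_const LIMSEQ_power_zero[of "1 / 2 :: real"], of s] by simp
qed (auto intro!: always_eventually less_imp_le[OF dyadic_above(1)] dyadic_above(2))

text \<open>
  Evaluation of a path at a random time is not measurable for the product \<open>\<sigma>\<close>-algebra. The limit along
  the dyadic times is, and it agrees with the evaluation on right-continuous paths.
\<close>
definition eval_path :: "(real \<Rightarrow> real) \<Rightarrow> real \<Rightarrow> real" where
  "eval_path p s = lim (\<lambda>n. p (dyadic_above n s))"

text \<open>
  The product space of trees contains arbitrary functions as paths. Lower bounds for positions are obtained on the
  trees with regular paths, which include the trees that come from Levy processes.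
\<close>
definition regular :: "(real \<Rightarrow> real) \<Rightarrow> bool" where
  "regular p \<longleftrightarrow> (\<forall>s\<ge>0. (\<lambda>n. p (dyadic_above n s)) \<longlonglongrightarrow> eval_path p s)"

lemma eval_path_measurable[measurable (raw)]:
  assumes [measurable]: "f \<in> N \<rightarrow>\<^sub>M path_space" "g \<in> borel_measurable N"
  shows "(\<lambda>x. eval_path (f x) (g x)) \<in> borel_measurable N"
  unfolding eval_path_def
proof (rule borel_measurable_lim_metric)
  fix n
  show "(\<lambda>x. f x (dyadic_above n (g x))) \<in> borel_measurable N"
    unfolding dyadic_above_def
  proof (rule measurable_compose_countable[where g="\<lambda>x. \<lfloor>2 ^ n * g x\<rfloor>"])
    fix i :: int
    have "(\<lambda>p. p (max 0 ((of_int i + 1) / 2 ^ n))) \<in> path_space \<rightarrow>\<^sub>M borel"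
      unfolding path_space_def by (rule measurable_component_singleton) simp
    from measurable_compose[OF assms(1) this]
    show "(\<lambda>x. f x (max 0 ((of_int i + 1) / 2 ^ n))) \<in> borel_measurable N" .
  qed measurable
qed

lemma cadlag_dyadic_lim:
  assumes "cadlag f" "s \<ge> 0"
  shows "(\<lambda>n. restrict f {0..} (dyadic_above n s)) \<longlonglongrightarrow> f s"
proof -
  have "(f \<longlongrightarrow> f s) (at_right s)"
    using assms by (auto simp: cadlag_def continuous_within)
  moreover have "filterlim (\<lambda>n. dyadic_above n s) (at_right s) sequentially"
    using dyadic_above_lim[OF assms(2)] dyadic_above(1)[OF assms(2)] less_imp_not_eq2[OF dyadic_above(1)[OF assms(2)]]
    by (auto simp: filterlim_at intro!: always_eventually)
  ultimately have "(\<lambda>n. f (dyadic_above n s)) \<longlonglongrightarrow> f s"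
    by (rule filterlim_compose)
  then show ?thesis by (simp add: dyadic_above_nonneg)
qed

lemma eval_path_cadlag: "cadlag f \<Longrightarrow> s \<ge> 0 \<Longrightarrow> eval_path (restrict f {0..}) s = f s"
  unfolding eval_path_def by (rule limI) (rule cadlag_dyadic_lim)

lemma regular_cadlag: "cadlag f \<Longrightarrow> regular (restrict f {0..})"
  by (auto simp: regular_def eval_path_cadlag simp del: restrict_apply intro!: cadlag_dyadic_lim)

text \<open>
  Right-continuity and the left limit bound the function near each point; compactness of the interval
  is used in the form of a bisection argument.
\<close>
lemma cadlag_bounded_below:
  assumes f: "cadlag f" and "0 \<le> T"
  shows "\<exists>D. \<forall>s\<in>{0..T}. D \<le> f s"
proof -
  define P where "P a b \<longleftrightarrow> a \<ge> 0 \<longrightarrow> (\<exists>D. \<forall>s\<in>{a..b}. D \<le> f s)" for a b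
  have "P 0 T"
  proof (rule Bolzano[OF \<open>0 \<le> T\<close>])
    fix a b c assume *: "P a b" "P b c" "a \<le> b" "b \<le> c"
    show "P a c"
      unfolding P_def
    proof
      assume "0 \<le> a"
      with * obtain D D' where "\<forall>s\<in>{a..b}. D \<le> f s" "\<forall>s\<in>{b..c}. D' \<le> f s"
        by (auto simp: P_def)
      then have "\<forall>s\<in>{a..c}. min D D' \<le> f s" by (metis atLeastAtMost_iff linear min.coboundedI1 min.coboundedI2)
      then show "\<exists>D. \<forall>s\<in>{a..c}. D \<le> f s" by blast
    qed
  next
    fix x assume x: "0 \<le> x" "x \<le> T"
    have right: "\<exists>d>0. \<forall>s. x < s \<and> s < x + d \<longrightarrow> f x - 1 \<le> f s"
    proof -
      have "(f \<longlongrightarrow> f x) (at_right x)" using f x by (auto simp: cadlag_def continuous_within)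
      then have "\<forall>\<^sub>F s in at_right x. f x - 1 < f s" by (rule order_tendstoD) simp
      then obtain b where "b > x" "\<forall>s. x < s \<and> s < b \<longrightarrow> f x - 1 < f s"
        by (auto simp: eventually_at_right_field)
      then show ?thesis by (intro exI[of _ "b - x"]) auto
    qed
    have left: "\<exists>d>0. \<exists>D. \<forall>s. x - d < s \<and> s < x \<and> 0 \<le> s \<longrightarrow> D \<le> f s"
    proof (cases "x = 0")
      case False
      then obtain l where "(f \<longlongrightarrow> l) (at_left x)" using f x by (force simp: cadlag_def)
      then have "\<forall>\<^sub>F s in at_left x. l - 1 < f s" by (rule order_tendstoD) simp
      then obtain b where "b < x" "\<forall>s. b < s \<and> s < x \<longrightarrow> l - 1 < f s"
        by (auto simp: eventually_at_left_field)
      then show ?thesis by (intro exI[of _ "x - b"] conjI exI[of _ "l - 1"]) auto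
    qed (auto intro!: exI[of _ 1])
    from right left obtain d d' D where d: "d > 0" "\<forall>s. x < s \<and> s < x + d \<longrightarrow> f x - 1 \<le> f s"
      "d' > 0" "\<forall>s. x - d' < s \<and> s < x \<and> 0 \<le> s \<longrightarrow> D \<le> f s" by blast
    have "P a b" if ab: "a \<le> x" "x \<le> b" "b - a < min d d'" for a b
      unfolding P_def
    proof (intro impI exI[of _ "min (f x - 1) D"] ballI)
      fix s assume "0 \<le> a" "s \<in> {a..b}"
      then consider "s = x" | "x < s" "s < x + d" | "s < x" "x - d' < s" "0 \<le> s"
        using ab by fastforce
      then show "min (f x - 1) D \<le> f s" using d by cases (auto simp: min_le_iff_disj)
    qed
    then show "\<exists>d>0. \<forall>a b. a \<le> x \<and> x \<le> b \<and> b - a < d \<longrightarrow> P a b"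
      using d by (intro exI[of _ "min d d'"]) auto
  qed
  then show ?thesis by (simp add: P_def)
qed

type_synonym mark = "(real \<Rightarrow> real) \<times> real \<times> nat"

abbreviation motion :: "mark \<Rightarrow> real \<Rightarrow> real" where "motion \<equiv> fst"
abbreviation life :: "mark \<Rightarrow> real" where "life m \<equiv> fst (snd m)"
abbreviation kids :: "mark \<Rightarrow> nat" where "kids m \<equiv> snd (snd m)"

text \<open>
  Trees are read from the root, contrary to the reversed Ulam--Harris labels, which makes the first branching
  the outermost step of the recursion. Positions are relative to the starting point of the root.
\<close>
fun alive_at :: "real \<Rightarrow> (nat list \<Rightarrow> mark) \<Rightarrow> nat list \<Rightarrow> bool" where
  "alive_at t \<tau> [] \<longleftrightarrow> 0 \<le> t \<and> t < life (\<tau> [])"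
| "alive_at t \<tau> (k # l) \<longleftrightarrow> k < kids (\<tau> []) \<and> alive_at (t - life (\<tau> [])) (subtree k \<tau>) l"

fun position_at :: "real \<Rightarrow> (nat list \<Rightarrow> mark) \<Rightarrow> nat list \<Rightarrow> real" where
  "position_at t \<tau> [] = eval_path (motion (\<tau> [])) t"
| "position_at t \<tau> (k # l) =
    eval_path (motion (\<tau> [])) (life (\<tau> [])) + position_at (t - life (\<tau> [])) (subtree k \<tau>) l"

fun born_in :: "(nat list \<Rightarrow> mark) \<Rightarrow> nat list \<Rightarrow> bool" where
  "born_in \<tau> [] \<longleftrightarrow> True"
| "born_in \<tau> (k # l) \<longleftrightarrow> k < kids (\<tau> []) \<and> born_in (subtree k \<tau>) l"

fun time_of :: "(nat list \<Rightarrow> mark) \<Rightarrow> nat list \<Rightarrow> real" where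
  "time_of \<tau> [] = 0"
| "time_of \<tau> (k # l) = life (\<tau> []) + time_of (subtree k \<tau>) l"

fun place_of :: "(nat list \<Rightarrow> mark) \<Rightarrow> nat list \<Rightarrow> real" where
  "place_of \<tau> [] = 0"
| "place_of \<tau> (k # l) = eval_path (motion (\<tau> [])) (life (\<tau> [])) + place_of (subtree k \<tau>) l"

lemma alive_at_append:
  "alive_at t \<tau> (l @ l') \<longleftrightarrow> born_in \<tau> l \<and> alive_at (t - time_of \<tau> l) (subtree_at l \<tau>) l'"
  by (induction l arbitrary: t \<tau>) (auto simp: subtree_at_Cons algebra_simps)

lemma position_at_append:
  "position_at t \<tau> (l @ l') = place_of \<tau> l + position_at (t - time_of \<tau> l) (subtree_at l \<tau>) l'"
  by (induction l arbitrary: t \<tau>) (auto simp: subtree_at_Cons algebra_simps)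

definition regular_tree :: "(nat list \<Rightarrow> mark) \<Rightarrow> bool" where
  "regular_tree \<tau> \<longleftrightarrow> (\<forall>l. regular (motion (\<tau> l)))"

lemma regular_subtree: "regular_tree \<tau> \<Longrightarrow> regular_tree (subtree k \<tau>)"
  by (simp add: regular_tree_def subtree_def)

lemma regular_subtree_at: "regular_tree \<tau> \<Longrightarrow> regular_tree (subtree_at l \<tau>)"
  by (simp add: regular_tree_def subtree_at_def)

text \<open>
  A tree with finitely many generations is finite, since every particle has finitely many children, and
  all its particles die before some time.
\<close>
lemma extinct_by_imp_not_alive:
  "extinct_by kids n \<tau> \<Longrightarrow> \<exists>t\<^sub>0. \<forall>t\<ge>t\<^sub>0. \<forall>l. \<not> alive_at t \<tau> l"
proof (induction n arbitrary: \<tau>)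
  case (Suc n)
  then have "\<forall>k<kids (\<tau> []). \<exists>t\<^sub>0. \<forall>t\<ge>t\<^sub>0. \<forall>l. \<not> alive_at t (subtree k \<tau>) l" by auto
  then obtain s where s: "\<And>k t l. k < kids (\<tau> []) \<Longrightarrow> t \<ge> s k \<Longrightarrow> \<not> alive_at t (subtree k \<tau>) l" by metis
  define t\<^sub>0 where "t\<^sub>0 = life (\<tau> []) + (\<Sum>k<kids (\<tau> []). \<bar>s k\<bar>)"
  have "\<not> alive_at t \<tau> l" if t: "t \<ge> t\<^sub>0" for t l
  proof (cases l)
    case Nil
    have "life (\<tau> []) \<le> t\<^sub>0" by (simp add: t\<^sub>0_def sum_nonneg)
    then show ?thesis using t Nil by simp
  next
    case (Cons k l')
    have "t - life (\<tau> []) \<ge> s k" if "k < kids (\<tau> [])"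
    proof -
      have "\<bar>s k\<bar> \<le> (\<Sum>k<kids (\<tau> []). \<bar>s k\<bar>)" using that by (intro member_le_sum) auto
      then show ?thesis using t by (simp add: t\<^sub>0_def)
    qed
    then show ?thesis using s Cons by auto
  qed
  then show ?case by blast
qed simp

section \<open>The law of a marked tree\<close>

lemma exp_ereal_real: "exp_ereal (ereal k) = ennreal (exp k)"
  by (simp add: exp_ereal_def)

lemma nn_integral_exponential_density:
  assumes "0 < l"
  shows "(\<integral>\<^sup>+s. ennreal (exponential_density l s) \<partial>lborel) = 1"
proof -
  interpret prob_space "density lborel (exponential_density l)"
    by (rule prob_space_exponential_density) fact
  show ?thesis using emeasure_space_1 by (simp add: emeasure_density)
qed

lemma nn_integral_exponential_density_atMost:
  assumes "0 < l" "0 \<le> t"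
  shows "(\<integral>\<^sup>+s. ennreal (exponential_density l s) * indicator {..t} s \<partial>lborel) = ennreal (1 - exp (- l * t))"
  using emeasure_erlang_density[of l 0 t] assms
  by (simp add: emeasure_density erlang_CDF_def mult.commute)

text \<open>
  What the proof uses of the law of a mark. The set of paths with left limits is not measurable for the product
  \<open>\<sigma>\<close>-algebra; the last assumption keeps the consequence that a path is bounded below during the life of its
  particle.
\<close>
locale branching_tree =
  PX: prob_space PX + PT: prob_space PT + PN: prob_space PN
  for PX :: "(real \<Rightarrow> real) measure" and PT :: "real measure" and PN :: "nat measure" +
  fixes \<nu> :: "mark measure" and rate \<mu> :: real and K :: "real \<Rightarrow> ereal"
  assumes nu_eq: "\<nu> = PX \<Otimes>\<^sub>M PT \<Otimes>\<^sub>M PN"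
    and PX_sets[measurable_cong]: "sets PX = sets path_space"
    and PT_eq: "PT = density lborel (exponential_density rate)"
    and PN_sets[measurable_cong]: "sets PN = sets (count_space UNIV)"
    and rate: "rate > 0" and \<mu>: "\<mu> > 0"
    and K_finite_below: "K \<theta> \<noteq> -\<infinity>"
    and mgf: "s \<ge> 0 \<Longrightarrow> (\<integral>\<^sup>+p. ennreal (exp (\<theta> * eval_path p s)) \<partial>PX) = exp_ereal (ereal s * K \<theta>)"
    and mean: "(\<integral>\<^sup>+n. of_nat n \<partial>PN) = ennreal (1 + \<mu>)"
    and bounded_below: "AE m in \<nu>. \<exists>D::nat. \<forall>q::rat. 0 \<le> q \<longrightarrow> real_of_rat q < life m \<longrightarrow> - real D \<le> motion m (real_of_rat q)"
begin

lemma PT_sets[measurable_cong]: "sets PT = sets borel"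
  by (simp add: PT_eq)

lemma nu_sets[measurable_cong]: "sets \<nu> = sets mark_space"
  unfolding nu_eq mark_space_def by (intro sets_pair_measure_cong PX_sets PT_sets PN_sets)

lemma motion_measurable[measurable]: "motion \<in> \<nu> \<rightarrow>\<^sub>M path_space"
  by (subst measurable_cong_sets[OF nu_sets refl]) (simp add: mark_space_def)

lemma life_measurable[measurable]: "(\<lambda>m. life m) \<in> borel_measurable \<nu>"
  by (subst measurable_cong_sets[OF nu_sets refl]) (simp add: mark_space_def)

lemma kids_measurable[measurable]: "(\<lambda>m. kids m) \<in> \<nu> \<rightarrow>\<^sub>M count_space UNIV"
  by (subst measurable_cong_sets[OF nu_sets refl]) (simp add: mark_space_def)

sublocale PTN: pair_prob_space PT PN ..
sublocale PXTN: pair_prob_space PX "PT \<Otimes>\<^sub>M PN" ..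

sublocale iid_tree \<nu>
  unfolding iid_tree_def nu_eq by unfold_locales

lemma nn_integral_nu:
  assumes f[measurable]: "f \<in> borel_measurable \<nu>"
  shows "(\<integral>\<^sup>+m. f m \<partial>\<nu>) = (\<integral>\<^sup>+n. \<integral>\<^sup>+s. \<integral>\<^sup>+p. f (p, s, n) \<partial>PX \<partial>PT \<partial>PN)"
proof -
  have [measurable]: "f \<in> borel_measurable (PX \<Otimes>\<^sub>M PT \<Otimes>\<^sub>M PN)" using f by (simp add: nu_eq)
  have "(\<integral>\<^sup>+m. f m \<partial>\<nu>) = (\<integral>\<^sup>+sn. \<integral>\<^sup>+p. f (p, sn) \<partial>PX \<partial>(PT \<Otimes>\<^sub>M PN))"
    unfolding nu_eq by (rule PXTN.nn_integral_snd[symmetric]) simp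
  also have "\<dots> = (\<integral>\<^sup>+n. \<integral>\<^sup>+s. \<integral>\<^sup>+p. f (p, s, n) \<partial>PX \<partial>PT \<partial>PN)"
    by (rule PTN.nn_integral_snd[symmetric]) measurable
  finally show ?thesis .
qed

text \<open>
  At the end of its life a particle has the exponential moment of the process killed at an independent
  exponential time, and it has \<open>1 + \<mu>\<close> children in the mean, independently.
\<close>
lemma nn_integral_at_death:
  assumes [measurable]: "\<phi> \<in> borel_measurable borel"
  shows "(\<integral>\<^sup>+m. of_nat (kids m) * (ennreal (exp (\<theta> * eval_path (motion m) (life m))) * \<phi> (life m)) \<partial>\<nu>)
    = ennreal (1 + \<mu>) * (\<integral>\<^sup>+s. ennreal (exponential_density rate s) * (exp_ereal (ereal s * K \<theta>) * \<phi> s) \<partial>lborel)"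
proof -
  have [measurable]: "(\<lambda>p. eval_path p s) \<in> borel_measurable PX" for s
    by measurable
  have "(\<integral>\<^sup>+m. of_nat (kids m) * (ennreal (exp (\<theta> * eval_path (motion m) (life m))) * \<phi> (life m)) \<partial>\<nu>)
    = (\<integral>\<^sup>+n. \<integral>\<^sup>+s. \<integral>\<^sup>+p. of_nat n * (ennreal (exp (\<theta> * eval_path p s)) * \<phi> s) \<partial>PX \<partial>PT \<partial>PN)"
    by (subst nn_integral_nu) auto
  also have "\<dots> = (\<integral>\<^sup>+n. of_nat n * (\<integral>\<^sup>+s. (\<integral>\<^sup>+p. ennreal (exp (\<theta> * eval_path p s)) \<partial>PX) * \<phi> s \<partial>PT) \<partial>PN)"
    by (simp add: nn_integral_cmult nn_integral_multc)
  also have "\<dots> = ennreal (1 + \<mu>) * (\<integral>\<^sup>+s. (\<integral>\<^sup>+p. ennreal (exp (\<theta> * eval_path p s)) \<partial>PX) * \<phi> s \<partial>PT)"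
    by (simp add: nn_integral_multc mean)
  also have "(\<integral>\<^sup>+s. (\<integral>\<^sup>+p. ennreal (exp (\<theta> * eval_path p s)) \<partial>PX) * \<phi> s \<partial>PT)
    = (\<integral>\<^sup>+s. ennreal (exponential_density rate s) * ((\<integral>\<^sup>+p. ennreal (exp (\<theta> * eval_path p s)) \<partial>PX) * \<phi> s) \<partial>lborel)"
    unfolding PT_eq by (subst nn_integral_density) (auto simp: exponential_density_def)
  also have "\<dots> = (\<integral>\<^sup>+s. ennreal (exponential_density rate s) * (exp_ereal (ereal s * K \<theta>) * \<phi> s) \<partial>lborel)"
    by (intro nn_integral_cong) (auto simp: exponential_density_def mgf)
  finally show ?thesis .
qed

lemma nn_integral_before_death:
  assumes "t \<ge> 0"
  shows "(\<integral>\<^sup>+m. (if t < life m then ennreal (exp (\<theta> * eval_path (motion m) t)) else 0) \<partial>\<nu>)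
    = ennreal (exp (- rate * t)) * exp_ereal (ereal t * K \<theta>)"
proof -
  have [measurable]: "(\<lambda>p. eval_path p t) \<in> borel_measurable PX"
    by measurable
  have "(\<integral>\<^sup>+m. (if t < life m then ennreal (exp (\<theta> * eval_path (motion m) t)) else 0) \<partial>\<nu>)
    = (\<integral>\<^sup>+m. indicator {t<..} (life m) * ennreal (exp (\<theta> * eval_path (motion m) t)) \<partial>\<nu>)"
    by (intro nn_integral_cong) auto
  also have "\<dots> = (\<integral>\<^sup>+n. \<integral>\<^sup>+s. \<integral>\<^sup>+p. indicator {t<..} s * ennreal (exp (\<theta> * eval_path p t)) \<partial>PX \<partial>PT \<partial>PN)"
    by (subst nn_integral_nu) auto
  also have "\<dots> = (\<integral>\<^sup>+n. (\<integral>\<^sup>+s. indicator {t<..} s * exp_ereal (ereal t * K \<theta>) \<partial>PT) \<partial>PN)"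
    using assms by (simp add: nn_integral_cmult mgf)
  also have "\<dots> = emeasure PT {t<..} * exp_ereal (ereal t * K \<theta>)"
    by (simp add: nn_integral_multc PN.emeasure_space_1)
  also have "emeasure PT {t<..} = ennreal (exp (- rate * t))"
  proof -
    have "PT.prob {..t} = 1 - exp (- rate * t)"
      using nn_integral_exponential_density_atMost[OF rate assms] rate assms
      by (simp add: PT_eq measure_def emeasure_density)
    moreover have "{t<..} = space PT - {..t}" by (auto simp: PT_eq)
    ultimately have "PT.prob {t<..} = exp (- rate * t)"
      using PT.prob_compl[of "{..t}"] by simp
    then show ?thesis by (simp add: PT.emeasure_eq_measure)
  qed
  finally show ?thesis .
qed

end

section \<open>First moments of the branching process\<close>

text \<open>
  The sum of \<open>exp (\<theta> x)\<close> over the positions \<open>x\<close> at time \<open>t\<close> of the particles of the first \<open>n\<close> generations,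
  written as a recursion over the first branching with finite sums only.
\<close>
fun weight :: "real \<Rightarrow> nat \<Rightarrow> real \<Rightarrow> (nat list \<Rightarrow> mark) \<Rightarrow> ennreal" where
  "weight \<theta> 0 t \<tau> = 0"
| "weight \<theta> (Suc n) t \<tau> =
    (if 0 \<le> t \<and> t < life (\<tau> []) then ennreal (exp (\<theta> * eval_path (motion (\<tau> [])) t)) else 0)
    + (\<Sum>k<kids (\<tau> []). ennreal (exp (\<theta> * eval_path (motion (\<tau> [])) (life (\<tau> []))))
        * weight \<theta> n (t - life (\<tau> [])) (subtree k \<tau>))"

lemma sum_alive_le_weight:
  assumes "finite F" "\<And>l. l \<in> F \<Longrightarrow> alive_at t \<tau> l \<and> length l < n"
  shows "(\<Sum>l\<in>F. ennreal (exp (\<theta> * position_at t \<tau> l))) \<le> weight \<theta> n t \<tau>"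
  using assms
proof (induction n arbitrary: F t \<tau>)
  case 0
  then have "F = {}" by auto
  then show ?case by simp
next
  case (Suc n)
  let ?f = "\<lambda>l. ennreal (exp (\<theta> * position_at t \<tau> l))"
  define G where "G k = {l. k # l \<in> F}" for k
  have G: "finite (G k)" for k
    unfolding G_def using finite_vimageI[OF \<open>finite F\<close>, of "\<lambda>l. k # l"] by (simp add: vimage_def inj_on_def)
  have "F - {[]} = (\<lambda>(k, l). k # l) ` (SIGMA k:{..<kids (\<tau> [])}. G k)"
  proof (rule set_eqI)
    fix x show "x \<in> F - {[]} \<longleftrightarrow> x \<in> (\<lambda>(k, l). k # l) ` (SIGMA k:{..<kids (\<tau> [])}. G k)"
      using Suc.prems(2)[of x] by (cases x) (auto simp: G_def image_iff)
  qed
  moreover have "inj_on (\<lambda>(k, l). k # l) (SIGMA k:{..<kids (\<tau> [])}. G k)"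
    by (auto simp: inj_on_def)
  ultimately have "(\<Sum>l\<in>F - {[]}. ?f l) = (\<Sum>(k, l)\<in>(SIGMA k:{..<kids (\<tau> [])}. G k). ?f (k # l))"
    by (simp add: sum.reindex comp_def split_beta' del: position_at.simps)
  also have "\<dots> = (\<Sum>k<kids (\<tau> []). \<Sum>l\<in>G k. ?f (k # l))"
    using G by (subst sum.Sigma) auto
  also have "\<dots> = (\<Sum>k<kids (\<tau> []). ennreal (exp (\<theta> * eval_path (motion (\<tau> [])) (life (\<tau> []))))
      * (\<Sum>l\<in>G k. ennreal (exp (\<theta> * position_at (t - life (\<tau> [])) (subtree k \<tau>) l))))"
    by (simp add: sum_distrib_left distrib_left exp_add ennreal_mult del: sum_ennreal)
  also have "\<dots> \<le> (\<Sum>k<kids (\<tau> []). ennreal (exp (\<theta> * eval_path (motion (\<tau> [])) (life (\<tau> []))))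
      * weight \<theta> n (t - life (\<tau> [])) (subtree k \<tau>))"
  proof (intro sum_mono mult_left_mono Suc.IH G)
    fix k l assume "l \<in> G k"
    then show "alive_at (t - life (\<tau> [])) (subtree k \<tau>) l \<and> length l < n"
      using Suc.prems(2)[of "k # l"] by (auto simp: G_def)
  qed simp
  finally have 1: "(\<Sum>l\<in>F - {[]}. ?f l) \<le> \<dots>" .
  have 2: "(\<Sum>l\<in>F \<inter> {[]}. ?f l) \<le> (if 0 \<le> t \<and> t < life (\<tau> []) then ennreal (exp (\<theta> * eval_path (motion (\<tau> [])) t)) else 0)"
    using Suc.prems(2)[of "[]"] by (cases "[] \<in> F") auto
  have "(\<Sum>l\<in>F. ?f l) = (\<Sum>l\<in>F \<inter> {[]}. ?f l) + (\<Sum>l\<in>F - {[]}. ?f l)"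
    using Suc.prems(1) by (rule sum.Int_Diff)
  then show ?case using add_mono[OF 2 1] by simp
qed

lemma weight_mono: "weight \<theta> n t \<tau> \<le> weight \<theta> (Suc n) t \<tau>"
proof (induction n arbitrary: t \<tau>)
  case (Suc n)
  show ?case
    unfolding weight.simps(2)[of \<theta> "Suc n" t \<tau>] weight.simps(2)[of \<theta> n t \<tau>]
    by (intro add_mono order_refl sum_mono mult_left_mono Suc) simp
qed simp

lemma suminf_if_less: "(\<Sum>k. if k < n then f k else 0 :: ennreal) = (\<Sum>k<n. f k)" for n :: nat
  by (subst suminf_finite[of "{..<n}"]) auto

context branching_tree
begin

lemma weight_measurable[measurable]:
  "f \<in> borel_measurable N \<Longrightarrow> h \<in> N \<rightarrow>\<^sub>M tree_law \<Longrightarrow> (\<lambda>x. weight \<theta> n (f x) (h x)) \<in> borel_measurable N"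
proof (induction n arbitrary: f h)
  case (Suc n)
  note [measurable] = Suc.prems
  have [measurable]: "(\<lambda>x. h x []) \<in> N \<rightarrow>\<^sub>M \<nu>"
    by (rule measurable_compose[OF Suc.prems(2) measurable_root])
  have [measurable]: "(\<lambda>x. weight \<theta> n (f x - life (h x [])) (subtree k (h x))) \<in> borel_measurable N" for k
    by (rule Suc.IH) measurable
  have "(\<lambda>x. \<Sum>k<kids (h x []). ennreal (exp (\<theta> * eval_path (motion (h x [])) (life (h x []))))
        * weight \<theta> n (f x - life (h x [])) (subtree k (h x))) \<in> borel_measurable N"
    by (rule measurable_compose_countable[where g="\<lambda>x. kids (h x [])"]) measurable
  then show ?case by simp
qed simp

text \<open>
  Looking at the first branching time gives a renewal equation, which \<open>exp ((K \<theta> + rate \<mu>) t)\<close> solves. The means of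
  the partial sums are its iterates started from \<open>0\<close>, and they stay below the solution by monotonicity.
\<close>
lemma nn_integral_weight_le:
  assumes K: "K \<theta> = ereal \<kappa>"
  shows "(\<integral>\<^sup>+\<tau>. weight \<theta> n t \<tau> \<partial>tree_law) \<le> (if t < 0 then 0 else ennreal (exp ((\<kappa> + rate * \<mu>) * t)))"
proof (induction n arbitrary: t)
  case (Suc n)
  define b where "b t = (if t < 0 then 0 else ennreal (exp ((\<kappa> + rate * \<mu>) * t)))" for t
  have [measurable]: "b \<in> borel_measurable borel" unfolding b_def by measurable
  have IH: "(\<integral>\<^sup>+\<tau>. weight \<theta> n t \<tau> \<partial>tree_law) \<le> b t" for t
    using Suc.IH unfolding b_def .
  define d where "d m = (if 0 \<le> t \<and> t < life m then ennreal (exp (\<theta> * eval_path (motion m) t)) else 0)" for m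
  have [measurable]: "d \<in> borel_measurable \<nu>" unfolding d_def by measurable
  define e where "e m = ennreal (exp (\<theta> * eval_path (motion m) (life m)))" for m
  have [measurable]: "e \<in> borel_measurable \<nu>" unfolding e_def by measurable
  have "(\<integral>\<^sup>+\<tau>. d (\<tau> []) \<partial>tree_law)
    = (\<integral>\<^sup>+m. d m \<partial>distr tree_law \<nu> (\<lambda>\<tau>. \<tau> []))"
    by (subst nn_integral_distr) auto
  also have "\<dots> = (if t < 0 then 0 else ennreal (exp ((\<kappa> - rate) * t)))"
    using nn_integral_before_death[of t \<theta>]
    by (auto simp: d_def distr_root K exp_ereal_def ennreal_mult[symmetric] exp_add[symmetric] algebra_simps)
  finally have first: "(\<integral>\<^sup>+\<tau>. d (\<tau> []) \<partial>tree_law) = \<dots>" .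
  have "(\<integral>\<^sup>+\<tau>. (\<Sum>k<kids (\<tau> []). e (\<tau> []) * weight \<theta> n (t - life (\<tau> [])) (subtree k \<tau>)) \<partial>tree_law)
    = (\<Sum>k. \<integral>\<^sup>+\<tau>. (if k < kids (\<tau> []) then e (\<tau> []) * weight \<theta> n (t - life (\<tau> [])) (subtree k \<tau>) else 0) \<partial>tree_law)"
    by (subst nn_integral_suminf[symmetric]) (auto simp: suminf_if_less)
  also have "\<dots> \<le> (\<Sum>k. \<integral>\<^sup>+m. (if k < kids m then e m * b (t - life m) else 0) \<partial>\<nu>)"
  proof (intro suminf_le allI summableI)
    fix k
    have 1: "(\<integral>\<^sup>+\<tau>. (if k < kids (\<tau> []) then e (\<tau> []) * weight \<theta> n (t - life (\<tau> [])) (subtree k \<tau>) else 0) \<partial>tree_law)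
      = (\<integral>\<^sup>+m. \<integral>\<^sup>+\<sigma>. (if k < kids m then e m * weight \<theta> n (t - life m) \<sigma> else 0) \<partial>tree_law \<partial>\<nu>)"
      using nn_integral_root_subtree[of "\<lambda>(m, \<sigma>). if k < kids m then e m * weight \<theta> n (t - life m) \<sigma> else 0" k]
      by simp
    have 2: "(\<integral>\<^sup>+\<sigma>. (if k < kids m then e m * weight \<theta> n (t - life m) \<sigma> else 0) \<partial>tree_law)
        \<le> (if k < kids m then e m * b (t - life m) else 0)" for m
      using IH by (auto simp: nn_integral_cmult intro!: mult_left_mono)
    show "(\<integral>\<^sup>+\<tau>. (if k < kids (\<tau> []) then e (\<tau> []) * weight \<theta> n (t - life (\<tau> [])) (subtree k \<tau>) else 0) \<partial>tree_law)
        \<le> (\<integral>\<^sup>+m. (if k < kids m then e m * b (t - life m) else 0) \<partial>\<nu>)"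
      unfolding 1 by (intro nn_integral_mono 2)
  qed
  also have "\<dots> = (\<integral>\<^sup>+m. of_nat (kids m) * (e m * b (t - life m)) \<partial>\<nu>)"
    by (subst nn_integral_suminf[symmetric]) (auto simp: suminf_if_less)
  also have "\<dots> = ennreal (1 + \<mu>) * (\<integral>\<^sup>+s. ennreal (exponential_density rate s) * (exp_ereal (ereal s * K \<theta>) * b (t - s)) \<partial>lborel)"
    unfolding e_def by (rule nn_integral_at_death[where \<phi>="\<lambda>s. b (t - s)"]) measurable
  \<comment> \<open>The integrand is \<open>exp ((\<kappa> + rate * \<mu>) * t)\<close> times an exponential density of rate \<open>rate * (1 + \<mu>)\<close>,
    cut off at \<open>t\<close>.\<close>
  also have "\<dots> = (if t < 0 then 0 else ennreal (exp ((\<kappa> + rate * \<mu>) * t) - exp ((\<kappa> - rate) * t)))"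
  proof (cases "t < 0")
    case True
    have "(\<integral>\<^sup>+s. ennreal (exponential_density rate s) * (exp_ereal (ereal s * K \<theta>) * b (t - s)) \<partial>lborel) = (\<integral>\<^sup>+(s::real). 0 \<partial>lborel)"
      by (intro nn_integral_cong) (use True in \<open>auto simp: exponential_density_def b_def\<close>)
    then show ?thesis using True by simp
  next
    case False
    let ?l = "rate * (1 + \<mu>)"
    have l: "?l > 0" using rate \<mu> by simp
    have exp_K: "exp_ereal (ereal s * K \<theta>) = ennreal (exp (s * \<kappa>))" for s
      by (simp add: K exp_ereal_real)
    have "ennreal (1 + \<mu>) * (\<integral>\<^sup>+s. ennreal (exponential_density rate s) * (exp_ereal (ereal s * K \<theta>) * b (t - s)) \<partial>lborel)
      = (\<integral>\<^sup>+s. ennreal (1 + \<mu>) * (ennreal (exponential_density rate s) * (exp_ereal (ereal s * K \<theta>) * b (t - s))) \<partial>lborel)"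
      unfolding exp_K by (rule nn_integral_cmult[symmetric]) measurable
    also have "\<dots> = (\<integral>\<^sup>+s. ennreal (exp ((\<kappa> + rate * \<mu>) * t)) * (ennreal (exponential_density ?l s) * indicator {..t} s) \<partial>lborel)"
    proof (intro nn_integral_cong)
      fix s
      have "(1 + \<mu>) * (rate * exp (- s * rate) * (exp (s * \<kappa>) * exp ((\<kappa> + rate * \<mu>) * (t - s))))
        = exp ((\<kappa> + rate * \<mu>) * t) * (?l * exp (- s * ?l))"
      proof -
        have "exp (- s * rate) * (exp (s * \<kappa>) * exp ((\<kappa> + rate * \<mu>) * (t - s))) = exp ((\<kappa> + rate * \<mu>) * t) * exp (- s * ?l)"
          by (simp add: exp_add[symmetric] algebra_simps)
        then show ?thesis by (simp add: mult_ac)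
      qed
      moreover have "0 \<le> 1 + \<mu>" "0 \<le> rate" "0 \<le> rate * (1 + \<mu>)" using rate \<mu> by auto
      ultimately show "ennreal (1 + \<mu>) * (ennreal (exponential_density rate s) * (exp_ereal (ereal s * K \<theta>) * b (t - s)))
        = ennreal (exp ((\<kappa> + rate * \<mu>) * t)) * (ennreal (exponential_density ?l s) * indicator {..t} s)"
        by (cases "s < 0"; cases "t < s")
          (simp_all add: exponential_density_def b_def exp_K ennreal_mult[symmetric])
    qed
    also have "\<dots> = ennreal (exp ((\<kappa> + rate * \<mu>) * t)) * ennreal (1 - exp (- ?l * t))"
    proof (subst nn_integral_cmult)
      show "ennreal (exp ((\<kappa> + rate * \<mu>) * t)) * (\<integral>\<^sup>+s. ennreal (exponential_density ?l s) * indicator {..t} s \<partial>lborel)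
        = ennreal (exp ((\<kappa> + rate * \<mu>) * t)) * ennreal (1 - exp (- ?l * t))"
        using False by (subst nn_integral_exponential_density_atMost[OF l]) auto
    qed measurable
    also have "\<dots> = ennreal (exp ((\<kappa> + rate * \<mu>) * t) - exp ((\<kappa> - rate) * t))"
    proof (subst ennreal_mult[symmetric])
      have "(\<kappa> + rate * \<mu>) * t + - ?l * t = (\<kappa> - rate) * t" by (simp add: algebra_simps)
      then show "ennreal (exp ((\<kappa> + rate * \<mu>) * t) * (1 - exp (- ?l * t)))
        = ennreal (exp ((\<kappa> + rate * \<mu>) * t) - exp ((\<kappa> - rate) * t))"
        by (simp only: right_diff_distrib exp_add[symmetric] mult_1_right)
    qed (use False l in auto)
    finally show ?thesis using False by simp
  qed
  finally have second: "(\<integral>\<^sup>+\<tau>. (\<Sum>k<kids (\<tau> []). e (\<tau> []) * weight \<theta> n (t - life (\<tau> [])) (subtree k \<tau>)) \<partial>tree_law) \<le> \<dots>" .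
  have [measurable]: "(\<lambda>\<tau>. \<Sum>k<kids (\<tau> []). e (\<tau> []) * weight \<theta> n (t - life (\<tau> [])) (subtree k \<tau>)) \<in> borel_measurable tree_law"
    by (rule measurable_compose_countable[where g="\<lambda>\<tau>. kids (\<tau> [])"]) measurable
  have "(\<integral>\<^sup>+\<tau>. weight \<theta> (Suc n) t \<tau> \<partial>tree_law)
    = (\<integral>\<^sup>+\<tau>. d (\<tau> []) \<partial>tree_law)
    + (\<integral>\<^sup>+\<tau>. (\<Sum>k<kids (\<tau> []). e (\<tau> []) * weight \<theta> n (t - life (\<tau> [])) (subtree k \<tau>)) \<partial>tree_law)"
    unfolding weight.simps e_def[symmetric] d_def[symmetric] by (subst nn_integral_add) auto
  also have "\<dots> \<le> (if t < 0 then 0 else ennreal (exp ((\<kappa> - rate) * t)))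
    + (if t < 0 then 0 else ennreal (exp ((\<kappa> + rate * \<mu>) * t) - exp ((\<kappa> - rate) * t)))"
    unfolding first by (intro add_left_mono second)
  also have "\<dots> = b t"
  proof (cases "t < 0")
    case False
    then have "(\<kappa> - rate) * t \<le> (\<kappa> + rate * \<mu>) * t" using rate \<mu> by (intro mult_right_mono) (auto intro: order_trans[of _ 0])
    then show ?thesis using False by (simp add: b_def ennreal_plus[symmetric] del: ennreal_plus)
  qed (simp add: b_def)
  finally show ?case by (simp add: b_def)
next
  case 0
  have "(\<integral>\<^sup>+\<tau>. weight \<theta> 0 t \<tau> \<partial>tree_law) = (\<integral>\<^sup>+\<tau>. 0 \<partial>tree_law)"
    by (intro nn_integral_cong) simp
  then show ?case by simp
qed

definition total_weight :: "real \<Rightarrow> real \<Rightarrow> (nat list \<Rightarrow> mark) \<Rightarrow> ennreal" where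
  "total_weight \<theta> t \<tau> = (SUP n. weight \<theta> n t \<tau>)"

lemma total_weight_measurable[measurable]: "total_weight \<theta> t \<in> borel_measurable tree_law"
  unfolding total_weight_def[abs_def] by measurable

lemma sum_alive_le_total_weight:
  assumes "finite F" "\<And>l. l \<in> F \<Longrightarrow> alive_at t \<tau> l"
  shows "(\<Sum>l\<in>F. ennreal (exp (\<theta> * position_at t \<tau> l))) \<le> total_weight \<theta> t \<tau>"
proof -
  have "length l < Suc (\<Sum>l\<in>F. length l)" if "l \<in> F" for l
    using member_le_sum[of l F length] that assms(1) by simp
  then have "(\<Sum>l\<in>F. ennreal (exp (\<theta> * position_at t \<tau> l))) \<le> weight \<theta> (Suc (\<Sum>l\<in>F. length l)) t \<tau>"
    using assms by (intro sum_alive_le_weight) auto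
  also have "\<dots> \<le> total_weight \<theta> t \<tau>"
    unfolding total_weight_def by (rule SUP_upper) simp
  finally show ?thesis .
qed

lemma nn_integral_total_weight_le:
  assumes "K \<theta> = ereal \<kappa>" "t \<ge> 0"
  shows "(\<integral>\<^sup>+\<tau>. total_weight \<theta> t \<tau> \<partial>tree_law) \<le> ennreal (exp ((\<kappa> + rate * \<mu>) * t))"
proof -
  have "(\<integral>\<^sup>+\<tau>. total_weight \<theta> t \<tau> \<partial>tree_law) = (SUP n. \<integral>\<^sup>+\<tau>. weight \<theta> n t \<tau> \<partial>tree_law)"
    unfolding total_weight_def
    by (rule nn_integral_monotone_convergence_SUP) (auto simp: incseq_Suc_iff le_fun_def simp del: weight.simps intro: weight_mono)
  also have "\<dots> \<le> ennreal (exp ((\<kappa> + rate * \<mu>) * t))"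
    using nn_integral_weight_le[OF assms(1), of _ t] assms(2) by (auto intro!: SUP_least)
  finally show ?thesis .
qed

lemma K_0: "K 0 = 0"
proof -
  have "exp_ereal (K 0) = 1"
    using mgf[of 1 0] by (simp add: PX.emeasure_space_1 flip: one_ereal_def)
  then show ?thesis
    using K_finite_below[of 0] by (cases "K 0") (auto simp: exp_ereal_def)
qed

lemma AE_finite_alive:
  assumes "t \<ge> 0"
  shows "AE \<tau> in tree_law. finite {l. alive_at t \<tau> l}"
proof -
  have "(\<integral>\<^sup>+\<tau>. total_weight 0 t \<tau> \<partial>tree_law) \<noteq> \<infinity>"
    using nn_integral_total_weight_le[of 0 0 t] assms K_0 by (auto simp: zero_ereal_def top_unique)
  then have "AE \<tau> in tree_law. total_weight 0 t \<tau> \<noteq> \<infinity>"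
    by (intro nn_integral_noteq_infinite) auto
  then show ?thesis
  proof eventually_elim
    case (elim \<tau>)
    then obtain r where r: "total_weight 0 t \<tau> = ennreal r" "r \<ge> 0" by (cases "total_weight 0 t \<tau>") auto
    have "card F \<le> nat \<lceil>r\<rceil>" if "finite F" "F \<subseteq> {l. alive_at t \<tau> l}" for F
    proof -
      have "ennreal (real (card F)) \<le> ennreal r"
        using sum_alive_le_total_weight[of F t \<tau> 0] that r by (auto simp: ennreal_of_nat_eq_real_of_nat)
      then show ?thesis using r(2) by (simp add: ennreal_le_iff) linarith
    qed
    then show ?case
      by (intro finite_if_finite_subsets_card_bdd[of _ "nat \<lceil>r\<rceil>", THEN conjunct1])
  qed
qed

text \<open>Markov's inequality for the exponential sum over all particles.\<close>
lemma alive_above_tail: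
  assumes "K \<theta> = ereal \<kappa>" "t \<ge> 0" "\<theta> > 0"
  obtains S where "S \<in> sets tree_law" "emeasure tree_law S \<le> ennreal (exp ((\<kappa> + rate * \<mu>) * t - \<theta> * a))"
    "\<And>\<tau> l. \<tau> \<in> space tree_law \<Longrightarrow> \<tau> \<notin> S \<Longrightarrow> alive_at t \<tau> l \<Longrightarrow> position_at t \<tau> l < a"
proof
  let ?S = "{\<tau> \<in> space tree_law. 1 \<le> ennreal (exp (- \<theta> * a)) * total_weight \<theta> t \<tau>}"
  show "?S \<in> sets tree_law" by measurable
  have "emeasure tree_law ?S
    \<le> ennreal (exp (- \<theta> * a)) * (\<integral>\<^sup>+\<tau>. total_weight \<theta> t \<tau> * indicator (space tree_law) \<tau> \<partial>tree_law)"
    by (rule nn_integral_Markov_inequality) measurable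
  also have "(\<integral>\<^sup>+\<tau>. total_weight \<theta> t \<tau> * indicator (space tree_law) \<tau> \<partial>tree_law) = (\<integral>\<^sup>+\<tau>. total_weight \<theta> t \<tau> \<partial>tree_law)"
    by (intro nn_integral_cong) simp
  also have "ennreal (exp (- \<theta> * a)) * (\<integral>\<^sup>+\<tau>. total_weight \<theta> t \<tau> \<partial>tree_law)
    \<le> ennreal (exp (- \<theta> * a)) * ennreal (exp ((\<kappa> + rate * \<mu>) * t))"
    by (intro mult_left_mono nn_integral_total_weight_le assms) simp
  also have "\<dots> = ennreal (exp ((\<kappa> + rate * \<mu>) * t - \<theta> * a))"
    by (simp add: ennreal_mult[symmetric] exp_add[symmetric] algebra_simps)
  finally show "emeasure tree_law ?S \<le> ennreal (exp ((\<kappa> + rate * \<mu>) * t - \<theta> * a))" .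
  fix \<tau> l assume \<tau>: "\<tau> \<in> space tree_law" "\<tau> \<notin> ?S" "alive_at t \<tau> l"
  show "position_at t \<tau> l < a"
  proof (rule ccontr)
    assume "\<not> position_at t \<tau> l < a"
    then have "\<theta> * a \<le> \<theta> * position_at t \<tau> l" using assms(3) by simp
    have "1 \<le> ennreal (exp (- \<theta> * a)) * ennreal (exp (\<theta> * position_at t \<tau> l))"
      using \<open>\<theta> * a \<le> _\<close> by (simp add: ennreal_mult[symmetric] exp_add[symmetric])
    also have "\<dots> \<le> ennreal (exp (- \<theta> * a)) * total_weight \<theta> t \<tau>"
      using sum_alive_le_total_weight[of "{l}" t \<tau> \<theta>] \<tau>(3) by (intro mult_left_mono) auto
    finally show False using \<tau> by auto
  qed
qed

end

section \<open>Truncated first moments of one generation\<close>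

text \<open>
  Truncation at level \<open>n\<close>. The lower bound on the lifetime makes lines of descent take a time proportional to their
  length; the lower bound on the path controls the positions between branching times.
\<close>
definition good :: "nat \<Rightarrow> mark \<Rightarrow> bool" where
  "good n m \<longleftrightarrow> 1 / (real n + 1) \<le> life m \<and> life m \<le> real n \<and> \<bar>eval_path (motion m) (life m)\<bar> \<le> real n \<and>
    (\<forall>q::rat. 0 \<le> q \<longrightarrow> real_of_rat q < life m \<longrightarrow> - real n \<le> motion m (real_of_rat q))"

definition gain :: "real \<Rightarrow> mark \<Rightarrow> real" where
  "gain a m = eval_path (motion m) (life m) - a * life m"

lemma good_mono: "good n m \<Longrightarrow> n \<le> n' \<Longrightarrow> good n' m"
proof -
  assume *: "good n m" "n \<le> n'"
  then have "1 / (real n' + 1) \<le> 1 / (real n + 1)" by (intro divide_left_mono) auto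
  with * show ?thesis unfolding good_def by force
qed

context branching_tree
begin

lemma good_measurable[measurable]: "Measurable.pred \<nu> (good n)"
proof -
  have [measurable]: "(\<lambda>m. motion m q) \<in> borel_measurable \<nu>" if "q \<ge> 0" for q
  proof -
    have "(\<lambda>p. p q) \<in> path_space \<rightarrow>\<^sub>M borel"
      unfolding path_space_def using that by (intro measurable_component_singleton) simp
    from measurable_compose[OF motion_measurable this] show ?thesis .
  qed
  have "Measurable.pred \<nu> (\<lambda>m. 0 \<le> q \<longrightarrow> real_of_rat q < life m \<longrightarrow> - real n \<le> motion m (real_of_rat q))" for q
    by (cases "0 \<le> q") simp_all
  note [measurable] = this
  show ?thesis unfolding good_def[abs_def] by measurable
qed

lemma gain_measurable[measurable]: "gain a \<in> borel_measurable \<nu>"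
  unfolding gain_def[abs_def] by measurable

lemma AE_life_pos: "AE m in \<nu>. life m > 0"
proof (rule AE_I')
  have "emeasure \<nu> {m \<in> space \<nu>. life m \<le> 0} = (\<integral>\<^sup>+m. indicator {m \<in> space \<nu>. life m \<le> 0} m \<partial>\<nu>)"
    by (rule nn_integral_indicator[symmetric]) measurable
  also have "\<dots> = (\<integral>\<^sup>+m. indicator {..0} (life m) \<partial>\<nu>)"
    by (intro nn_integral_cong) (simp split: split_indicator)
  also have "\<dots> = emeasure PT {..0}"
    by (subst nn_integral_nu) (auto simp: PX.emeasure_space_1 PN.emeasure_space_1)
  also have "\<dots> = 0"
    using nn_integral_exponential_density_atMost[OF rate, of 0] by (simp add: PT_eq emeasure_density)
  finally show "{m \<in> space \<nu>. life m \<le> 0} \<in> null_sets \<nu>" by (intro null_setsI) auto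
qed auto

text \<open>
  The bounds exhaust the marks as \<open>n\<close> grows, because lifetimes are positive and paths are bounded below
  during the life of a particle.
\<close>
lemma AE_good: "AE m in \<nu>. \<exists>n. good n m"
  using AE_life_pos bounded_below
proof eventually_elim
  case (elim m)
  then obtain D :: nat where D: "\<And>q. 0 \<le> q \<Longrightarrow> real_of_rat q < life m \<Longrightarrow> - real D \<le> motion m (real_of_rat q)" by blast
  obtain n1 :: nat where n1: "1 / life m < real n1" using reals_Archimedean2 by blast
  obtain n2 :: nat where n2: "\<bar>life m\<bar> + \<bar>eval_path (motion m) (life m)\<bar> < real n2" using reals_Archimedean2 by blast
  define n where "n = D + n1 + n2"
  have "1 / (real n + 1) \<le> life m"
  proof -
    have "1 < life m * real n1" using n1 elim by (simp add: divide_less_eq mult.commute)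
    also have "\<dots> \<le> life m * (real n + 1)" using elim by (intro mult_left_mono) (auto simp: n_def)
    finally show ?thesis by (simp add: divide_le_eq mult.commute)
  qed
  moreover have "- real n \<le> motion m (real_of_rat q)" if "0 \<le> q" "real_of_rat q < life m" for q
    using D[OF that] by (simp add: n_def)
  ultimately have "good n m" using n2 by (auto simp: good_def n_def)
  then show ?case ..
qed

lemma nn_integral_kids: "(\<integral>\<^sup>+m. of_nat (kids m) \<partial>\<nu>) = ennreal (1 + \<mu>)"
  using nn_integral_at_death[of "\<lambda>_. 1" 0] nn_integral_exponential_density[OF rate]
  by (simp add: K_0 exp_ereal_def)

lemma prob_branching: "\<P>(m in \<nu>. 2 \<le> kids m) > 0"
proof (rule ccontr)
  assume "\<not> \<P>(m in \<nu>. 2 \<le> kids m) > 0"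
  then have "\<P>(m in \<nu>. 2 \<le> kids m) = 0" by (simp add: zero_less_measure_iff)
  then have "AE m in \<nu>. \<not> 2 \<le> kids m" by (subst (asm) prob_eq_0) auto
  then have "(\<integral>\<^sup>+m. of_nat (kids m) \<partial>\<nu>) \<le> (\<integral>\<^sup>+m. 1 \<partial>\<nu>)"
  proof (intro nn_integral_mono_AE, eventually_elim)
    case (elim m)
    then have "kids m \<le> 1" by simp
    then show "of_nat (kids m) \<le> (1 :: ennreal)" by (metis of_nat_1 of_nat_mono)
  qed
  then have "ennreal (1 + \<mu>) \<le> ennreal 1"
    unfolding nn_integral_kids by (simp add: emeasure_space_1)
  then show False using \<mu> by (subst (asm) ennreal_le_iff) auto
qed

text \<open>
  The mean is \<open>1 + \<mu>\<close> times the integral of \<open>rate * exp (- (rate + a \<theta> - K \<theta>) s)\<close> over \<open>s \<ge> 0\<close>, and the hypothesis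
  says that the exponent \<open>rate + a \<theta> - K \<theta>\<close> is less than \<open>rate * (1 + \<mu>)\<close>.
\<close>
lemma nn_integral_gain_gt_1:
  assumes a: "\<And>\<theta>. \<theta> > 0 \<Longrightarrow> ereal (a * \<theta>) < K \<theta> + ereal (rate * \<mu>)" and \<theta>: "\<theta> \<ge> 0"
  shows "1 < (\<integral>\<^sup>+m. of_nat (kids m) * ennreal (exp (\<theta> * gain a m)) \<partial>\<nu>)"
proof -
  \<comment> \<open>A nonpositive real \<open>\<kappa>\<close> between \<open>- rate * \<mu>\<close> and \<open>K \<theta> - a \<theta>\<close> avoids infinite values of \<open>K\<close> and divergent
    integrals.\<close>
  have "\<exists>\<kappa>. - (rate * \<mu>) < \<kappa> \<and> \<kappa> \<le> 0 \<and> ereal (\<kappa> + a * \<theta>) \<le> K \<theta>"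
  proof (cases "\<theta> = 0")
    case True
    then show ?thesis using rate \<mu> by (intro exI[of _ 0]) (auto simp: K_0 zero_ereal_def)
  next
    case False
    with a[of \<theta>] \<theta> have *: "ereal (a * \<theta>) < K \<theta> + ereal (rate * \<mu>)" by simp
    show ?thesis
    proof (cases "K \<theta>")
      case (real k)
      then show ?thesis using * rate \<mu> by (intro exI[of _ "min 0 (k - a * \<theta>)"]) auto
    next
      case PInf
      then show ?thesis using rate \<mu> by (intro exI[of _ 0]) auto
    qed (use K_finite_below in auto)
  qed
  then obtain \<kappa> where \<kappa>: "- (rate * \<mu>) < \<kappa>" "\<kappa> \<le> 0" "ereal (\<kappa> + a * \<theta>) \<le> K \<theta>" by blast
  define l where "l = rate - \<kappa>"
  have l: "l > 0" "l < rate * (1 + \<mu>)" using \<kappa> rate by (auto simp: l_def algebra_simps)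
  have exp_K: "ennreal (exp (\<kappa> * s)) \<le> exp_ereal (ereal s * K \<theta>) * ennreal (exp (- (a * \<theta>) * s))" if "s \<ge> 0" for s
  proof (cases "K \<theta>")
    case (real k)
    then have "\<kappa> * s \<le> (k - a * \<theta>) * s" using \<kappa> that by (intro mult_right_mono) auto
    then show ?thesis
      using real by (simp add: exp_ereal_real ennreal_mult[symmetric] exp_add[symmetric] algebra_simps)
  next
    case PInf
    show ?thesis
    proof (cases "s = 0")
      case False
      then show ?thesis using PInf that by (simp add: exp_ereal_def ennreal_top_mult)
    qed (simp add: exp_ereal_def PInf)
  qed (use K_finite_below in auto)
  have "1 < (1 + \<mu>) * (rate / l)" using l by (simp add: less_divide_eq mult.commute)
  then have "1 < ennreal ((1 + \<mu>) * (rate / l))" by (subst ennreal_1[symmetric], subst ennreal_less_iff) auto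
  also have "\<dots> = ennreal (1 + \<mu>) * (ennreal (rate / l) * (\<integral>\<^sup>+s. ennreal (exponential_density l s) \<partial>lborel))"
    unfolding nn_integral_exponential_density[OF l(1)] mult_1_right
    by (rule ennreal_mult) (use l rate \<mu> in auto)
  finally have "1 < ennreal (1 + \<mu>) * (ennreal (rate / l) * (\<integral>\<^sup>+s. ennreal (exponential_density l s) \<partial>lborel))" .
  moreover have "ennreal (rate / l) * (\<integral>\<^sup>+s. ennreal (exponential_density l s) \<partial>lborel)
    \<le> (\<integral>\<^sup>+s. ennreal (exponential_density rate s) * (exp_ereal (ereal s * K \<theta>) * ennreal (exp (- (a * \<theta>) * s))) \<partial>lborel)"
    (is "_ \<le> ?R")
  proof -
    have "ennreal (rate / l) * (\<integral>\<^sup>+s. ennreal (exponential_density l s) \<partial>lborel)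
      = (\<integral>\<^sup>+s. ennreal (rate / l) * ennreal (exponential_density l s) \<partial>lborel)"
      by (rule nn_integral_cmult[symmetric]) measurable
    also have "\<dots> \<le> (\<integral>\<^sup>+s. ennreal (exponential_density rate s) * (exp_ereal (ereal s * K \<theta>) * ennreal (exp (- (a * \<theta>) * s))) \<partial>lborel)"
    proof (rule nn_integral_mono)
      fix s :: real
      show "ennreal (rate / l) * ennreal (exponential_density l s)
        \<le> ennreal (exponential_density rate s) * (exp_ereal (ereal s * K \<theta>) * ennreal (exp (- (a * \<theta>) * s)))"
      proof (cases "s < 0")
        case False
        have "exp (- s * l) = exp (- s * rate) * exp (\<kappa> * s)"
          by (simp add: l_def mult_exp_exp algebra_simps)
        then have "rate / l * (l * exp (- s * l)) = rate * exp (- s * rate) * exp (\<kappa> * s)"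
          using l by simp
        then have "ennreal (rate / l) * ennreal (exponential_density l s) = ennreal (exponential_density rate s) * ennreal (exp (\<kappa> * s))"
          using False l rate by (simp add: exponential_density_def ennreal_mult[symmetric])
        also have "\<dots> \<le> ennreal (exponential_density rate s) * (exp_ereal (ereal s * K \<theta>) * ennreal (exp (- (a * \<theta>) * s)))"
          using False by (intro mult_left_mono exp_K) auto
        finally show ?thesis .
      qed (simp add: exponential_density_def)
    qed
    finally show ?thesis .
  qed
  ultimately have "1 < ennreal (1 + \<mu>) * ?R"
    by (meson less_le_trans mult_left_mono zero_le)
  also have "ennreal (1 + \<mu>) * (\<integral>\<^sup>+s. ennreal (exponential_density rate s) * (exp_ereal (ereal s * K \<theta>) * ennreal (exp (- (a * \<theta>) * s))) \<partial>lborel)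
    = (\<integral>\<^sup>+m. of_nat (kids m) * (ennreal (exp (\<theta> * eval_path (motion m) (life m))) * ennreal (exp (- (a * \<theta>) * life m))) \<partial>\<nu>)"
    by (rule nn_integral_at_death[symmetric]) measurable
  also have "\<dots> = (\<integral>\<^sup>+m. of_nat (kids m) * ennreal (exp (\<theta> * gain a m)) \<partial>\<nu>)"
    by (intro nn_integral_cong) (simp add: gain_def ennreal_mult[symmetric] exp_add[symmetric] algebra_simps)
  finally show ?thesis .
qed

text \<open>
  If the gain at the speed \<open>a\<close> were never positive, then the gain at the larger speed \<open>a0\<close> would be
  negative for all particles with children, and its exponential moments would tend to \<open>0\<close> as \<open>\<theta>\<close> grows, contradicting the lower bound \<open>1\<close>.
\<close>
lemma gain_pos:
  assumes a0: "\<And>\<theta>. \<theta> > 0 \<Longrightarrow> ereal (a0 * \<theta>) < K \<theta> + ereal (rate * \<mu>)" and "a < a0"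
  shows "\<not> (AE m in \<nu>. kids m \<ge> 1 \<longrightarrow> gain a m \<le> 0)"
proof
  assume "AE m in \<nu>. kids m \<ge> 1 \<longrightarrow> gain a m \<le> 0"
  with AE_life_pos have neg: "AE m in \<nu>. kids m \<ge> 1 \<longrightarrow> gain a0 m < 0"
  proof eventually_elim
    case (elim m)
    have "a * life m < a0 * life m" using elim assms(2) by simp
    with elim show ?case unfolding gain_def by linarith
  qed
  have "(\<lambda>i. \<integral>\<^sup>+m. of_nat (kids m) * ennreal (exp (real i * gain a0 m)) \<partial>\<nu>) \<longlonglongrightarrow> (\<integral>\<^sup>+m. 0 \<partial>\<nu>)"
  proof (rule nn_integral_dominated_convergence[where w="\<lambda>m. of_nat (kids m)"])
    show "AE m in \<nu>. of_nat (kids m) * ennreal (exp (real i * gain a0 m)) \<le> of_nat (kids m)" for i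
      using neg
    proof eventually_elim
      case (elim m)
      show ?case
      proof (cases "kids m = 0")
        case False
        then have "real i * gain a0 m \<le> 0" using elim by (intro mult_nonneg_nonpos) auto
        then have "of_nat (kids m) * ennreal (exp (real i * gain a0 m)) \<le> of_nat (kids m) * 1"
          by (intro mult_left_mono) auto
        then show ?thesis by simp
      qed simp
    qed
    show "AE m in \<nu>. (\<lambda>i. of_nat (kids m) * ennreal (exp (real i * gain a0 m))) \<longlonglongrightarrow> 0"
      using neg
    proof eventually_elim
      case (elim m)
      show ?case
      proof (cases "kids m = 0")
        case False
        then have g: "gain a0 m < 0" using elim by simp
        have "(\<lambda>i. exp (gain a0 m) ^ i) \<longlonglongrightarrow> 0"
          using g by (intro LIMSEQ_power_zero) simp
        then have "(\<lambda>i. real (kids m) * exp (real i * gain a0 m)) \<longlonglongrightarrow> real (kids m) * 0"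
          by (intro tendsto_intros) (simp add: exp_of_nat_mult)
        then have "(\<lambda>i. ennreal (real (kids m) * exp (real i * gain a0 m))) \<longlonglongrightarrow> ennreal 0"
          by (intro tendsto_ennrealI) simp
        then show ?thesis by (simp add: ennreal_mult ennreal_of_nat_eq_real_of_nat)
      qed simp
    qed
    show "(\<integral>\<^sup>+m. of_nat (kids m) \<partial>\<nu>) < \<infinity>" by (simp add: nn_integral_kids)
  qed measurable
  moreover have "1 \<le> (\<integral>\<^sup>+m. of_nat (kids m) * ennreal (exp (real i * gain a0 m)) \<partial>\<nu>)" for i
    by (rule less_imp_le, rule nn_integral_gain_gt_1[OF a0]) auto
  ultimately have "1 \<le> (\<integral>\<^sup>+m. 0 \<partial>\<nu>)"
    by (intro tendsto_lowerbound[OF _ always_eventually]) auto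
  then show False by simp
qed

definition cut_weight :: "nat \<Rightarrow> mark \<Rightarrow> real" where
  "cut_weight n m = (if good n m then real (min (kids m) n) else 0)"

definition cut_gain :: "real \<Rightarrow> nat \<Rightarrow> mark \<Rightarrow> real" where
  "cut_gain a n m = (if good n m then gain a m else 0)"

lemma cut_measurable[measurable]:
  "cut_weight n \<in> borel_measurable \<nu>" "cut_gain a n \<in> borel_measurable \<nu>"
  unfolding cut_weight_def[abs_def] cut_gain_def[abs_def] by measurable

lemma cut_gain_bounded: "\<bar>cut_gain a n m\<bar> \<le> real n + \<bar>a\<bar> * real n"
proof (cases "good n m")
  case True
  then have "0 \<le> life m" "life m \<le> real n" "\<bar>eval_path (motion m) (life m)\<bar> \<le> real n"
    by (auto simp: good_def intro: order_trans[of 0 "1 / (real n + 1)"])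
  then have "\<bar>a * life m\<bar> \<le> \<bar>a\<bar> * real n" by (auto simp: abs_mult intro!: mult_left_mono)
  with \<open>\<bar>eval_path (motion m) (life m)\<bar> \<le> real n\<close> show ?thesis using True by (simp add: cut_gain_def gain_def)
qed (simp add: cut_gain_def)

definition cut_gen :: "real \<Rightarrow> nat \<Rightarrow> real \<Rightarrow> real" where
  "cut_gen a n \<theta> = (\<integral>m. cut_weight n m * exp (\<theta> * cut_gain a n m) \<partial>\<nu>)"

lemma cut_weight_bounds: "0 \<le> cut_weight n m" "cut_weight n m \<le> real n" "\<bar>cut_weight n m\<bar> \<le> real n"
  by (auto simp: cut_weight_def)

lemma integrable_cut: "integrable \<nu> (\<lambda>m. cut_weight n m * exp (\<theta> * cut_gain a n m))"
  by (rule integrable_exp_bounded) (auto intro: cut_weight_bounds cut_gain_bounded)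

lemma cut_mono:
  assumes "n \<le> n'"
  shows "cut_weight n m * exp (\<theta> * cut_gain a n m) \<le> cut_weight n' m * exp (\<theta> * cut_gain a n' m)"
proof (cases "good n m")
  case True
  with good_mono[OF True assms] assms show ?thesis by (simp add: cut_weight_def cut_gain_def)
qed (simp add: cut_weight_def)

lemma cut_gen_mono: "n \<le> n' \<Longrightarrow> cut_gen a n \<theta> \<le> cut_gen a n' \<theta>"
  unfolding cut_gen_def by (intro integral_mono integrable_cut cut_mono)

text \<open>
  Fatou's lemma, as the truncated integrands are eventually equal to the original one.
\<close>
lemma cut_gen_gt_1:
  assumes a: "\<And>\<theta>. \<theta> > 0 \<Longrightarrow> ereal (a * \<theta>) < K \<theta> + ereal (rate * \<mu>)" and \<theta>: "\<theta> \<ge> 0"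
  shows "\<exists>n. cut_gen a n \<theta> > 1"
proof -
  let ?f = "\<lambda>n m. ennreal (cut_weight n m * exp (\<theta> * cut_gain a n m))"
  have "AE m in \<nu>. of_nat (kids m) * ennreal (exp (\<theta> * gain a m)) = liminf (\<lambda>n. ?f n m)"
    using AE_good
  proof eventually_elim
    case (elim m)
    then obtain n0 where n0: "good n0 m" by blast
    have "?f n m = of_nat (kids m) * ennreal (exp (\<theta> * gain a m))" if "n \<ge> n0 + kids m" for n
      using good_mono[OF n0, of n] that
      by (simp add: cut_weight_def cut_gain_def ennreal_mult ennreal_of_nat_eq_real_of_nat)
    then have "\<forall>\<^sub>F n in sequentially. ?f n m = of_nat (kids m) * ennreal (exp (\<theta> * gain a m))"
      by (auto simp: eventually_sequentially)
    then have "(\<lambda>n. ?f n m) \<longlonglongrightarrow> of_nat (kids m) * ennreal (exp (\<theta> * gain a m))"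
      by (rule tendsto_eventually)
    then show ?case by (intro lim_imp_Liminf[symmetric]) auto
  qed
  then have "(\<integral>\<^sup>+m. of_nat (kids m) * ennreal (exp (\<theta> * gain a m)) \<partial>\<nu>) = (\<integral>\<^sup>+m. liminf (\<lambda>n. ?f n m) \<partial>\<nu>)"
    by (rule nn_integral_cong_AE)
  also have "\<dots> \<le> liminf (\<lambda>n. \<integral>\<^sup>+m. ?f n m \<partial>\<nu>)"
    by (rule nn_integral_liminf) measurable
  also have "(\<lambda>n. \<integral>\<^sup>+m. ?f n m \<partial>\<nu>) = (\<lambda>n. ennreal (cut_gen a n \<theta>))"
    unfolding cut_gen_def by (intro ext nn_integral_eq_integral integrable_cut) (auto simp: cut_weight_bounds)
  finally have "1 < liminf (\<lambda>n. ennreal (cut_gen a n \<theta>))"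
    using nn_integral_gain_gt_1[OF assms] by simp
  then have "\<forall>\<^sub>F n in sequentially. 1 < ennreal (cut_gen a n \<theta>)" by (rule less_LiminfD)
  then obtain n where "1 < ennreal (cut_gen a n \<theta>)" by (auto simp: eventually_sequentially)
  then have "1 < cut_gen a n \<theta>"
    by (subst (asm) ennreal_1[symmetric], subst (asm) ennreal_less_iff) auto
  then show ?thesis ..
qed

lemma cut_gen_exponential_growth:
  assumes a0: "\<And>\<theta>. \<theta> > 0 \<Longrightarrow> ereal (a0 * \<theta>) < K \<theta> + ereal (rate * \<mu>)" and "a < a0"
  shows "\<exists>n\<^sub>0 \<eta> c. \<eta> > 0 \<and> c > 0 \<and> (\<forall>n\<ge>n\<^sub>0. \<forall>\<theta>\<ge>0. c * exp (\<theta> * \<eta>) \<le> cut_gen a n \<theta>)"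
proof -
  define S where "S n = {m \<in> space \<nu>. good n m \<and> kids m \<ge> 1 \<and> gain a m > 1 / (real n + 1)}" for n
  have S[measurable]: "S n \<in> sets \<nu>" for n unfolding S_def by measurable
  have "\<exists>n. prob (S n) > 0"
  proof (rule ccontr)
    assume "\<not> (\<exists>n. prob (S n) > 0)"
    then have "prob (S n) = 0" for n by (simp add: zero_less_measure_iff)
    then have "AE m in \<nu>. m \<notin> S n" for n by (intro AE_not_in) (simp add: null_sets_def emeasure_eq_measure)
    then have "AE m in \<nu>. \<forall>n. m \<notin> S n" by (subst AE_all_countable) auto
    with AE_good AE_space have "AE m in \<nu>. kids m \<ge> 1 \<longrightarrow> gain a m \<le> 0"
    proof eventually_elim
      case (elim m)
      show ?case
      proof (rule ccontr)
        assume *: "\<not> (kids m \<ge> 1 \<longrightarrow> gain a m \<le> 0)"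
        obtain n0 where n0: "good n0 m" using elim by blast
        obtain n1 :: nat where n1: "1 / gain a m < real n1" using reals_Archimedean2 by blast
        have "1 < gain a m * real n1" using n1 * by (simp add: divide_less_eq mult.commute)
        also have "\<dots> \<le> gain a m * (real (n0 + n1) + 1)" using * by (intro mult_left_mono) auto
        finally have "1 / (real (n0 + n1) + 1) < gain a m" by (simp add: divide_less_eq mult.commute)
        then have "m \<in> S (n0 + n1)"
          using * elim good_mono[OF n0, of "n0 + n1"] by (auto simp: S_def)
        then show False using elim by blast
      qed
    qed
    then show False using gain_pos[OF assms] by simp
  qed
  then obtain n0 where n0: "prob (S n0) > 0" by blast
  define \<eta> where "\<eta> = 1 / (real n0 + 1)"
  have "prob (S n0) * exp (\<theta> * \<eta>) \<le> cut_gen a n \<theta>" if n: "n \<ge> Suc n0" and \<theta>: "\<theta> \<ge> 0" for n \<theta>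
  proof -
    have "prob (S n0) * exp (\<theta> * \<eta>) = (\<integral>m. indicator (S n0) m * exp (\<theta> * \<eta>) \<partial>\<nu>)"
      by (simp add: Int_absorb2 sets.sets_into_space)
    also have "\<dots> \<le> cut_gen a n \<theta>"
      unfolding cut_gen_def
    proof (rule integral_mono'[OF integrable_cut])
      fix m
      show "indicator (S n0) m * exp (\<theta> * \<eta>) \<le> cut_weight n m * exp (\<theta> * cut_gain a n m)"
      proof (cases "m \<in> S n0")
        case True
        then have "good n m" "kids m \<ge> 1" "\<eta> < gain a m" using good_mono[of n0 m n] n by (auto simp: S_def \<eta>_def)
        then have "1 * exp (\<theta> * \<eta>) \<le> real (min (kids m) n) * exp (\<theta> * gain a m)"
          using n \<theta> by (intro mult_mono) (auto intro!: mult_left_mono)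
        then show ?thesis using True \<open>good n m\<close> by (simp add: cut_weight_def cut_gain_def)
      qed (simp add: cut_weight_bounds)
    qed (auto simp: cut_weight_bounds)
    finally show ?thesis .
  qed
  then show ?thesis using n0 by (intro exI[of _ "Suc n0"] exI[of _ \<eta>] exI[of _ "prob (S n0)"]) (auto simp: \<eta>_def)
qed

text \<open>
  The truncation can be chosen uniformly in \<open>\<theta>\<close>: by compactness on bounded intervals, and by the
  exponential growth beyond them.
\<close>
lemma uniform_truncation:
  assumes a0: "\<And>\<theta>. \<theta> > 0 \<Longrightarrow> ereal (a0 * \<theta>) < K \<theta> + ereal (rate * \<mu>)" and "a < a0"
  obtains n \<eta> c where "\<And>\<theta>. \<theta> \<ge> 0 \<Longrightarrow> cut_gen a n \<theta> > 1" "\<eta> > 0" "c > 0"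
    "\<And>\<theta>. \<theta> \<ge> 0 \<Longrightarrow> c * exp (\<theta> * \<eta>) \<le> cut_gen a n \<theta>"
proof -
  have a: "ereal (a * \<theta>) < K \<theta> + ereal (rate * \<mu>)" if "\<theta> > 0" for \<theta>
  proof -
    have "ereal (a * \<theta>) < ereal (a0 * \<theta>)" using that assms(2) by simp
    also have "\<dots> < K \<theta> + ereal (rate * \<mu>)" using a0 that by simp
    finally show ?thesis .
  qed
  obtain n0 \<eta> c where c: "\<eta> > 0" "c > 0" "\<And>n \<theta>. n \<ge> n0 \<Longrightarrow> \<theta> \<ge> 0 \<Longrightarrow> c * exp (\<theta> * \<eta>) \<le> cut_gen a n \<theta>"
    using cut_gen_exponential_growth[OF assms] by blast
  \<comment> \<open>Beyond \<open>B\<close> the exponential growth alone exceeds \<open>1\<close>.\<close>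
  define B where "B = (\<bar>ln (1 / c)\<bar> + 1) / \<eta>"
  have far: "cut_gen a n \<theta> > 1" if "n \<ge> n0" "\<theta> \<ge> B" for n \<theta>
  proof -
    have "\<theta> \<ge> 0" using that(2) c by (auto simp: B_def intro: order_trans[of 0 B])
    have "\<bar>ln (1 / c)\<bar> + 1 \<le> \<theta> * \<eta>" using that(2) c by (simp add: B_def divide_le_eq)
    then have "ln (1 / c) < \<theta> * \<eta>" by linarith
    then have "1 / c < exp (\<theta> * \<eta>)" using c by (metis exp_less_mono exp_ln zero_less_divide_1_iff)
    then have "1 < c * exp (\<theta> * \<eta>)" using c by (simp add: divide_less_eq mult.commute)
    also have "\<dots> \<le> cut_gen a n \<theta>" using c(3)[OF that(1) \<open>\<theta> \<ge> 0\<close>] .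
    finally show ?thesis .
  qed
  have "open {\<theta>. cut_gen a n \<theta> > 1}" for n
  proof -
    have "continuous_on UNIV (cut_gen a n)"
      unfolding cut_gen_def
      by (intro continuous_at_imp_continuous_on ballI isCont_integral_exp[where F="real n" and A="real n + \<bar>a\<bar> * real n"])
        (auto intro: cut_weight_bounds cut_gain_bounded)
    then show ?thesis by (intro open_Collect_less continuous_intros)
  qed
  moreover have "{0..B} \<subseteq> (\<Union>n\<in>UNIV. {\<theta>. cut_gen a n \<theta> > 1})"
  proof
    fix \<theta> assume "\<theta> \<in> {0..B}"
    then have "\<exists>n. cut_gen a n \<theta> > 1" by (intro cut_gen_gt_1 a) auto
    then show "\<theta> \<in> (\<Union>n\<in>UNIV. {\<theta>. cut_gen a n \<theta> > 1})" by simp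
  qed
  ultimately obtain N where N: "finite N" "{0..B} \<subseteq> (\<Union>n\<in>N. {\<theta>. cut_gen a n \<theta> > 1})"
    using compactE_image[of "{0..B}" UNIV "\<lambda>n. {\<theta>. cut_gen a n \<theta> > 1}"] compact_Icc by metis
  define n where "n = n0 + (\<Sum>n\<in>N. n)"
  have near: "cut_gen a n \<theta> > 1" if "\<theta> \<in> {0..B}" for \<theta>
  proof -
    have "\<exists>k\<in>N. cut_gen a k \<theta> > 1" using subsetD[OF N(2) that] by simp
    then obtain k where "k \<in> N" "cut_gen a k \<theta> > 1" by blast
    moreover have "k \<le> n" using member_le_sum[OF \<open>k \<in> N\<close>, of "\<lambda>n. n"] N(1) by (simp add: n_def)
    ultimately show ?thesis using cut_gen_mono[of k n a \<theta>] by simp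
  qed
  show thesis
  proof (rule that[of n \<eta> c])
    show "cut_gen a n \<theta> > 1" if "\<theta> \<ge> 0" for \<theta>
      using near[of \<theta>] far[of n \<theta>] that by (cases "\<theta> \<le> B") (auto simp: n_def)
  qed (use c in \<open>auto simp: n_def\<close>)
qed

end

section \<open>Fast lines of descent\<close>

lemma eval_path_ge_on_life:
  assumes "regular (motion m)" "good n m" "0 \<le> t" "t < life m"
  shows "- real n \<le> eval_path (motion m) t"
proof (rule tendsto_lowerbound)
  show "(\<lambda>k. motion m (dyadic_above k t)) \<longlonglongrightarrow> eval_path (motion m) t"
    using assms by (auto simp: regular_def)
  have "\<forall>\<^sub>F k in sequentially. dyadic_above k t < life m"
    using dyadic_above_lim[OF assms(3)] assms(4) by (rule order_tendstoD)
  then show "\<forall>\<^sub>F k in sequentially. - real n \<le> motion m (dyadic_above k t)"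
  proof eventually_elim
    case (elim k)
    obtain q where q: "dyadic_above k t = real_of_rat q"
      using dyadic_above_Rats[of k t] by (auto elim: Rats_cases)
    then have "0 \<le> q" using dyadic_above_nonneg[of k t] by simp
    then show ?case using assms(2) elim unfolding q good_def by blast
  qed
qed simp

locale good_lines = branching_tree PX PT PN \<nu> rate \<mu> K
  for PX :: "(real \<Rightarrow> real) measure" and PT :: "real measure" and PN :: "nat measure"
    and \<nu> :: "mark measure" and rate \<mu> :: real and K :: "real \<Rightarrow> ereal" +
  fixes a :: real and n :: nat
begin

sublocale selected_lines \<nu> "\<lambda>m. kids m" "good n" "cut_gain a n" n "real n + \<bar>a\<bar> * real n"
  by unfold_locales (auto intro: cut_gain_bounded)

lemma gen_eq: "gen \<theta> = cut_gen a n \<theta>"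
  unfolding gen_def cut_gen_def cut_weight_def ..

lemma line_bounds:
  "line y \<tau> l \<Longrightarrow> born_in \<tau> l \<and> real (length l) / (real n + 1) \<le> time_of \<tau> l \<and>
    time_of \<tau> l \<le> real n * real (length l) \<and> a * time_of \<tau> l \<le> y + place_of \<tau> l"
proof (induction l arbitrary: y \<tau>)
  case (Cons k l)
  then have g: "good n (\<tau> [])" "k < kids (\<tau> [])" and "line (y + cut_gain a n (\<tau> [])) (subtree k \<tau>) l"
    by simp_all
  then have l: "line (y + gain a (\<tau> [])) (subtree k \<tau>) l"
    unfolding cut_gain_def by simp
  have "1 / (real n + 1) \<le> life (\<tau> [])" "life (\<tau> []) \<le> real n" using g by (auto simp: good_def)
  with Cons.IH[OF l] g(2) show ?case
    by (auto simp: gain_def add_divide_distrib algebra_simps)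
qed simp

text \<open>
  The particles of the line live one after the other, without gaps, and none of them falls by more than \<open>n\<close>
  below its birthplace.
\<close>
lemma line_alive:
  "line y \<tau> l \<Longrightarrow> 0 \<le> t \<Longrightarrow> t < time_of \<tau> l \<Longrightarrow>
    \<exists>l'. alive_at t \<tau> l' \<and> (regular_tree \<tau> \<longrightarrow> - real n * real (length l) \<le> position_at t \<tau> l')"
proof (induction l arbitrary: y \<tau> t)
  case (Cons k l)
  then have g: "good n (\<tau> [])" "k < kids (\<tau> [])" and l: "line (y + cut_gain a n (\<tau> [])) (subtree k \<tau>) l"
    by auto
  show ?case
  proof (cases "t < life (\<tau> [])")
    case True
    have "- real n * real (length (k # l)) \<le> eval_path (motion (\<tau> [])) t" if "regular_tree \<tau>"
    proof -
      have "- real n \<le> eval_path (motion (\<tau> [])) t"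
        using that g Cons.prems True by (intro eval_path_ge_on_life) (auto simp: regular_tree_def)
      moreover have "- real n * real (length (k # l)) \<le> - real n" by (simp add: algebra_simps)
      ultimately show ?thesis by (rule order_trans[rotated])
    qed
    then show ?thesis using Cons.prems True by (intro exI[of _ "[]"]) auto
  next
    case False
    then obtain l' where l': "alive_at (t - life (\<tau> [])) (subtree k \<tau>) l'"
      "regular_tree (subtree k \<tau>) \<Longrightarrow> - real n * real (length l) \<le> position_at (t - life (\<tau> [])) (subtree k \<tau>) l'"
      using Cons.IH[OF l, of "t - life (\<tau> [])"] Cons.prems by auto
    have "- real n \<le> eval_path (motion (\<tau> [])) (life (\<tau> []))" using g by (auto simp: good_def abs_le_iff)
    then show ?thesis
      using l' g by (intro exI[of _ "k # l'"]) (auto simp: algebra_simps dest!: regular_subtree[of \<tau> k])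
  qed
qed simp

text \<open>
  A chain of good lines contains at every time a living particle, and the particles of the chain move at
  speed \<open>b\<close> at least, up to the fluctuation within one line.
\<close>
lemma lineage_alive:
  assumes "b \<le> a" and y: "y = real g * ((a - b) / (real n + 1))"
  shows "lineage g y k \<tau> \<Longrightarrow> 0 \<le> t \<Longrightarrow> t < real k * (real g / (real n + 1)) \<Longrightarrow>
    \<exists>l. alive_at t \<tau> l \<and> (regular_tree \<tau> \<longrightarrow> b * t - (1 + \<bar>b\<bar>) * real n * real g \<le> position_at t \<tau> l)"
proof (induction k arbitrary: \<tau> t)
  case (Suc k)
  then obtain l where l: "length l = g" "line y \<tau> l" "lineage g y k (subtree_at l \<tau>)"
    by (auto simp: lines_def)
  note bounds = line_bounds[OF l(2), unfolded l(1)]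
  show ?case
  proof (cases "t < time_of \<tau> l")
    case True
    then obtain l' where l': "alive_at t \<tau> l'" "regular_tree \<tau> \<Longrightarrow> - real n * real g \<le> position_at t \<tau> l'"
      using line_alive[OF l(2) Suc.prems(2)] l(1) by auto
    have "b * t \<le> \<bar>b\<bar> * t" using Suc.prems(2) by (intro mult_right_mono) auto
    also have "\<dots> \<le> \<bar>b\<bar> * (real n * real g)" using True bounds by (intro mult_left_mono) auto
    finally have "b * t - (1 + \<bar>b\<bar>) * real n * real g \<le> - real n * real g" by (simp add: algebra_simps)
    then show ?thesis using l' by (intro exI[of _ l']) auto
  next
    case False
    have "t - time_of \<tau> l < real k * (real g / (real n + 1))"
      using Suc.prems(3) bounds by (simp add: algebra_simps add_divide_distrib)
    then obtain l' where l': "alive_at (t - time_of \<tau> l) (subtree_at l \<tau>) l'"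
      "regular_tree \<tau> \<Longrightarrow> b * (t - time_of \<tau> l) - (1 + \<bar>b\<bar>) * real n * real g \<le> position_at (t - time_of \<tau> l) (subtree_at l \<tau>) l'"
      using Suc.IH[OF l(3), of "t - time_of \<tau> l"] False by (auto dest: regular_subtree_at)
    \<comment> \<open>The initial credit \<open>y\<close> is covered by the difference of the speeds, since the line takes at least the time
      \<open>g / (n + 1)\<close>.\<close>
    have "y = (a - b) * (real g / (real n + 1))" by (simp add: y)
    also have "\<dots> \<le> (a - b) * time_of \<tau> l" using bounds assms(1) by (intro mult_left_mono) auto
    finally have "b * time_of \<tau> l \<le> place_of \<tau> l" using bounds by (simp add: algebra_simps)
    then show ?thesis
      using l' bounds by (intro exI[of _ "l @ l'"]) (auto simp: alive_at_append position_at_append algebra_simps)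
  qed
qed simp

end

context branching_tree
begin

lemma measurable_line_data[measurable]:
  "Measurable.pred tree_law (\<lambda>\<tau>. born_in \<tau> l)"
  "(\<lambda>\<tau>. time_of \<tau> l) \<in> borel_measurable tree_law"
  "(\<lambda>\<tau>. place_of \<tau> l) \<in> borel_measurable tree_law"
proof -
  have "Measurable.pred tree_law (\<lambda>\<tau>. born_in \<tau> l) \<and> (\<lambda>\<tau>. time_of \<tau> l) \<in> borel_measurable tree_law
    \<and> (\<lambda>\<tau>. place_of \<tau> l) \<in> borel_measurable tree_law"
  proof (induction l)
    case (Cons k l)
    then have [measurable]: "Measurable.pred tree_law (\<lambda>\<tau>. born_in \<tau> l)"
      "(\<lambda>\<tau>. time_of \<tau> l) \<in> borel_measurable tree_law" "(\<lambda>\<tau>. place_of \<tau> l) \<in> borel_measurable tree_law" by auto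
    show ?case by simp
  qed simp
  then show "Measurable.pred tree_law (\<lambda>\<tau>. born_in \<tau> l)"
    "(\<lambda>\<tau>. time_of \<tau> l) \<in> borel_measurable tree_law" "(\<lambda>\<tau>. place_of \<tau> l) \<in> borel_measurable tree_law" by auto
qed

text \<open>
  Having somewhere in the tree a particle that starts an infinite good chain is a property whose failure
  is inherited by all subtrees. By the zero-one law it fails only on extinction.
\<close>
lemma fast_particles_on_survival:
  assumes a0: "\<And>\<theta>. \<theta> > 0 \<Longrightarrow> ereal (a0 * \<theta>) < K \<theta> + ereal (rate * \<mu>)" and "b < a0"
  obtains E :: "nat \<Rightarrow> (nat list \<Rightarrow> mark) \<Rightarrow> bool" and C :: real where
    "\<And>j. Measurable.pred tree_law (E j)"
    "\<And>j \<tau>. E j \<tau> \<Longrightarrow> E (Suc j) \<tau>"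
    "\<P>(\<tau> in tree_law. \<not> extinct kids \<tau> \<and> (\<forall>j. \<not> E j \<tau>)) = 0"
    "\<And>j \<tau> t. E j \<tau> \<Longrightarrow> regular_tree \<tau> \<Longrightarrow> t \<ge> real j \<Longrightarrow>
      \<exists>l. alive_at t \<tau> l \<and> b * t - (1 + \<bar>b\<bar>) * real j - C \<le> position_at t \<tau> l"
proof -
  \<comment> \<open>Two margins are needed: from \<open>a0\<close> to \<open>a\<close> for the truncation and from \<open>a\<close> to \<open>b\<close> for the fluctuations within
    a line.\<close>
  define a where "a = (a0 + b) / 2"
  have a: "a < a0" "b < a" using assms(2) by (auto simp: a_def)
  obtain n \<eta> c where n: "\<And>\<theta>. \<theta> \<ge> 0 \<Longrightarrow> cut_gen a n \<theta> > 1" "\<eta> > 0" "c > 0"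
    "\<And>\<theta>. \<theta> \<ge> 0 \<Longrightarrow> c * exp (\<theta> * \<eta>) \<le> cut_gen a n \<theta>"
    using uniform_truncation[OF a0 a(1)] by metis
  interpret good_lines PX PT PN \<nu> rate \<mu> K a n ..
  have "(a - b) / (real n + 1) > 0" using a by simp
  then obtain g where g: "g \<ge> 1" "mean_count g (real g * ((a - b) / (real n + 1))) > 1"
    using mean_count_supercritical[of \<eta> c "(a - b) / (real n + 1)"] n by (auto simp: gen_eq)
  define y where "y = real g * ((a - b) / (real n + 1))"
  define R where "R \<tau> \<longleftrightarrow> (\<forall>k. lineage g y k \<tau>)" for \<tau>
  have [measurable]: "Measurable.pred tree_law R" unfolding R_def[abs_def] by measurable
  have R_pos: "\<P>(\<tau> in tree_law. R \<tau>) > 0"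
    unfolding R_def by (rule lineage_positive) (use g in \<open>simp add: y_def\<close>)
  define C where "C = (1 + \<bar>b\<bar>) * real n * real g"
  have R_alive: "\<exists>l. alive_at t \<tau> l \<and> (regular_tree \<tau> \<longrightarrow> b * t - C \<le> position_at t \<tau> l)"
    if "R \<tau>" "0 \<le> t" for \<tau> t
  proof -
    obtain k :: nat where "t / (real g / (real n + 1)) < real k" using reals_Archimedean2 by blast
    then have "t < real k * (real g / (real n + 1))" using g by (simp add: divide_less_eq field_simps)
    then show ?thesis
      unfolding C_def using that a by (intro lineage_alive[where y=y and k=k]) (auto simp: R_def y_def)
  qed
  \<comment> \<open>The bounds by \<open>j\<close> make the time from which the particles are fast uniform on each \<open>E j\<close>.\<close>
  define E where "E j \<tau> \<longleftrightarrow> (\<exists>l. born_in \<tau> l \<and> \<bar>time_of \<tau> l\<bar> \<le> real j \<and> \<bar>place_of \<tau> l\<bar> \<le> real j \<and> R (subtree_at l \<tau>))" for j \<tau>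
  define H where "H \<tau> \<longleftrightarrow> (\<exists>l. born_in \<tau> l \<and> R (subtree_at l \<tau>))" for \<tau>
  have [measurable]: "Measurable.pred tree_law H" unfolding H_def[abs_def] by measurable
  have E_measurable: "Measurable.pred tree_law (E j)" for j unfolding E_def[abs_def] by measurable
  have H_E: "H \<tau> \<longleftrightarrow> (\<exists>j. E j \<tau>)" for \<tau>
  proof
    assume "H \<tau>"
    then obtain l where l: "born_in \<tau> l" "R (subtree_at l \<tau>)" by (auto simp: H_def)
    obtain j :: nat where "\<bar>time_of \<tau> l\<bar> + \<bar>place_of \<tau> l\<bar> < real j" using reals_Archimedean2 by blast
    then have "E j \<tau>" using l unfolding E_def by (intro exI[of _ l]) auto
    then show "\<exists>j. E j \<tau>" ..
  qed (auto simp: E_def H_def)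
  have E_alive: "\<exists>l. alive_at t \<tau> l \<and> (regular_tree \<tau> \<longrightarrow> b * t - (1 + \<bar>b\<bar>) * real j - C \<le> position_at t \<tau> l)"
    if E: "E j \<tau>" and t: "t \<ge> real j" for j \<tau> t
  proof -
    obtain l where l: "born_in \<tau> l" "\<bar>time_of \<tau> l\<bar> \<le> real j" "\<bar>place_of \<tau> l\<bar> \<le> real j" "R (subtree_at l \<tau>)"
      using E unfolding E_def by blast
    have "0 \<le> t - time_of \<tau> l" using l(2) t by (simp add: abs_le_iff)
    from R_alive[OF l(4) this] obtain l' where l': "alive_at (t - time_of \<tau> l) (subtree_at l \<tau>) l'"
      "regular_tree (subtree_at l \<tau>) \<longrightarrow> b * (t - time_of \<tau> l) - C \<le> position_at (t - time_of \<tau> l) (subtree_at l \<tau>) l'"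
      by blast
    have "b * time_of \<tau> l \<le> \<bar>b\<bar> * real j"
      using l(2) by (metis abs_ge_self abs_ge_zero abs_mult mult_left_mono order_trans)
    then have "b * t - (1 + \<bar>b\<bar>) * real j - C \<le> place_of \<tau> l + (b * (t - time_of \<tau> l) - C)"
      using l(3) by (simp add: algebra_simps abs_le_iff)
    then show ?thesis
      using l l' by (intro exI[of _ "l @ l'"]) (auto simp: alive_at_append position_at_append dest: regular_subtree_at)
  qed
  have "\<P>(\<tau> in tree_law. \<not> H \<tau> \<and> \<not> extinct kids \<tau>) = 0"
  proof (rule inherited_zero_one_law)
    fix \<tau> and k assume *: "\<not> H \<tau>" "k < kids (\<tau> [])"
    show "\<not> H (subtree k \<tau>)"
    proof
      assume "H (subtree k \<tau>)"
      then obtain l where "born_in (subtree k \<tau>) l" "R (subtree_at l (subtree k \<tau>))" by (auto simp: H_def)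
      then have "born_in \<tau> (k # l) \<and> R (subtree_at (k # l) \<tau>)" using * by (simp add: subtree_at_Cons)
      then show False using * unfolding H_def by blast
    qed
  next
    fix \<tau> assume "extinct kids \<tau>"
    then obtain t0 where t0: "\<And>t l. t \<ge> t0 \<Longrightarrow> \<not> alive_at t \<tau> l"
      unfolding extinct_def using extinct_by_imp_not_alive by blast
    show "\<not> H \<tau>"
    proof
      assume "H \<tau>"
      then obtain j where "E j \<tau>" by (auto simp: H_E)
      from E_alive[OF this, of "max t0 (real j)"] t0[of "max t0 (real j)"] show False by auto
    qed
  next
    have "\<P>(\<tau> in tree_law. R \<tau>) \<le> \<P>(\<tau> in tree_law. H \<tau>)"
      by (rule tree.finite_measure_mono) (auto simp: H_def intro!: exI[of _ "[]"])
    then show "\<P>(\<tau> in tree_law. \<not> H \<tau>) < 1"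
      using R_pos by (subst tree.prob_neg) auto
  qed (use prob_branching in measurable)
  moreover have "(\<not> H \<tau> \<and> \<not> extinct kids \<tau>) \<longleftrightarrow> (\<not> extinct kids \<tau> \<and> (\<forall>j. \<not> E j \<tau>))" for \<tau>
    by (auto simp: H_E)
  ultimately have "\<P>(\<tau> in tree_law. \<not> extinct kids \<tau> \<and> (\<forall>j. \<not> E j \<tau>)) = 0" by simp
  moreover have "E (Suc j) \<tau>" if "E j \<tau>" for j \<tau>
    using that unfolding E_def by force
  moreover have "\<exists>l. alive_at t \<tau> l \<and> b * t - (1 + \<bar>b\<bar>) * real j - C \<le> position_at t \<tau> l"
    if "E j \<tau>" "regular_tree \<tau>" "t \<ge> real j" for j \<tau> t
    using E_alive[OF that(1,3)] that(2) by blast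
  ultimately show thesis
    using E_measurable by (intro that[of E C])
qed

end

section \<open>From the branching process to its marked tree\<close>

text \<open>
  The infimum is bounded above because \<open>K\<close> is finite at some \<open>\<theta> > 0\<close>. The assumed lower bound for \<open>K\<close> is
  supplied by \<open>cgf_lower_bound\<close>.
\<close>
lemma speed_finite:
  fixes K :: "real \<Rightarrow> ereal" and r L :: real
  assumes finite: "\<forall>\<^sub>F \<theta> in nhds 0. \<bar>K \<theta>\<bar> \<noteq> \<infinity>"
    and lower: "\<And>\<theta>. \<theta> > 0 \<Longrightarrow> ereal (- L * \<theta> - rate * \<mu>) \<le> K \<theta>"
  shows "ereal (speed K rate \<mu>) = (INF \<theta>\<in>{0<..}. (K \<theta> + ereal (rate * \<mu>)) / ereal \<theta>)"
proof -
  let ?I = "INF \<theta>\<in>{0<..}. (K \<theta> + ereal (rate * \<mu>)) / ereal \<theta>"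
  obtain d where d: "d > 0" "\<And>\<theta>. dist \<theta> 0 < d \<Longrightarrow> \<bar>K \<theta>\<bar> \<noteq> \<infinity>"
    using finite by (auto simp: eventually_nhds_metric)
  then have "\<bar>K (d / 2)\<bar> \<noteq> \<infinity>" by (intro d(2)) auto
  then obtain k where k: "K (d / 2) = ereal k" by auto
  have "?I \<le> (K (d / 2) + ereal (rate * \<mu>)) / ereal (d / 2)"
    by (rule INF_lower) (use d in simp)
  also have "\<dots> < \<infinity>" using d by (simp add: k)
  finally have "?I \<noteq> \<infinity>" by simp
  have "ereal (- L) \<le> (K \<theta> + ereal (rate * \<mu>)) / ereal \<theta>" if "\<theta> > 0" for \<theta>
    using lower[OF that] that by (cases "K \<theta>") (auto simp: field_simps)
  then have "ereal (- L) \<le> ?I" by (intro INF_greatest) auto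
  then have "?I \<noteq> -\<infinity>" by auto
  with \<open>?I \<noteq> \<infinity>\<close> show ?thesis
    unfolding speed_def by (intro ereal_real') auto
qed

lemma below_speed:
  assumes speed: "ereal (speed K rate \<mu>) = (INF \<theta>\<in>{0<..}. (K \<theta> + ereal (rate * \<mu>)) / ereal \<theta>)"
    and "a < speed K rate \<mu>" "\<theta> > 0"
  shows "ereal (a * \<theta>) < K \<theta> + ereal (rate * \<mu>)"
proof -
  have "ereal a < ereal (speed K rate \<mu>)" using assms(2) by simp
  also have "\<dots> \<le> (K \<theta> + ereal (rate * \<mu>)) / ereal \<theta>"
    unfolding speed by (rule INF_lower) (use assms in simp)
  finally have "ereal a < (K \<theta> + ereal (rate * \<mu>)) / ereal \<theta>" .
  then show ?thesis using assms(3) by (cases "K \<theta>") (auto simp: less_divide_eq)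
qed

lemma above_speed:
  assumes speed: "ereal (speed K rate \<mu>) = (INF \<theta>\<in>{0<..}. (K \<theta> + ereal (rate * \<mu>)) / ereal \<theta>)"
    and K: "\<And>\<theta>. K \<theta> \<noteq> -\<infinity>" and "speed K rate \<mu> < a"
  obtains \<theta> \<kappa> where "\<theta> > 0" "K \<theta> = ereal \<kappa>" "\<kappa> + rate * \<mu> < a * \<theta>"
proof -
  have "(INF \<theta>\<in>{0<..}. (K \<theta> + ereal (rate * \<mu>)) / ereal \<theta>) < ereal a"
    unfolding speed[symmetric] using assms(3) by simp
  then obtain \<theta> where \<theta>: "\<theta> > 0" "(K \<theta> + ereal (rate * \<mu>)) / ereal \<theta> < ereal a"
    by (auto simp: INF_less_iff)
  show thesis
  proof (cases "K \<theta>")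
    case (real k)
    then show ?thesis using \<theta> by (intro that[of \<theta> k]) (auto simp: divide_less_eq)
  qed (use \<theta> K in auto)
qed

text \<open>
  The exponential moment at time \<open>1\<close> is at least \<open>exp (- \<theta> L)\<close> times the probability of being above \<open>- L\<close>, and
  that probability exceeds \<open>exp (- c)\<close> for large \<open>L\<close>.
\<close>
lemma (in levy_process) cgf_lower_bound:
  assumes "c > 0"
  obtains L where "\<And>\<theta>. \<theta> > 0 \<Longrightarrow> ereal (- L * \<theta> - c) \<le> cgf M X \<theta>"
proof -
  have [measurable]: "X 1 \<in> borel_measurable M" by (rule measurable) simp
  have "(\<lambda>n. prob {\<omega> \<in> space M. - real n \<le> X 1 \<omega>}) \<longlonglongrightarrow> prob (\<Union>n. {\<omega> \<in> space M. - real n \<le> X 1 \<omega>})"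
    by (rule finite_Lim_measure_incseq) (auto simp: incseq_def)
  also have "(\<Union>n. {\<omega> \<in> space M. - real n \<le> X 1 \<omega>}) = space M"
  proof -
    have "\<exists>n. - real n \<le> X 1 \<omega>" for \<omega>
    proof -
      obtain n where "- X 1 \<omega> < real n" using reals_Archimedean2 by blast
      then show ?thesis by (intro exI[of _ n]) linarith
    qed
    then show ?thesis by auto
  qed
  finally have "(\<lambda>n. prob {\<omega> \<in> space M. - real n \<le> X 1 \<omega>}) \<longlonglongrightarrow> 1" by (simp add: prob_space)
  then have "\<forall>\<^sub>F n in sequentially. exp (- c) < prob {\<omega> \<in> space M. - real n \<le> X 1 \<omega>}"
    by (rule order_tendstoD) (use assms in simp)
  then obtain n where n: "exp (- c) < prob {\<omega> \<in> space M. - real n \<le> X 1 \<omega>}"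
    by (auto simp: eventually_sequentially)
  let ?S = "{\<omega> \<in> space M. - real n \<le> X 1 \<omega>}"
  have "ereal (- real n * \<theta> - c) \<le> cgf M X \<theta>" if "\<theta> > 0" for \<theta>
  proof -
    have "ennreal (exp (- real n * \<theta> - c)) \<le> ennreal (exp (- real n * \<theta>)) * ennreal (prob ?S)"
      using n by (simp add: ennreal_mult[symmetric] exp_diff exp_minus field_simps)
    also have "\<dots> = (\<integral>\<^sup>+\<omega>. ennreal (exp (- real n * \<theta>)) * indicator ?S \<omega> \<partial>M)"
      by (subst nn_integral_cmult_indicator) (auto simp: emeasure_eq_measure)
    also have "\<dots> \<le> (\<integral>\<^sup>+\<omega>. ennreal (exp (\<theta> * X 1 \<omega>)) \<partial>M)"
    proof (rule nn_integral_mono)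
      fix \<omega>
      have "- real n * \<theta> \<le> \<theta> * X 1 \<omega>" if "- real n \<le> X 1 \<omega>"
        using mult_left_mono[OF that, of \<theta>] \<open>\<theta> > 0\<close> by (simp add: mult.commute)
      then show "ennreal (exp (- real n * \<theta>)) * indicator ?S \<omega> \<le> ennreal (exp (\<theta> * X 1 \<omega>))"
        by (auto split: split_indicator)
    qed
    also have "\<dots> = exp_ereal (cgf M X \<theta>)"
      using mgf_eq_cgf(1)[of 1 \<theta>] by (simp add: mgf_def flip: one_ereal_def)
    finally show ?thesis
      using mgf_eq_cgf(2)[of 1 \<theta>] by (cases "cgf M X \<theta>") (auto simp: exp_ereal_def)
  qed
  then show thesis by (rule that)
qed

text \<open>
  The marks of the descendants of \<open>u\<close>, with labels counted from \<open>u\<close> and read forwards.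
\<close>
definition marked_tree ::
  "(label \<Rightarrow> real \<Rightarrow> 'a \<Rightarrow> real) \<Rightarrow> (label \<Rightarrow> 'a \<Rightarrow> real) \<Rightarrow> (label \<Rightarrow> 'a \<Rightarrow> nat) \<Rightarrow> 'a \<Rightarrow> label \<Rightarrow> nat list \<Rightarrow> mark"
  where "marked_tree X T N \<omega> u l = mark (X (rev l @ u)) (T (rev l @ u)) (N (rev l @ u)) \<omega>"

lemma subtree_marked_tree: "subtree k (marked_tree X T N \<omega> u) = marked_tree X T N \<omega> (k # u)"
  by (simp add: subtree_def marked_tree_def fun_eq_iff)

lemma mark_simps [simp]:
  "motion (mark X T N \<omega>) = sample_path X \<omega>" "life (mark X T N \<omega>) = T \<omega>" "kids (mark X T N \<omega>) = N \<omega>"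
  by (simp_all add: mark_def)

lemma marked_tree_Nil: "marked_tree X T N \<omega> u [] = mark (X u) (T u) (N u) \<omega>"
  by (simp add: marked_tree_def)

lemma alive_iff_alive_at:
  "rev l @ u \<in> alive T N t \<omega> \<longleftrightarrow> born N \<omega> u \<and> alive_at (t - birth_time T \<omega> u) (marked_tree X T N \<omega> u) l"
proof (induction l arbitrary: u)
  case Nil
  show ?case by (auto simp: alive_def marked_tree_Nil)
next
  case (Cons k l)
  show ?case using Cons.IH[of "k # u"]
    by (auto simp: marked_tree_Nil subtree_marked_tree diff_diff_eq)
qed

context branching_levy_process
begin

lemma eval_sample_path: "\<omega> \<in> space M \<Longrightarrow> s \<ge> 0 \<Longrightarrow> eval_path (sample_path (X u) \<omega>) s = X u s \<omega>"
  unfolding sample_path_def using levy_process.paths[OF levy[of u]] by (rule eval_path_cadlag)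

lemma regular_marked_tree: "\<omega> \<in> space M \<Longrightarrow> regular_tree (marked_tree X T N \<omega> u)"
  unfolding regular_tree_def marked_tree_def mark_simps sample_path_def
  by (intro allI regular_cadlag levy_process.paths[OF levy])

lemma position_eq_position_at:
  assumes "\<omega> \<in> space M"
  shows "birth_time T \<omega> (rev l @ u) \<le> t \<Longrightarrow>
    position X T x0 (rev l @ u) t \<omega> = birth_place X T x0 \<omega> u + position_at (t - birth_time T \<omega> u) (marked_tree X T N \<omega> u) l"
proof (induction l arbitrary: u)
  case Nil
  then show ?case by (simp add: position_def marked_tree_Nil eval_sample_path[OF assms])
next
  case (Cons k l)
  show ?case using Cons.IH[of "k # u"] Cons.prems lifetime_pos[OF assms, of u]
    by (simp add: marked_tree_Nil subtree_marked_tree diff_diff_eq eval_sample_path[OF assms])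
qed

lemma survives_imp_not_extinct:
  assumes "survives T N \<omega>"
  shows "\<not> extinct kids (marked_tree X T N \<omega> [])"
proof
  assume "extinct kids (marked_tree X T N \<omega> [])"
  then obtain t0 where t0: "\<And>t l. t \<ge> t0 \<Longrightarrow> \<not> alive_at t (marked_tree X T N \<omega> []) l"
    unfolding extinct_def using extinct_by_imp_not_alive by blast
  have "alive T N (max 0 t0) \<omega> \<noteq> {}" using assms by (simp add: survives_def)
  then obtain u where "u \<in> alive T N (max 0 t0) \<omega>" by blast
  then have "alive_at (max 0 t0) (marked_tree X T N \<omega> []) (rev u)"
    using alive_iff_alive_at[of "rev u" "[]" T N "max 0 t0" \<omega> X] by simp
  with t0[of "max 0 t0"] show False by simp
qed

lemma positions_eq:
  assumes "\<omega> \<in> space M"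
  shows "(\<lambda>u. position X T x0 u t \<omega>) ` alive T N t \<omega>
    = (\<lambda>l. x0 + position_at t (marked_tree X T N \<omega> []) l) ` {l. alive_at t (marked_tree X T N \<omega> []) l}"
proof -
  have iff: "u \<in> alive T N t \<omega> \<longleftrightarrow> alive_at t (marked_tree X T N \<omega> []) (rev u)" for u
    using alive_iff_alive_at[of "rev u" "[]" T N t \<omega> X] by simp
  have pos: "position X T x0 u t \<omega> = x0 + position_at t (marked_tree X T N \<omega> []) (rev u)" if "u \<in> alive T N t \<omega>" for u
    using position_eq_position_at[OF assms, of "rev u" "[]" t x0] that by (simp add: alive_def)
  have "alive T N t \<omega> = rev ` {l. alive_at t (marked_tree X T N \<omega> []) l}"
  proof (rule set_eqI)
    fix u show "u \<in> alive T N t \<omega> \<longleftrightarrow> u \<in> rev ` {l. alive_at t (marked_tree X T N \<omega> []) l}"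
      using imageI[of "rev u" "{l. alive_at t (marked_tree X T N \<omega> []) l}" rev] by (auto simp: iff)
  qed
  then show ?thesis using pos by (auto simp: image_image)
qed

lemma sample_path_measurable[measurable]: "sample_path (X u) \<in> M \<rightarrow>\<^sub>M path_space"
  unfolding sample_path_def[abs_def] path_space_def
  by (rule measurable_restrict, rule levy_process.measurable[OF levy]) simp

lemma mark_measurable[measurable]: "mark (X u) (T u) (N u) \<in> M \<rightarrow>\<^sub>M mark_space"
proof -
  have [measurable]: "T u \<in> borel_measurable M" "N u \<in> M \<rightarrow>\<^sub>M count_space UNIV"
    by (rule lifetime_measurable offspring_measurable)+
  show ?thesis unfolding mark_def[abs_def] mark_space_def by measurable
qed

definition mark_law :: "mark measure" where
  "mark_law = distr M mark_space (mark (X []) (T []) (N []))"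

lemma mark_law_sets: "sets mark_law = sets mark_space"
  by (simp add: mark_law_def)

lemma mark_measurable_mark_law: "mark (X u) (T u) (N u) \<in> M \<rightarrow>\<^sub>M mark_law"
  using mark_measurable[of u] by (simp add: measurable_cong_sets[OF refl mark_law_sets])

lemma marked_tree_measurable:
  "(\<lambda>\<omega>. marked_tree X T N \<omega> []) \<in> M \<rightarrow>\<^sub>M (\<Pi>\<^sub>M l\<in>UNIV. mark_law)"
  unfolding marked_tree_def
  by (rule measurable_PiM_single') (auto intro: measurable_space[OF mark_measurable_mark_law] mark_measurable_mark_law)

lemma distr_marked_tree:
  "distr M (\<Pi>\<^sub>M l\<in>UNIV. mark_law) (\<lambda>\<omega>. marked_tree X T N \<omega> []) = (\<Pi>\<^sub>M l\<in>UNIV. mark_law)"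
proof -
  have law: "distr M mark_space (mark (X v) (T v) (N v)) = mark_law" for v
    unfolding mark_law_def by (rule same_law)
  have prob: "prob_space mark_law" unfolding mark_law_def by (rule prob_space_distr) measurable
  have "distr M (\<Pi>\<^sub>M v\<in>UNIV. mark_space) (\<lambda>\<omega>. \<lambda>v\<in>UNIV. mark (X v) (T v) (N v) \<omega>)
      = (\<Pi>\<^sub>M v\<in>UNIV. distr M mark_space (mark (X v) (T v) (N v)))"
    using indep_labels by (subst (asm) indep_vars_iff_distr_eq_PiM) auto
  then have labels: "distr M (\<Pi>\<^sub>M v\<in>UNIV. mark_space) (\<lambda>\<omega> v. mark (X v) (T v) (N v) \<omega>) = (\<Pi>\<^sub>M v\<in>UNIV. mark_law)"
    by (simp add: law restrict_UNIV)
  have rev: "distr (\<Pi>\<^sub>M v\<in>UNIV. mark_law) (\<Pi>\<^sub>M v\<in>UNIV. mark_law) (\<lambda>\<tau> l. \<tau> (rev l)) = (\<Pi>\<^sub>M v\<in>UNIV. mark_law)"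
    using distr_PiM_reindex[of UNIV "\<lambda>_. mark_law" rev UNIV] prob by (simp add: restrict_UNIV)
  have sets: "sets (\<Pi>\<^sub>M v\<in>UNIV. mark_space) = sets (\<Pi>\<^sub>M v\<in>(UNIV :: label set). mark_law)"
    by (intro sets_PiM_cong) (auto simp: mark_law_sets)
  have all_measurable: "(\<lambda>\<omega> v. mark (X v) (T v) (N v) \<omega>) \<in> M \<rightarrow>\<^sub>M (\<Pi>\<^sub>M v\<in>UNIV. mark_space)"
    by (rule measurable_PiM_single') (auto intro: measurable_space[OF mark_measurable] mark_measurable)
  have rev_measurable: "(\<lambda>\<tau> l. \<tau> (rev l)) \<in> (\<Pi>\<^sub>M v\<in>UNIV. mark_space) \<rightarrow>\<^sub>M (\<Pi>\<^sub>M v\<in>UNIV. mark_law)"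
  proof (rule measurable_PiM_single')
    show "(\<lambda>\<tau>. \<tau> (rev l)) \<in> (\<Pi>\<^sub>M v\<in>UNIV. mark_space) \<rightarrow>\<^sub>M mark_law" for l
      unfolding measurable_cong_sets[OF refl mark_law_sets] by (rule measurable_component_singleton) simp
    show "(\<lambda>\<tau> l. \<tau> (rev l)) \<in> space (\<Pi>\<^sub>M v\<in>UNIV. mark_space) \<rightarrow> (\<Pi>\<^sub>E l\<in>UNIV. space mark_law)"
      by (auto simp: space_PiM mark_law_def)
  qed
  have "distr M (\<Pi>\<^sub>M l\<in>UNIV. mark_law) (\<lambda>\<omega>. marked_tree X T N \<omega> [])
      = distr (distr M (\<Pi>\<^sub>M v\<in>UNIV. mark_space) (\<lambda>\<omega> v. mark (X v) (T v) (N v) \<omega>)) (\<Pi>\<^sub>M l\<in>UNIV. mark_law) (\<lambda>\<tau> l. \<tau> (rev l))"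
    by (subst distr_distr[OF rev_measurable all_measurable]) (simp add: comp_def marked_tree_def[abs_def])
  also have "\<dots> = (\<Pi>\<^sub>M l\<in>UNIV. mark_law)"
    unfolding labels by (rule rev)
  finally show ?thesis .
qed

lemma distr_lifetime: "distr M borel (T u) = density lborel (exponential_density rate)"
proof -
  have [measurable]: "T u \<in> borel_measurable M" by (rule lifetime_measurable)
  have "distributed M lborel (T u) (exponential_density rate)"
  proof (rule exponential_distributedI)
    fix a :: real assume a: "0 \<le> a"
    have "prob {\<omega> \<in> space M. T u \<omega> \<le> a} = 1 - prob {\<omega> \<in> space M. T u \<omega> > a}"
      by (subst prob_neg[symmetric]) (auto simp: not_less)
    then show "emeasure M {\<omega> \<in> space M. T u \<omega> \<le> a} = 1 - ennreal (exp (- a * rate))"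
      using lifetime_exponential[OF a, of u]
      by (simp add: emeasure_eq_measure mult.commute ennreal_minus flip: ennreal_1)
  qed (use rate_pos in auto)
  then have "distr M lborel (T u) = density lborel (exponential_density rate)"
    by (rule distributed_distr_eq_density)
  then show ?thesis by (simp cong: distr_cong)
qed

lemma branching_tree_mark_law:
  assumes N_int: "integrable M (\<lambda>\<omega>. real (N [] \<omega>))" and \<mu>: "\<mu> = (\<integral>\<omega>. real (N [] \<omega>) \<partial>M) - 1" "\<mu> > 0"
  shows "branching_tree (distr M path_space (sample_path (X []))) (distr M borel (T []))
    (distr M (count_space UNIV) (N [])) mark_law rate \<mu> (cgf M (X []))"
proof -
  have [measurable]: "T [] \<in> borel_measurable M" "N [] \<in> M \<rightarrow>\<^sub>M count_space UNIV"
    by (rule lifetime_measurable offspring_measurable)+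
  interpret X: levy_process M "X []" by (rule levy)
  have mgf: "(\<integral>\<^sup>+p. ennreal (exp (\<theta> * eval_path p s)) \<partial>distr M path_space (sample_path (X []))) = exp_ereal (ereal s * cgf M (X []) \<theta>)"
    if "s \<ge> 0" for s \<theta>
  proof -
    have "(\<integral>\<^sup>+p. ennreal (exp (\<theta> * eval_path p s)) \<partial>distr M path_space (sample_path (X [])))
        = (\<integral>\<^sup>+\<omega>. ennreal (exp (\<theta> * eval_path (sample_path (X []) \<omega>) s)) \<partial>M)"
      by (subst nn_integral_distr) auto
    also have "\<dots> = X.mgf \<theta> s"
      unfolding X.mgf_def using that by (intro nn_integral_cong) (simp add: eval_sample_path)
    finally show ?thesis using X.mgf_eq_cgf(1)[OF that] by simp
  qed
  have mean: "(\<integral>\<^sup>+n. of_nat n \<partial>distr M (count_space UNIV) (N [])) = ennreal (1 + \<mu>)"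
  proof -
    have "(\<integral>\<^sup>+n. of_nat n \<partial>distr M (count_space UNIV) (N [])) = (\<integral>\<^sup>+\<omega>. ennreal (real (N [] \<omega>)) \<partial>M)"
      by (subst nn_integral_distr) (auto simp: ennreal_of_nat_eq_real_of_nat)
    also have "\<dots> = ennreal (1 + \<mu>)" using N_int by (subst nn_integral_eq_integral) (auto simp: \<mu>(1))
    finally show ?thesis .
  qed
  have bounded_below: "AE m in mark_law. \<exists>D::nat. \<forall>q::rat. 0 \<le> q \<longrightarrow> real_of_rat q < life m \<longrightarrow> - real D \<le> motion m (real_of_rat q)"
  proof -
    have "Measurable.pred mark_space (\<lambda>m. 0 \<le> q \<longrightarrow> real_of_rat q < life m \<longrightarrow> - real D \<le> motion m (real_of_rat q))" for q and D :: nat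
    proof (cases "0 \<le> q")
      case True
      have "(\<lambda>p. p (real_of_rat q)) \<in> path_space \<rightarrow>\<^sub>M borel"
        unfolding path_space_def using True by (intro measurable_component_singleton) simp
      moreover have "motion \<in> mark_space \<rightarrow>\<^sub>M path_space" "(\<lambda>m. life m) \<in> borel_measurable mark_space"
        by (simp_all add: mark_space_def)
      ultimately show ?thesis by measurable
    qed simp
    note [measurable] = this
    have sets: "{m \<in> space mark_space. \<exists>D::nat. \<forall>q. 0 \<le> q \<longrightarrow> real_of_rat q < life m \<longrightarrow> - real D \<le> motion m (real_of_rat q)} \<in> sets mark_space"
      by measurable
    have "\<exists>D::nat. \<forall>q. 0 \<le> q \<longrightarrow> real_of_rat q < T [] \<omega> \<longrightarrow> - real D \<le> sample_path (X []) \<omega> (real_of_rat q)" if \<omega>: "\<omega> \<in> space M" for \<omega>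
    proof -
      obtain D where D: "\<forall>s\<in>{0..T [] \<omega>}. D \<le> X [] s \<omega>"
        using cadlag_bounded_below[OF X.paths[OF \<omega>], of "T [] \<omega>"] lifetime_pos[OF \<omega>, of "[]"] by auto
      obtain n :: nat where "- D < real n" using reals_Archimedean2 by blast
      then have "- real n \<le> sample_path (X []) \<omega> (real_of_rat q)" if "0 \<le> q" "real_of_rat q < T [] \<omega>" for q
        using D[rule_format, of "real_of_rat q"] that by (simp add: sample_path_def)
      then show ?thesis by blast
    qed
    then show ?thesis
      unfolding mark_law_def AE_distr_iff[OF mark_measurable sets] by (intro AE_I2) simp
  qed
  have K: "cgf M (X []) \<theta> \<noteq> -\<infinity>" for \<theta>
    using X.mgf_eq_cgf(2)[of 1] by simp
  show ?thesis
  proof (intro branching_tree.intro branching_tree_axioms.intro)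
    show "mark_law = distr M path_space (sample_path (X [])) \<Otimes>\<^sub>M distr M borel (T []) \<Otimes>\<^sub>M distr M (count_space UNIV) (N [])"
      unfolding mark_law_def by (rule indep_mark)
    show "sets (distr M path_space (sample_path (X []))) = sets path_space"
      and "sets (distr M (count_space UNIV) (N [])) = sets (count_space UNIV)" by simp_all
    show "prob_space (distr M path_space (sample_path (X [])))"
      by (rule prob_space_distr) (rule sample_path_measurable)
    show "prob_space (distr M borel (T []))" by (rule prob_space_distr) (rule lifetime_measurable)
    show "prob_space (distr M (count_space UNIV) (N []))" by (rule prob_space_distr) (rule offspring_measurable)
    show "distr M borel (T []) = density lborel (exponential_density rate)" by (rule distr_lifetime)
    show "rate > 0" by (rule rate_pos)
    show "\<mu> > 0" by (rule \<mu>(2))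
    show "cgf M (X []) \<theta> \<noteq> -\<infinity>" for \<theta> by (rule K)
    show "(\<integral>\<^sup>+p. ennreal (exp (\<theta> * eval_path p s)) \<partial>distr M path_space (sample_path (X []))) = exp_ereal (ereal s * cgf M (X []) \<theta>)"
      if "s \<ge> 0" for s \<theta> using that by (rule mgf)
    show "(\<integral>\<^sup>+n. of_nat n \<partial>distr M (count_space UNIV) (N [])) = ennreal (1 + \<mu>)" by (rule mean)
    show "AE m in mark_law. \<exists>D::nat. \<forall>q::rat. 0 \<le> q \<longrightarrow> real_of_rat q < life m \<longrightarrow> - real D \<le> motion m (real_of_rat q)"
      by (rule bounded_below)
  qed
qed

end

section \<open>The speed of the rightmost particle\<close>

text \<open>
  Covering the deviation event by a measurable set of small probability suffices even where that event is not
  measurable, because \<open>prob\<close> assigns \<open>0\<close> to sets that are not measurable.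
\<close>
lemma (in prob_space) cond_converges_in_probI:
  assumes "\<And>\<epsilon> \<delta>. \<epsilon> > 0 \<Longrightarrow> \<delta> > 0 \<Longrightarrow>
    \<forall>\<^sub>F t in at_top. \<exists>B\<in>events. {\<omega> \<in> space M. \<bar>Y t \<omega> - c\<bar> > \<epsilon> \<and> Q \<omega>} \<subseteq> B \<and> prob B < \<delta>"
  shows "cond_converges_in_prob M Q Y c"
  unfolding cond_converges_in_prob_def
proof (intro allI impI)
  fix \<epsilon> :: real assume \<epsilon>: "\<epsilon> > 0"
  have "((\<lambda>t. \<P>(\<omega> in M. \<bar>Y t \<omega> - c\<bar> > \<epsilon> \<and> Q \<omega>)) \<longlongrightarrow> 0) at_top"
  proof (rule tendstoI)
    fix \<delta> :: real assume "\<delta> > 0"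
    from assms[OF \<epsilon> this] show "\<forall>\<^sub>F t in at_top. dist \<P>(\<omega> in M. \<bar>Y t \<omega> - c\<bar> > \<epsilon> \<and> Q \<omega>) 0 < \<delta>"
    proof eventually_elim
      case (elim t)
      then obtain B where B: "B \<in> events" "{\<omega> \<in> space M. \<bar>Y t \<omega> - c\<bar> > \<epsilon> \<and> Q \<omega>} \<subseteq> B" "prob B < \<delta>" by blast
      have "\<P>(\<omega> in M. \<bar>Y t \<omega> - c\<bar> > \<epsilon> \<and> Q \<omega>) \<le> prob B"
        using B(1,2) by (rule finite_measure_mono[rotated])
      with B(3) show ?case by simp
    qed
  qed
  then have "((\<lambda>t. \<P>(\<omega> in M. \<bar>Y t \<omega> - c\<bar> > \<epsilon> \<and> Q \<omega>) / \<P>(\<omega> in M. Q \<omega>)) \<longlongrightarrow> 0) at_top"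
    by (rule tendsto_divide_zero)
  then show "((\<lambda>t. \<P>(\<omega> in M. \<bar>Y t \<omega> - c\<bar> > \<epsilon> \<bar> Q \<omega>)) \<longlongrightarrow> 0) at_top"
    by (simp add: cond_prob_def)
qed

lemma eventually_linear_ge:
  fixes d e :: real
  assumes "d > 0"
  shows "\<forall>\<^sub>F t in at_top. e \<le> d * t"
  using eventually_ge_at_top[of "e / d"] by eventually_elim (use assms in \<open>simp add: divide_le_eq mult.commute\<close>)

theorem theorem1p5:
  fixes M :: "'a measure" and X :: "label \<Rightarrow> real \<Rightarrow> 'a \<Rightarrow> real"
    and T :: "label \<Rightarrow> 'a \<Rightarrow> real" and N :: "label \<Rightarrow> 'a \<Rightarrow> nat"
    and rate x0 \<mu> :: real and K :: "real \<Rightarrow> ereal"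
  assumes "branching_levy_process M X T N rate"
    and "K = cgf M (X [])"
    and "\<forall>\<^sub>F \<theta> in nhds 0. \<bar>K \<theta>\<bar> \<noteq> \<infinity>"
    and "integrable M (\<lambda>\<omega>. real (N [] \<omega>))"
    and "\<mu> = (\<integral>\<omega>. real (N [] \<omega>) \<partial>M) - 1"
    and "\<mu> > 0"
  shows "cond_converges_in_prob M (survives T N)
    (\<lambda>t \<omega>. 1 / t * Max ((\<lambda>u. position X T x0 u t \<omega>) ` alive T N t \<omega>))
    (speed K rate \<mu>)"
proof -
  interpret B: branching_levy_process M X T N rate by (rule assms(1))
  interpret tree: branching_tree "distr M path_space (sample_path (X []))" "distr M borel (T [])"
    "distr M (count_space UNIV) (N [])" B.mark_law rate \<mu> K
    unfolding assms(2) using assms(4-6) by (rule B.branching_tree_mark_law)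
  let ?P = "\<Pi>\<^sub>M l\<in>UNIV. B.mark_law"
  define tr where "tr \<omega> = marked_tree X T N \<omega> []" for \<omega>
  define c where "c = speed K rate \<mu>"
  have tr_measurable[measurable]: "tr \<in> M \<rightarrow>\<^sub>M ?P"
    unfolding tr_def[abs_def] by (rule B.marked_tree_measurable)
  have distr_tr: "distr M ?P tr = ?P"
    unfolding tr_def[abs_def] by (rule B.distr_marked_tree)
  have prob_tr: "measure M (tr -` S \<inter> space M) = measure ?P S" if "S \<in> sets ?P" for S
    using measure_distr[OF tr_measurable that] by (simp add: distr_tr)
  have "rate * \<mu> > 0" using B.rate_pos assms(6) by simp
  then obtain L where "\<And>\<theta>. \<theta> > 0 \<Longrightarrow> ereal (- L * \<theta> - rate * \<mu>) \<le> K \<theta>"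
    unfolding assms(2) by (rule levy_process.cgf_lower_bound[OF B.levy[of "[]"]]) blast
  then have speed: "ereal (speed K rate \<mu>) = (INF \<theta>\<in>{0<..}. (K \<theta> + ereal (rate * \<mu>)) / ereal \<theta>)"
    using assms(3) by (intro speed_finite)
  show ?thesis
    unfolding c_def[symmetric]
  proof (rule B.cond_converges_in_probI)
    fix \<epsilon> \<delta> :: real assume \<epsilon>: "\<epsilon> > 0" and \<delta>: "\<delta> > 0"
    \<comment> \<open>The particles of \<open>fast_particles_on_survival\<close> have speed \<open>c - \<epsilon> / 2\<close>, which leaves the margin \<open>\<epsilon> / 2 * t\<close>
      for the constants.\<close>
    obtain E C where E: "\<And>j. Measurable.pred ?P (E j)" "\<And>j \<tau>. E j \<tau> \<Longrightarrow> E (Suc j) \<tau>"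
      "\<P>(\<tau> in ?P. \<not> extinct kids \<tau> \<and> (\<forall>j. \<not> E j \<tau>)) = 0"
      and fast: "\<And>j \<tau> t. E j \<tau> \<Longrightarrow> regular_tree \<tau> \<Longrightarrow> t \<ge> real j \<Longrightarrow>
        \<exists>l. alive_at t \<tau> l \<and> (c - \<epsilon> / 2) * t - (1 + \<bar>c - \<epsilon> / 2\<bar>) * real j - C \<le> position_at t \<tau> l"
    proof (rule tree.fast_particles_on_survival[of "c - \<epsilon> / 4" "c - \<epsilon> / 2"])
      show "ereal ((c - \<epsilon> / 4) * \<theta>) < K \<theta> + ereal (rate * \<mu>)" if "\<theta> > 0" for \<theta>
        using \<epsilon> that by (intro below_speed[OF speed]) (auto simp: c_def)
    qed (use \<epsilon> in auto)
    note [measurable] = E(1) tree.extinct_measurable[OF tree.kids_measurable]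
    let ?S = "\<lambda>j. {\<tau> \<in> space ?P. \<not> extinct kids \<tau> \<and> \<not> E j \<tau>}"
    have "(\<lambda>j. measure ?P (?S j)) \<longlonglongrightarrow> measure ?P (\<Inter>j. ?S j)"
      by (rule tree.tree.finite_Lim_measure_decseq) (auto simp: decseq_Suc_iff dest: E(2))
    also have "(\<Inter>j. ?S j) = {\<tau> \<in> space ?P. \<not> extinct kids \<tau> \<and> (\<forall>j. \<not> E j \<tau>)}" by auto
    finally have "(\<lambda>j. measure ?P (?S j)) \<longlonglongrightarrow> 0" using E(3) by simp
    then have "\<forall>\<^sub>F j in sequentially. measure ?P (?S j) < \<delta> / 2"
      by (rule order_tendstoD) (use \<delta> in simp)
    then obtain j where j: "measure ?P (?S j) < \<delta> / 2" by (auto simp: eventually_sequentially)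
    \<comment> \<open>An exponent at which the mean of the exponential sum grows more slowly than \<open>exp (\<theta> (c + \<epsilon>) t)\<close>.\<close>
    obtain \<theta> \<kappa> where \<theta>: "\<theta> > 0" "K \<theta> = ereal \<kappa>" "\<kappa> + rate * \<mu> < (c + \<epsilon>) * \<theta>"
      using above_speed[OF speed tree.K_finite_below, of "c + \<epsilon>"] \<epsilon> by (auto simp: c_def)
    define D where "D = (1 + \<bar>c - \<epsilon> / 2\<bar>) * real j + C - x0"
    have "\<forall>\<^sub>F t in at_top. D \<le> \<epsilon> / 2 * t" by (rule eventually_linear_ge) (use \<epsilon> in simp)
    moreover have "\<forall>\<^sub>F t in at_top. \<theta> * x0 - ln (\<delta> / 2) + 1 \<le> ((c + \<epsilon>) * \<theta> - (\<kappa> + rate * \<mu>)) * t"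
      by (rule eventually_linear_ge) (use \<theta> in simp)
    moreover have "\<forall>\<^sub>F t in at_top. max 1 (real j) \<le> t" by (rule eventually_ge_at_top)
    ultimately show "\<forall>\<^sub>F t in at_top. \<exists>S\<in>sets M.
      {\<omega> \<in> space M. \<bar>1 / t * Max ((\<lambda>u. position X T x0 u t \<omega>) ` alive T N t \<omega>) - c\<bar> > \<epsilon> \<and> survives T N \<omega>} \<subseteq> S
      \<and> measure M S < \<delta>"
    proof eventually_elim
      case (elim t)
      then have t: "t \<ge> 0" "t \<ge> real j" "t > 0" by auto
      obtain S where S: "S \<in> sets ?P" "emeasure ?P S \<le> ennreal (exp ((\<kappa> + rate * \<mu>) * t - \<theta> * ((c + \<epsilon>) * t - x0)))"
        "\<And>\<tau> l. \<tau> \<in> space ?P \<Longrightarrow> \<tau> \<notin> S \<Longrightarrow> alive_at t \<tau> l \<Longrightarrow> position_at t \<tau> l < (c + \<epsilon>) * t - x0"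
        using tree.alive_above_tail[OF \<theta>(2) t(1) \<theta>(1), of "(c + \<epsilon>) * t - x0"] by blast
      obtain Z where Z: "Z \<in> null_sets ?P" "\<And>\<tau>. \<tau> \<in> space ?P \<Longrightarrow> \<tau> \<notin> Z \<Longrightarrow> finite {l. alive_at t \<tau> l}"
        using tree.AE_finite_alive[OF t(1)] by (auto elim!: AE_E3)
      have S_small: "measure ?P S < \<delta> / 2"
      proof -
        have "measure ?P S \<le> exp ((\<kappa> + rate * \<mu>) * t - \<theta> * ((c + \<epsilon>) * t - x0))"
          using S(2) by (simp add: tree.tree.emeasure_eq_measure)
        also have "(\<kappa> + rate * \<mu>) * t - \<theta> * ((c + \<epsilon>) * t - x0) < ln (\<delta> / 2)"
          using elim(2) by (simp add: algebra_simps)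
        then have "exp ((\<kappa> + rate * \<mu>) * t - \<theta> * ((c + \<epsilon>) * t - x0)) < \<delta> / 2"
          using \<delta> by (metis exp_less_mono exp_ln half_gt_zero)
        finally show ?thesis .
      qed
      \<comment> \<open>Outside of this set the maximum is taken over a finite set, it is smaller than \<open>(c + \<epsilon>) t\<close>, and fast
        particles exist on survival.\<close>
      let ?bad = "S \<union> Z \<union> ?S j"
      have bad: "?bad \<in> sets ?P" using S(1) Z(1) by auto
      have "measure ?P ?bad \<le> measure ?P S + measure ?P Z + measure ?P (?S j)"
        using S(1) Z(1) by (intro order_trans[OF measure_Un_le] add_mono measure_Un_le) auto
      also have "\<dots> < \<delta>" using S_small j measure_eq_0_null_sets[OF Z(1)] by simp
      finally have small: "measure M (tr -` ?bad \<inter> space M) < \<delta>" using prob_tr[OF bad] by simp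
      have "\<bar>1 / t * Max ((\<lambda>u. position X T x0 u t \<omega>) ` alive T N t \<omega>) - c\<bar> \<le> \<epsilon>"
        if \<omega>: "\<omega> \<in> space M" and surv: "survives T N \<omega>" and good: "tr \<omega> \<notin> ?bad" for \<omega>
      proof -
        let ?A = "{l. alive_at t (tr \<omega>) l}"
        let ?m = "Max ((\<lambda>u. position X T x0 u t \<omega>) ` alive T N t \<omega>)"
        have space: "tr \<omega> \<in> space ?P" by (rule measurable_space[OF tr_measurable \<omega>])
        have eq: "(\<lambda>u. position X T x0 u t \<omega>) ` alive T N t \<omega> = (\<lambda>l. x0 + position_at t (tr \<omega>) l) ` ?A"
          unfolding tr_def by (rule B.positions_eq[OF \<omega>])
        have "E j (tr \<omega>)"
          using good space B.survives_imp_not_extinct[OF surv] by (auto simp: tr_def)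
        then obtain l where l: "alive_at t (tr \<omega>) l"
          "(c - \<epsilon> / 2) * t - (1 + \<bar>c - \<epsilon> / 2\<bar>) * real j - C \<le> position_at t (tr \<omega>) l"
          using fast[of j "tr \<omega>" t] B.regular_marked_tree[OF \<omega>] t(2) unfolding tr_def by blast
        have fin: "finite ?A" using Z(2)[OF space] good by auto
        have "?m \<in> (\<lambda>l. x0 + position_at t (tr \<omega>) l) ` ?A"
          unfolding eq by (rule Max_in) (use fin l(1) in auto)
        then obtain l' where "alive_at t (tr \<omega>) l'" "?m = x0 + position_at t (tr \<omega>) l'" by auto
        then have "?m \<le> (c + \<epsilon>) * t"
          using S(3)[OF space] good by fastforce
        moreover have "x0 + position_at t (tr \<omega>) l \<le> ?m"
          unfolding eq by (rule Max_ge) (use fin l(1) in auto)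
        then have "(c - \<epsilon>) * t \<le> ?m" using l(2) elim(1) unfolding D_def by (simp add: algebra_simps)
        ultimately have "1 / t * ?m \<le> c + \<epsilon>" "c - \<epsilon> \<le> 1 / t * ?m"
          using t(3) by (auto simp: divide_le_eq le_divide_eq)
        then show ?thesis by (simp add: abs_le_iff)
      qed
      then have "{\<omega> \<in> space M. \<bar>1 / t * Max ((\<lambda>u. position X T x0 u t \<omega>) ` alive T N t \<omega>) - c\<bar> > \<epsilon> \<and> survives T N \<omega>}
        \<subseteq> tr -` ?bad \<inter> space M" by (auto simp: not_le[symmetric])
      moreover have "tr -` ?bad \<inter> space M \<in> sets M" using tr_measurable bad by (rule measurable_sets)
      ultimately show ?case using small by blast
    qed
  qed
qed

end
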